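(* Let $D=[0,\pi]$. For any $T>0$, $H\in(\tfrac12,1)$ and any $p\ge2$, there exists a constant $c_1=c_1(H,p,T)>0$ such that, for every $0\le\zeta\le t\le T$, $$E\Bigg(\bigg\|\int_\zeta^t\int_DG(\cdot,y,t-s)\,W_H(dy,ds)\bigg\|_{L^\infty(D)}^p\Bigg)\le c_1\,(t-\zeta)^{\frac{p(5H-2)}{4}}.$$ Furthermore, there exists a constant $c_2=c_2(H)>0$ such that, for every $0\le\zeta\le t\le T$, $$\int_0^T\int_D\Big\|\big[K_H^*\big(G(\cdot,\diamond,t-\bullet)\mathbf 1_{[\zeta,t]}(\bullet)\big)\big](y,s)\Big\|^2_{L^\infty(D)}\,dyds\le c_2\,(t-\zeta)^{\frac{4H-1}{2}}.$$
   Context: **Notation.** The symbols $\cdot,\diamond,\bullet$ are placeholders for the variables $x,y,s$ respectively; $L^\infty(D)$ norms are taken in $x$, while the operator $K_H^*$ acts on functions of $(y,s)$, with $x$ as a parameter. **Green's function.** $G(x,y,t)=\sum_{k=0}^\infty e^{-k^4t}a_k(x)a_k(y)$ for $x,y\in D$, $t>0$, where $a_0=\frac1{\sqrt\pi}$, $a_k(x)=\sqrt{\tfrac2\pi}\cos(kx)$ for $k\ge1$. **Noise.** On a complete probability space, $\{W_H(U\times[0,t]): U\in\mathcal B(D),\,t\in[0,T]\}$ is a centered Gaussian random field with covariance $E\big(W_H(U\times[0,t])W_H(V\times[0,s])\big)=m(U\cap V)\,\frac{t^{2H}+s^{2H}-|t-s|^{2H}}{2}$, $m$ being Lebesgue measure.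 Let $\mathcal H$ be the Hilbert space closure of the step functions on $D\times[0,T]$ under $\langle \mathbf 1_{U\times[0,t]},\mathbf 1_{V\times[0,s]}\rangle_{\mathcal H}=E\big(W_H(U\times[0,t])W_H(V\times[0,s])\big)$. The map $\mathbf 1_{U\times[0,t]}\mapsto W_H(U\times[0,t])$ extends to an isometry $\hat W_H$ from $\mathcal H$ onto a closed subspace of $L^2(\Omega)$, and one writes $\int_0^T\int_D\phi(y,s)\,W_H(dy,ds):=\hat W_H(\phi)$; integrals over $[\zeta,t]$ are obtained by inserting $\mathbf 1_{[\zeta,t]}(s)$ in the integrand. **Operator $K_H^*$.** $[K_H^*(\phi)](y,s)=\int_s^T\phi(y,r)\frac{\partial K_H}{\partial r}(r,s)\,dr$, where $\frac{\partial K_H}{\partial r}(r,s)=c(H)\big(\tfrac rs\big)^{H-\frac12}(r-s)^{H-\frac32}$ for $0<s<r\le T$ and $c(H)=\Big(\frac{H(2H-1)}{\mathrm B(2-2H,H-\frac12)}\Big)^{1/2}$ ($\mathrm B$ is the beta function). It extends to an isometry from $\mathcal H$ onto $L^2(D\times[0,T])$.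
   Formalization: The constant c_2 is allowed to depend on T as well as on H; with c_2 = c_2(H) alone the second bound fails for ζ=0, t=T and large T, since the k=0 mode makes the left side at least T^{2H}/π. *)

theory Defs
  imports "HOL-Probability.Probability"
begin

definition space_dom :: "real set" where
  "space_dom = {0..pi}"

definition dom_measure :: "real measure" where
  "dom_measure = restrict_space lborel space_dom"

definition cyl_measure :: "real \<Rightarrow> (real \<times> real) measure" where
  "cyl_measure T = restrict_space lborel (space_dom \<times> {0..T})"

text \<open>The norm is an essential supremum, with value \<^term>\<open>top\<close> for functions that are not
  essentially bounded or not measurable.\<close>

definition linf_norm :: "(real \<Rightarrow> real) \<Rightarrow> ennreal" where
  "linf_norm f = esssup dom_measure (\<lambda>x. ennreal \<bar>f x\<bar>)"

definition ennreal_powr :: "ennreal \<Rightarrow> real \<Rightarrow> ennreal" where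
  "ennreal_powr a p = (if a = top then top else ennreal (enn2real a powr p))"


section \<open>Green's function\<close>

definition eigenfun :: "nat \<Rightarrow> real \<Rightarrow> real" where
  "eigenfun k x = (if k = 0 then 1 / sqrt pi else sqrt (2 / pi) * cos (real k * x))"

text \<open>The series is only used for positive times; the value 0 elsewhere is a convention, and
  integrals up to the singular time do not see it.\<close>

definition green :: "real \<Rightarrow> real \<Rightarrow> real \<Rightarrow> real" where
  "green x y t =
     (if t > 0 then (\<Sum>k. exp (- (real k ^ 4) * t) * eigenfun k x * eigenfun k y) else 0)"

definition green_kernel :: "real \<Rightarrow> real \<Rightarrow> real \<Rightarrow> real \<times> real \<Rightarrow> real" where
  "green_kernel \<zeta> t x = (\<lambda>(y, s). green x y (t - s) * indicator {\<zeta>..t} s)"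


section \<open>Step functions and the inner product of the Hilbert space of the noise\<close>

text \<open>The entry \<open>(c, U, t)\<close> of a list stands for \<open>c\<close> times the indicator function of
  \<open>U \<times> {0..t}\<close>, and the list for the sum of its entries. Different lists representing the
  same function have distance 0.\<close>

type_synonym step = "(real \<times> real set \<times> real) list"

definition is_step :: "real \<Rightarrow> step \<Rightarrow> bool" where
  "is_step T \<phi> \<longleftrightarrow> (\<forall>(c, U, t) \<in> set \<phi>. U \<in> sets borel \<and> U \<subseteq> space_dom \<and> 0 \<le> t \<and> t \<le> T)"

definition step_fun :: "step \<Rightarrow> real \<times> real \<Rightarrow> real" where
  "step_fun \<phi> z = (\<Sum>(c, U, t)\<leftarrow>\<phi>. c * indicator (U \<times> {0..t}) z)"

definition step_diff :: "step \<Rightarrow> step \<Rightarrow> step" where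
  "step_diff \<phi> \<psi> = \<phi> @ map (\<lambda>(c, U, t). (- c, U, t)) \<psi>"

definition noise_cov :: "real \<Rightarrow> real set \<Rightarrow> real \<Rightarrow> real set \<Rightarrow> real \<Rightarrow> real" where
  "noise_cov H U t V s =
     measure lborel (U \<inter> V) * ((t powr (2 * H) + s powr (2 * H) - \<bar>t - s\<bar> powr (2 * H)) / 2)"

definition step_inner :: "real \<Rightarrow> step \<Rightarrow> step \<Rightarrow> real" where
  "step_inner H \<phi> \<psi> =
     (\<Sum>(c, U, t)\<leftarrow>\<phi>. \<Sum>(d, V, s)\<leftarrow>\<psi>. c * d * noise_cov H U t V s)"

definition step_norm :: "real \<Rightarrow> step \<Rightarrow> real" where
  "step_norm H \<phi> = sqrt (step_inner H \<phi> \<phi>)"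

text \<open>An element of the completion is given by a Cauchy sequence of step functions.\<close>

definition step_Cauchy :: "real \<Rightarrow> real \<Rightarrow> (nat \<Rightarrow> step) \<Rightarrow> bool" where
  "step_Cauchy H T \<Phi> \<longleftrightarrow> (\<forall>n. is_step T (\<Phi> n)) \<and>
     (\<forall>e>0. \<exists>N. \<forall>m\<ge>N. \<forall>n\<ge>N. step_norm H (step_diff (\<Phi> m) (\<Phi> n)) < e)"


section \<open>The fractional noise\<close>

definition step_noise :: "((real \<times> real) set \<Rightarrow> 'w \<Rightarrow> real) \<Rightarrow> step \<Rightarrow> 'w \<Rightarrow> real" where
  "step_noise W \<phi> \<omega> = (\<Sum>(c, U, t)\<leftarrow>\<phi>. c * W (U \<times> {0..t}) \<omega>)"

definition centered_gaussian :: "'w measure \<Rightarrow> ('w \<Rightarrow> real) \<Rightarrow> bool" where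
  "centered_gaussian M X \<longleftrightarrow> X \<in> borel_measurable M \<and>
     ((AE \<omega> in M. X \<omega> = 0) \<or> (\<exists>\<sigma>>0. distributed M lborel X (normal_density 0 \<sigma>)))"

text \<open>A random field is Gaussian when all its finite linear combinations are Gaussian, possibly
  degenerate.\<close>

locale fractional_noise = prob_space M + complete_measure M
  for M :: "'w measure" +
  fixes W :: "(real \<times> real) set \<Rightarrow> 'w \<Rightarrow> real" and H T :: real
  assumes gaussian: "is_step T \<phi> \<Longrightarrow> centered_gaussian M (step_noise W \<phi>)"
    and covariance: "\<lbrakk>U \<in> sets borel; U \<subseteq> space_dom; V \<in> sets borel; V \<subseteq> space_dom; t \<in> {0..T}; s \<in> {0..T}\<rbrakk>
      \<Longrightarrow> (\<integral>\<omega>. W (U \<times> {0..t}) \<omega> * W (V \<times> {0..s}) \<omega> \<partial>M) = noise_cov H U t V s"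


section \<open>The operator \<open>KH_star\<close>\<close>

definition cH :: "real \<Rightarrow> real" where
  "cH H = sqrt (H * (2 * H - 1) / Beta (2 - 2 * H) (H - 1 / 2))"

definition dKH :: "real \<Rightarrow> real \<Rightarrow> real \<Rightarrow> real" where
  "dKH H r s = cH H * (r / s) powr (H - 1 / 2) * (r - s) powr (H - 3 / 2)"

definition KH_star :: "real \<Rightarrow> real \<Rightarrow> (real \<times> real \<Rightarrow> real) \<Rightarrow> real \<times> real \<Rightarrow> real" where
  "KH_star H T \<phi> = (\<lambda>(y, s). LBINT r:{s..T}. \<phi> (y, r) * dKH H r s)"

text \<open>A function \<open>\<phi>\<close> on the space-time cylinder is identified with the element of the Hilbert
  space given by the Cauchy sequence \<open>\<Phi>\<close> when the integral defining \<^term>\<open>KH_star H T \<phi>\<close>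
  exists almost everywhere and agrees with the image of that element under the extension of
  \<^term>\<open>KH_star H T\<close> to the completion, i.e. with the mean square limit of the images of \<open>\<Phi>\<close>.\<close>

definition represents :: "real \<Rightarrow> real \<Rightarrow> (nat \<Rightarrow> step) \<Rightarrow> (real \<times> real \<Rightarrow> real) \<Rightarrow> bool" where
  "represents H T \<Phi> \<phi> \<longleftrightarrow> step_Cauchy H T \<Phi> \<and>
     (AE (y, s) in cyl_measure T. set_integrable lborel {s..T} (\<lambda>r. \<phi> (y, r) * dKH H r s)) \<and>
     KH_star H T \<phi> \<in> borel_measurable (cyl_measure T) \<and>
     (\<lambda>n. \<integral>\<^sup>+ z. ennreal ((KH_star H T (step_fun (\<Phi> n)) z - KH_star H T \<phi> z)\<^sup>2) \<partial>cyl_measure T)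
       \<longlonglongrightarrow> 0"


section \<open>The stochastic integral\<close>

text \<open>The integral is determined up to almost sure equality: \<open>X\<close> is a version of the integral of
  \<open>\<phi>\<close> if it is the value at \<open>\<phi>\<close> of the isometric extension of \<^term>\<open>step_noise W\<close>.\<close>

definition noise_integral ::
  "'w measure \<Rightarrow> ((real \<times> real) set \<Rightarrow> 'w \<Rightarrow> real) \<Rightarrow> real \<Rightarrow> real \<Rightarrow>
    (real \<times> real \<Rightarrow> real) \<Rightarrow> ('w \<Rightarrow> real) \<Rightarrow> bool" where
  "noise_integral M W H T \<phi> X \<longleftrightarrow> X \<in> borel_measurable M \<and>
     (\<exists>\<Phi>. represents H T \<Phi> \<phi> \<and>
       (\<lambda>n. \<integral>\<^sup>+ \<omega>. ennreal ((step_noise W (\<Phi> n) \<omega> - X \<omega>)\<^sup>2) \<partial>M) \<longlonglongrightarrow> 0)"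

text \<open>For each \<open>x\<close> the stochastic convolution is only an almost sure class, so its norm in \<open>x\<close>
  needs a jointly measurable version. By Fubini any two such versions coincide, almost surely, for
  almost every \<open>x\<close>, and the essential supremum is a random variable which does not depend on the
  version up to null sets.\<close>

definition convolution_version ::
  "'w measure \<Rightarrow> ((real \<times> real) set \<Rightarrow> 'w \<Rightarrow> real) \<Rightarrow> real \<Rightarrow> real \<Rightarrow> real \<Rightarrow> real \<Rightarrow>
    ('w \<Rightarrow> real \<Rightarrow> real) \<Rightarrow> bool" where
  "convolution_version M W H T \<zeta> t Z \<longleftrightarrow>
     (\<lambda>(\<omega>, x). Z \<omega> x) \<in> borel_measurable (M \<Otimes>\<^sub>M dom_measure) \<and>
     (\<forall>x\<in>space_dom. noise_integral M W H T (green_kernel \<zeta> t x) (\<lambda>\<omega>. Z \<omega> x))"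

end

theory Submission
  imports Defs
begin

text \<open>Second estimate. The kernel of \<open>KH_star\<close> composed with its adjoint is
  \<open>H (2H - 1) |r - r'|^(2H - 2)\<close>, a beta integral. By Schur's test a function supported in the times
  \<open>[a, b]\<close> satisfies \<open>norm (KH_star f)^2 \<le> 4 H (b - a)^(2H - 1) norm f^2\<close> in \<open>L\<^sup>2\<close> of the cylinder. Since
  \<open>|G(x, y, u)| \<le> C u^(- 1/4)\<close> uniformly in \<open>x\<close> and \<open>y\<close>, the estimate follows.

  First estimate. The same kernel identity makes \<open>KH_star\<close> an isometry on step functions, so the
  integral of \<open>f\<close> has variance at most \<open>C norm (KH_star f)^2\<close>. The integral \<open>\<xi> k\<close> of the
  \<open>k\<close>-th mode of the Green kernel then has variance at most
  \<open>C \<tau>^(2H - 1) min \<tau> (k^(- 4)) \<le> C \<tau>^((5H - 2)/2) k^(- 2(2 - H))\<close> where \<open>\<tau> = t - \<zeta>\<close>.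
  Since \<open>2 - H > 1\<close>, the series \<open>\<Sum>k. a k x * \<xi> k\<close> converges absolutely and uniformly in \<open>x\<close>;
  it is a version of the convolution, dominated by \<open>\<Sum>k. |\<xi> k|\<close>, whose moments are controlled
  by Jensen's inequality with the weights \<open>k^(H - 2)\<close> and the Gaussian moments of \<open>\<xi> k\<close>.\<close>

section \<open>Riesz and beta integrals\<close>

text \<open>The supremum in x needs neither chaining nor a continuity criterion: each mode separates
  into \<open>eigenfun k x\<close> and a random variable free of x, and the eigenfunctions are
  bounded by 1, so everything rests on the size of the \<xi> k. The interpolation between \<tau> and
  k^(-4) has exactly the freedom required. With exponent H/2 on \<tau> the power of time is (2H - 1)
  + H/2 = (5H - 2)/2, the variance exponent that the claim demands, and a standard deviation of
  order k^(H - 2) is left for the k-th mode, summable because H < 1.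

  Integrals are specified only through Cauchy sequences of step functions. Instead of showing that
  the limits are again Gaussian and isometric, the bounds are kept up to constant factors and passed
  to the limit, in the end by Fatou's lemma. This is where several powers of 4 come from. Since
  \<open>KH_star\<close> is bounded on L2 of the cylinder, approximation in plain L2 suffices
  throughout.\<close>

lemma nn_integral_Beta:
  fixes a b :: real
  assumes "a > 0" "b > 0"
  shows "(\<integral>\<^sup>+ v. ennreal (v powr (a - 1) * (1 - v) powr (b - 1)) * indicator {0..1} v \<partial>lborel) = ennreal (Beta a b)"
proof -
  have "(\<integral>\<^sup>+ v. ennreal (indicator {0..1} v * (v powr (a - 1) * (1 - v) powr (b - 1))) \<partial>lborel) = ennreal (Beta a b)"
    by (rule nn_integral_has_integral_lebesgue[OF _ has_integral_Beta_real[OF assms]]) auto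
  moreover have "(\<integral>\<^sup>+ v. ennreal (v powr (a - 1) * (1 - v) powr (b - 1)) * indicator {0..1} v \<partial>lborel) =
     (\<integral>\<^sup>+ v. ennreal (indicator {0..1} v * (v powr (a - 1) * (1 - v) powr (b - 1))) \<partial>lborel)"
    by (intro nn_integral_cong) (auto simp: indicator_def)
  ultimately show ?thesis by simp
qed

text \<open>The antiderivative is continuous at r even for \<beta> < 1, where the integrand is
  unbounded. The fundamental theorem with exceptional point r therefore covers the weak singularity
  without a limiting argument.\<close>

lemma has_integral_Riesz:
  fixes \<beta> a b r :: real
  assumes "\<beta> > 0" "a \<le> b"
  shows "((\<lambda>x. \<bar>x - r\<bar> powr (\<beta> - 1)) has_integral
    (sgn (b - r) * \<bar>b - r\<bar> powr \<beta> - sgn (a - r) * \<bar>a - r\<bar> powr \<beta>) / \<beta>) {a..b}"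
proof -
  let ?F = "\<lambda>x. sgn (x - r) * \<bar>x - r\<bar> powr \<beta> / \<beta>"
  have "((\<lambda>x. \<bar>x - r\<bar> powr (\<beta> - 1)) has_integral ?F b - ?F a) {a..b}"
  proof (rule fundamental_theorem_of_calculus_strong[of "{r}"])
    fix x assume "x \<in> {a..b} - {r}"
    then consider "x < r" | "x > r" by force
    then show "(?F has_vector_derivative \<bar>x - r\<bar> powr (\<beta> - 1)) (at x)"
    proof cases
      case 1
      have "((\<lambda>x. - ((r - x) powr \<beta>) / \<beta>) has_real_derivative \<bar>x - r\<bar> powr (\<beta> - 1)) (at x)"
        using 1 assms by (auto intro!: derivative_eq_intros simp: abs_if)
      then show ?thesis
        unfolding has_real_derivative_iff_has_vector_derivative
        by (rule has_vector_derivative_transform_within_open[of _ _ _ "{..<r}"]) (use 1 in auto)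
    next
      case 2
      have "((\<lambda>x. ((x - r) powr \<beta>) / \<beta>) has_real_derivative \<bar>x - r\<bar> powr (\<beta> - 1)) (at x)"
        using 2 assms by (auto intro!: derivative_eq_intros simp: abs_if)
      then show ?thesis
        unfolding has_real_derivative_iff_has_vector_derivative
        by (rule has_vector_derivative_transform_within_open[of _ _ _ "{r<..}"]) (use 2 in auto)
    qed
  next
    \<comment> \<open>Continuity is hidden by the jump of \<open>sgn\<close>; splitting into
      positive and negative parts exhibits two continuous powers with positive exponent.\<close>
    have eq: "?F = (\<lambda>x. (max 0 (x - r) powr \<beta> - max 0 (r - x) powr \<beta>) / \<beta>)"
      using assms by (auto simp: fun_eq_iff sgn_if max_def)
    have "continuous_on {a..b} (\<lambda>x. max 0 (x - r) powr \<beta>)" "continuous_on {a..b} (\<lambda>x. max 0 (r - x) powr \<beta>)"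
      using assms by (auto intro!: continuous_on_powr' continuous_on_max continuous_on_diff)
    then show "continuous_on {a..b} ?F"
      unfolding eq using assms by (intro continuous_on_diff continuous_on_divide continuous_on_const) auto
  qed (use assms in auto)
  then show ?thesis by (simp add: diff_divide_distrib)
qed

lemma nn_integral_Riesz:
  fixes \<beta> a b r :: real
  assumes "\<beta> > 0" "a \<le> b"
  shows "(\<integral>\<^sup>+ x. ennreal (\<bar>x - r\<bar> powr (\<beta> - 1)) * indicator {a..b} x \<partial>lborel) =
    ennreal ((sgn (b - r) * \<bar>b - r\<bar> powr \<beta> - sgn (a - r) * \<bar>a - r\<bar> powr \<beta>) / \<beta>)"
proof -
  have "(\<integral>\<^sup>+ x. ennreal (\<bar>x - r\<bar> powr (\<beta> - 1)) * indicator {a..b} x \<partial>lborel) =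
     (\<integral>\<^sup>+ x. ennreal (indicator {a..b} x * \<bar>x - r\<bar> powr (\<beta> - 1)) \<partial>lborel)"
    by (intro nn_integral_cong) (auto simp: indicator_def)
  also have "\<dots> = ennreal ((sgn (b - r) * \<bar>b - r\<bar> powr \<beta> - sgn (a - r) * \<bar>a - r\<bar> powr \<beta>) / \<beta>)"
    by (rule nn_integral_has_integral_lebesgue[OF _ has_integral_Riesz[OF assms]]) auto
  finally show ?thesis .
qed

lemma nn_integral_Riesz_le:
  fixes \<beta> a b r :: real
  assumes "\<beta> > 0" "a \<le> r" "r \<le> b"
  shows "(\<integral>\<^sup>+ x. ennreal (\<bar>x - r\<bar> powr (\<beta> - 1)) * indicator {a..b} x \<partial>lborel) \<le> ennreal (2 * (b - a) powr \<beta> / \<beta>)"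
proof -
  have "sgn (b - r) * \<bar>b - r\<bar> powr \<beta> - sgn (a - r) * \<bar>a - r\<bar> powr \<beta> = (b - r) powr \<beta> + (r - a) powr \<beta>"
    using assms by (auto simp: sgn_if abs_if)
  also have "\<dots> \<le> 2 * (b - a) powr \<beta>"
    using assms powr_mono2[of \<beta> "b - r" "b - a"] powr_mono2[of \<beta> "r - a" "b - a"] by auto
  finally show ?thesis
    using assms by (subst nn_integral_Riesz) (auto intro!: ennreal_leI divide_right_mono)
qed

text \<open>For \<beta> = 2H - 1, multiplying by H(2H - 1) gives the covariance of fractional
  Brownian motion as the double integral of its mixed second derivative.\<close>

lemma nn_integral_Riesz_rectangle:
  fixes \<beta> s t :: real
  assumes "\<beta> > 0" "0 \<le> s" "0 \<le> t"
  shows "(\<integral>\<^sup>+ r. \<integral>\<^sup>+ x. ennreal (\<bar>x - r\<bar> powr (\<beta> - 1)) * indicator {0..s} x * indicator {0..t} r \<partial>lborel \<partial>lborel) =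
    ennreal ((t powr (\<beta> + 1) + s powr (\<beta> + 1) - \<bar>t - s\<bar> powr (\<beta> + 1)) / (\<beta> * (\<beta> + 1)))"
proof -
  let ?f = "\<lambda>r. (sgn (s - r) * \<bar>s - r\<bar> powr \<beta> - sgn (0 - r) * \<bar>0 - r\<bar> powr \<beta>) / \<beta>"
  let ?F = "\<lambda>r. (r powr (\<beta> + 1) - \<bar>s - r\<bar> powr (\<beta> + 1)) / (\<beta> * (\<beta> + 1))"
  have frac: "((\<beta> + 1) * X + (\<beta> + 1) * Y) / (\<beta> * (\<beta> + 1)) = (X + Y) / \<beta>" for X Y
  proof -
    have "((\<beta> + 1) * X + (\<beta> + 1) * Y) / (\<beta> * (\<beta> + 1)) = ((X + Y) * (\<beta> + 1)) / (\<beta> * (\<beta> + 1))"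
      by (simp add: algebra_simps)
    also have "\<dots> = (X + Y) / \<beta>"
      using assms by (intro mult_divide_mult_cancel_right) auto
    finally show ?thesis .
  qed
  have "(?f has_integral ?F t - ?F 0) {0..t}"
  \<comment> \<open>The formula for the derivative changes branch at s, and \<open>powr\<close> is
    delicate at 0, so both points are left exceptional.\<close>
  proof (rule fundamental_theorem_of_calculus_strong[of "{0,s}"])
    fix x assume "x \<in> {0..t} - {0,s}"
    then consider "0 < x" "x < s" | "0 < x" "x > s" by force
    then show "(?F has_vector_derivative ?f x) (at x)"
    proof cases
      case 1
      have "((\<lambda>r. (r powr (\<beta> + 1) - (s - r) powr (\<beta> + 1)) / (\<beta> * (\<beta> + 1))) has_real_derivative ?f x) (at x)"
      proof (rule DERIV_cong[OF DERIV_cdivide[OF DERIV_diff]])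
        show "((\<lambda>r. r powr (\<beta> + 1)) has_real_derivative (\<beta> + 1) * x powr \<beta>) (at x)"
          using 1 assms by (auto intro!: derivative_eq_intros)
        show "((\<lambda>r. (s - r) powr (\<beta> + 1)) has_real_derivative - ((\<beta> + 1) * (s - x) powr \<beta>)) (at x)"
          using 1 assms by (auto intro!: derivative_eq_intros)
        have "((\<beta> + 1) * X - - ((\<beta> + 1) * Y)) / (\<beta> * (\<beta> + 1)) = (Y + X) / \<beta>" for X Y
          using frac[of X Y] by (simp add: add.commute)
        then show "((\<beta> + 1) * x powr \<beta> - - ((\<beta> + 1) * (s - x) powr \<beta>)) / (\<beta> * (\<beta> + 1)) = ?f x"
          using 1 by simp
      qed
      then show ?thesis
        unfolding has_real_derivative_iff_has_vector_derivative
        by (rule has_vector_derivative_transform_within_open[of _ _ _ "{..<s}"]) (use 1 in auto)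
    next
      case 2
      have "((\<lambda>r. (r powr (\<beta> + 1) - (r - s) powr (\<beta> + 1)) / (\<beta> * (\<beta> + 1))) has_real_derivative ?f x) (at x)"
      proof (rule DERIV_cong[OF DERIV_cdivide[OF DERIV_diff]])
        show "((\<lambda>r. r powr (\<beta> + 1)) has_real_derivative (\<beta> + 1) * x powr \<beta>) (at x)"
          using 2 assms by (auto intro!: derivative_eq_intros)
        show "((\<lambda>r. (r - s) powr (\<beta> + 1)) has_real_derivative (\<beta> + 1) * (x - s) powr \<beta>) (at x)"
          using 2 assms by (auto intro!: derivative_eq_intros)
        have "((\<beta> + 1) * X - (\<beta> + 1) * Y) / (\<beta> * (\<beta> + 1)) = (X - Y) / \<beta>" for X Y
          using frac[of X "- Y"] by simp
        then show "((\<beta> + 1) * x powr \<beta> - (\<beta> + 1) * (x - s) powr \<beta>) / (\<beta> * (\<beta> + 1)) = ?f x"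
          using 2 by simp
      qed
      then show ?thesis
        unfolding has_real_derivative_iff_has_vector_derivative
        by (rule has_vector_derivative_transform_within_open[of _ _ _ "{s<..}"]) (use 2 in auto)
    qed
  next
    show "continuous_on {0..t} ?F"
      using assms by (intro continuous_intros continuous_on_powr') auto
  qed (use assms in auto)
  moreover have nonneg: "?f r \<ge> 0" if "r \<in> {0..t}" for r
    using has_integral_nonneg[OF has_integral_Riesz[of \<beta> 0 s r]] assms by auto
  ultimately have "(\<integral>\<^sup>+ r. ennreal (indicator {0..t} r * ?f r) \<partial>lborel) = ennreal (?F t - ?F 0)"
    by (intro nn_integral_has_integral_lebesgue) auto
  moreover have "(\<integral>\<^sup>+ r. \<integral>\<^sup>+ x. ennreal (\<bar>x - r\<bar> powr (\<beta> - 1)) * indicator {0..s} x * indicator {0..t} r \<partial>lborel \<partial>lborel)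
     = (\<integral>\<^sup>+ r. ennreal (indicator {0..t} r * ?f r) \<partial>lborel)"
  proof (intro nn_integral_cong)
    fix r
    have "(\<integral>\<^sup>+ x. ennreal (\<bar>x - r\<bar> powr (\<beta> - 1)) * indicator {0..s} x * indicator {0..t} r \<partial>lborel) =
       (\<integral>\<^sup>+ x. ennreal (\<bar>x - r\<bar> powr (\<beta> - 1)) * indicator {0..s} x \<partial>lborel) * indicator {0..t} r"
      by (rule nn_integral_multc) measurable
    also have "\<dots> = ennreal (indicator {0..t} r * ?f r)"
      using assms by (subst nn_integral_Riesz) (auto simp: indicator_def)
    finally show "(\<integral>\<^sup>+ x. ennreal (\<bar>x - r\<bar> powr (\<beta> - 1)) * indicator {0..s} x * indicator {0..t} r \<partial>lborel)
       = ennreal (indicator {0..t} r * ?f r)" .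
  qed
  moreover have "?F t - ?F 0 = (t powr (\<beta> + 1) + s powr (\<beta> + 1) - \<bar>t - s\<bar> powr (\<beta> + 1)) / (\<beta> * (\<beta> + 1))"
    using assms by (simp add: diff_divide_distrib add_divide_distrib abs_minus_commute)
  ultimately show ?thesis by metis
qed

section \<open>The beta integral behind the operator\<close>

locale hurst =
  fixes H T :: real
  assumes T_pos: "0 < T" and H_gt: "1 / 2 < H" and H_less: "H < 1"
begin

abbreviation cyl :: "(real \<times> real) measure" where
  "cyl \<equiv> cyl_measure T"

abbreviation KH :: "(real \<times> real \<Rightarrow> real) \<Rightarrow> real \<times> real \<Rightarrow> real" where
  "KH \<equiv> KH_star H T"

text \<open>The normalisation in \<open>cH\<close> cancels the beta value that the product of two
  kernels produces, leaving the factor H(2H - 1) of the fractional covariance.\<close>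

lemma cH_square: "(cH H)\<^sup>2 * Beta (2 - 2 * H) (H - 1 / 2) = H * (2 * H - 1)"
proof -
  have B: "Beta (2 - 2 * H) (H - 1 / 2) > 0"
    using H_gt H_less unfolding Beta_def
    by (intro divide_pos_pos mult_pos_pos Gamma_real_pos) auto
  moreover have "H * (2 * H - 1) \<ge> 0"
    using H_gt by (intro mult_nonneg_nonneg) auto
  ultimately show ?thesis
    unfolding cH_def by (subst real_sqrt_pow2) auto
qed

lemma dKH_nonneg: "0 \<le> dKH H r s"
proof -
  have "Beta (2 - 2 * H) (H - 1 / 2) > 0"
    using H_gt H_less unfolding Beta_def
    by (intro divide_pos_pos mult_pos_pos Gamma_real_pos) auto
  then have "cH H \<ge> 0"
    using H_gt unfolding cH_def by (intro real_sqrt_ge_zero divide_nonneg_pos mult_nonneg_nonneg) auto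
  then show ?thesis unfolding dKH_def by auto
qed

lemma dKH_measurable[measurable]:
  assumes "f \<in> borel_measurable M" "g \<in> borel_measurable M"
  shows "(\<lambda>x. dKH H (f x) (g x)) \<in> borel_measurable M"
  unfolding dKH_def using assms by measurable

text \<open>The Moebius substitution \<open>v = u (b - a) / (a (b - u))\<close> sends \<open>0, a, b\<close> to \<open>0, 1, \<infinity>\<close>,
  which turns the integrand into that of the beta function.\<close>

lemma nn_integral_dKH_dKH:
  assumes ab: "0 < a" "a < b"
  shows "(\<integral>\<^sup>+ u. ennreal (dKH H b u * dKH H a u) * indicator {0..a} u \<partial>lborel) =
    ennreal (H * (2 * H - 1) * (b - a) powr (2 * H - 2))"
proof -
  let ?g = "\<lambda>u. u * (b - a) / (a * (b - u))"
  let ?g' = "\<lambda>u. (b - a) * b / (a * (b - u)\<^sup>2)"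
  let ?f = "\<lambda>v. v powr ((2 - 2 * H) - 1) * (1 - v) powr ((H - 1 / 2) - 1)"
  have g01: "?g 0 = 0" "?g a = 1" using ab by auto
  have "ennreal (Beta (2 - 2 * H) (H - 1 / 2)) = (\<integral>\<^sup>+ v. ennreal (?f v) * indicator {0..1} v \<partial>lborel)"
    using H_gt H_less by (subst nn_integral_Beta) auto
  also have "\<dots> = (\<integral>\<^sup>+ v. ennreal (?f v * indicator {?g 0..?g a} v) \<partial>lborel)"
    unfolding g01 by (intro nn_integral_cong) (auto simp: indicator_def)
  also have "\<dots> = (\<integral>\<^sup>+ u. ennreal (?f (?g u) * ?g' u * indicator {0..a} u) \<partial>lborel)"
  proof (rule nn_integral_substitution[where f = ?f and g = ?g and g' = ?g' and a = 0 and b = a])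
    show "set_borel_measurable borel {?g 0..?g a} ?f"
      unfolding set_borel_measurable_def by measurable
    show "(?g has_real_derivative ?g' x) (at x)" if "x \<in> {0..a}" for x
    proof (rule DERIV_cong[OF DERIV_divide])
      show "((\<lambda>u. u * (b - a)) has_real_derivative b - a) (at x)"
        "((\<lambda>u. a * (b - u)) has_real_derivative - a) (at x)"
        by (auto intro!: derivative_eq_intros)
      show "a * (b - x) \<noteq> 0" using that ab by auto
      have "(b - a) * (a * (b - x)) - x * (b - a) * (- a) = a * ((b - a) * b)"
        by (simp add: algebra_simps)
      moreover have "a * (b - x) * (a * (b - x)) = a * (a * (b - x)\<^sup>2)"
        by (simp add: power2_eq_square)
      ultimately show "((b - a) * (a * (b - x)) - x * (b - a) * (- a)) / (a * (b - x) * (a * (b - x))) = ?g' x"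
        using ab by simp
    qed
    show "continuous_on {0..a} ?g'"
      using ab by (intro continuous_on_divide continuous_on_mult continuous_on_power continuous_on_diff
          continuous_on_const continuous_on_id ballI) auto
    show "?g' x \<ge> 0" if "x \<in> {0..a}" for x
      using that ab by (intro divide_nonneg_nonneg mult_nonneg_nonneg) auto
  qed (use ab in auto)
  finally have B: "ennreal (Beta (2 - 2 * H) (H - 1 / 2)) =
    (\<integral>\<^sup>+ u. ennreal (?f (?g u) * ?g' u * indicator {0..a} u) \<partial>lborel)" .
  let ?c = "(cH H)\<^sup>2 * (b - a) powr (2 * H - 2)"
  \<comment> \<open>The factors recombine because 1 - g(u) = b(a - u)/(a(b - u)) supplies the
    singularity of \<open>dKH H a\<close>, while the powers of b - u coming from g, 1 - g and the
    derivative together yield that of \<open>dKH H b\<close>. What remains is to add exponents base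
    by base.\<close>
  have eq: "dKH H b u * dKH H a u = ?c * (?f (?g u) * ?g' u)" if "0 < u" "u < a" for u
  proof -
    have one: "1 - ?g u = b * (a - u) / (a * (b - u))"
      using that ab by (simp add: field_simps)
    have pw: "(B * w / (A * v)) powr e = B powr e * w powr e * A powr (- e) * v powr (- e)" for A B v w e :: real
      by (simp add: powr_mult powr_divide powr_minus divide_simps)
    have e1: "2 - 2 * H - 1 = 1 - 2 * H" "- (1 - 2 * H) = 2 * H - 1"
      and e2: "H - 1 / 2 - 1 = H - 3 / 2" "- (H - 3 / 2) = 3 / 2 - H"
      by auto
    have p: "?g u powr ((2 - 2 * H) - 1) = u powr (1 - 2*H) * (b - a) powr (1 - 2 * H) * a powr (2*H - 1) * (b - u) powr (2*H - 1)"
      unfolding e1(1) pw e1(2) ..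
    have q: "(1 - ?g u) powr ((H - 1/2) - 1) = b powr (H - 3/2) * (a - u) powr (H - 3/2) * a powr (3/2 - H) * (b - u) powr (3/2 - H)"
      unfolding e2(1) one pw e2(2) ..
    have r: "?g' u = (b - a) powr 1 * b powr 1 * a powr (-1) * (b - u) powr (-2)"
      using that ab by (simp add: powr_minus powr_numeral divide_inverse)
    have "?f (?g u) * ?g' u = (u powr (1 - 2*H)) * ((b - a) powr (1 - 2 * H) * (b - a) powr 1) *
       (a powr (2*H - 1) * a powr (3/2 - H) * a powr (-1)) *
       ((b - u) powr (2*H - 1) * (b - u) powr (3/2 - H) * (b - u) powr (-2)) *
       (b powr (H - 3/2) * b powr 1) * (a - u) powr (H - 3/2)"
      unfolding p q r by (simp only: mult_ac)
    also have "\<dots> = u powr (1 - 2*H) * (b - a) powr (2 - 2 * H) * a powr (H - 1/2) * (b - u) powr (H - 3/2) * b powr (H - 1/2) * (a - u) powr (H - 3/2)"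
    proof -
      have "(b - a) powr (1 - 2 * H) * (b - a) powr 1 = (b - a) powr (2 - 2 * H)"
        unfolding powr_add[symmetric] by (rule arg_cong[where f="(powr) (b - a)"]) linarith
      moreover have "a powr (2*H - 1) * a powr (3/2 - H) * a powr (-1) = a powr (H - 1/2)"
        unfolding powr_add[symmetric] by (rule arg_cong[where f="(powr) a"]) linarith
      moreover have "(b - u) powr (2*H - 1) * (b - u) powr (3/2 - H) * (b - u) powr (-2) = (b - u) powr (H - 3/2)"
        unfolding powr_add[symmetric] by (rule arg_cong[where f="(powr) (b - u)"]) linarith
      moreover have "b powr (H - 3/2) * b powr 1 = b powr (H - 1/2)"
        unfolding powr_add[symmetric] by (rule arg_cong[where f="(powr) b"]) linarith
      ultimately show ?thesis by (simp only:)
    qed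
    finally have E: "?f (?g u) * ?g' u = \<dots>" .
    have one': "(b - a) powr (2 * H - 2) * (b - a) powr (2 - 2 * H) = 1"
      unfolding powr_add[symmetric] using ab by simp
    have u: "u powr (1 - 2*H) = inverse (u powr (H - 1/2) * u powr (H - 1/2))"
      unfolding powr_add[symmetric] powr_minus[symmetric] by (rule arg_cong[where f="(powr) u"]) linarith
    have frac: "c * (B / U) * X * (c * (A / U) * Y) = c\<^sup>2 * d * (inverse (U * U) * d' * A * X * B * Y)"
      if "d * d' = 1" for c B U X A Y d d' :: real
    proof -
      have "c\<^sup>2 * d * (inverse (U * U) * d' * A * X * B * Y) = c\<^sup>2 * (d * d') * (inverse (U * U) * A * X * B * Y)"
        by (simp only: mult_ac)
      also have "\<dots> = c * (B / U) * X * (c * (A / U) * Y)"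
        unfolding that by (simp add: power2_eq_square divide_inverse)
      finally show ?thesis ..
    qed
    show ?thesis
      unfolding E unfolding u dKH_def powr_divide by (rule frac[OF one'])
  qed
  have "(\<integral>\<^sup>+ u. ennreal (dKH H b u * dKH H a u) * indicator {0..a} u \<partial>lborel) =
    (\<integral>\<^sup>+ u. ennreal ?c * ennreal (?f (?g u) * ?g' u * indicator {0..a} u) \<partial>lborel)"
  proof (rule nn_integral_cong_AE)
    \<comment> \<open>The pointwise identity \<open>eq\<close> covers the open interval only, since
      the powers degenerate at the ends.\<close>
    have "AE u in lborel. u \<noteq> 0 \<and> u \<noteq> a"
      by (auto intro: AE_lborel_singleton)
    then show "AE u in lborel. ennreal (dKH H b u * dKH H a u) * indicator {0..a} u =
        ennreal ?c * ennreal (?f (?g u) * ?g' u * indicator {0..a} u)"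
    proof eventually_elim
      case (elim u)
      show ?case
      proof (cases "u \<in> {0..a}")
        case True
        with elim have "0 < u" "u < a" by auto
        then show ?thesis
          using True eq[of u] by (simp add: ennreal_mult'[symmetric])
      qed auto
    qed
  qed
  also have "\<dots> = ennreal ?c * ennreal (Beta (2 - 2 * H) (H - 1 / 2))"
    unfolding B by (rule nn_integral_cmult) measurable
  also have "\<dots> = ennreal (H * (2 * H - 1) * (b - a) powr (2 * H - 2))"
    unfolding cH_square[symmetric] by (subst ennreal_mult'[symmetric]) (simp_all add: mult_ac)
  finally show ?thesis .
qed

end

section \<open>The operator in time\<close>

text \<open>The squared L2 norm with values in \<open>ennreal\<close>, so that limits and bounds
  carry no integrability side conditions. Staying with the square replaces the triangle inequality
  by one with a factor 2.\<close>

definition msq :: "'a measure \<Rightarrow> ('a \<Rightarrow> real) \<Rightarrow> ennreal" where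
  "msq M f = (\<integral>\<^sup>+ x. ennreal ((f x)\<^sup>2) \<partial>M)"

lemma ennreal_mult_le_add_squares: "a * b \<le> a\<^sup>2 + b\<^sup>2" for a b :: ennreal
proof (cases "a \<le> b")
  case True
  then have "a * b \<le> b * b" by (intro mult_right_mono) auto
  then show ?thesis by (simp add: power2_eq_square add_increasing)
next
  case False
  then have "a * b \<le> a * a" by (intro mult_left_mono) auto
  then show ?thesis by (simp add: power2_eq_square add_increasing2)
qed

lemma space_dom_borel[measurable]: "space_dom \<in> sets borel"
  unfolding space_dom_def by simp

lemma real_Pair_measurable:
  fixes f g :: "'a \<Rightarrow> real"
  assumes "f \<in> borel_measurable M" "g \<in> borel_measurable M"
  shows "(\<lambda>x. (f x, g x)) \<in> borel_measurable M"
  using assms by (rule borel_measurable_Pair)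

lemma nn_integral_cyl_measure:
  assumes [measurable]: "f \<in> borel_measurable borel"
  shows "(\<integral>\<^sup>+ z. f z \<partial>cyl_measure T) =
    (\<integral>\<^sup>+ y. (\<integral>\<^sup>+ s. f (y, s) * indicator {0..T} s \<partial>lborel) * indicator space_dom y \<partial>lborel)"
proof -
  have S: "space_dom \<times> {0..T} \<in> sets borel"
    unfolding space_dom_def by (intro borel_closed closed_Times) auto
  have [measurable]: "f \<in> borel_measurable (lborel \<Otimes>\<^sub>M lborel)"
    unfolding lborel_prod by simp
  have "(\<integral>\<^sup>+ z. f z \<partial>cyl_measure T) = (\<integral>\<^sup>+ z. f z * indicator (space_dom \<times> {0..T}) z \<partial>lborel)"
    unfolding cyl_measure_def by (rule nn_integral_restrict_space) (use S in auto)
  also have "\<dots> = (\<integral>\<^sup>+ z. f z * indicator (space_dom \<times> {0..T}) z \<partial>(lborel \<Otimes>\<^sub>M lborel))"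
    unfolding lborel_prod ..
  also have "\<dots> = (\<integral>\<^sup>+ y. \<integral>\<^sup>+ s. f (y, s) * indicator (space_dom \<times> {0..T}) (y, s) \<partial>lborel \<partial>lborel)"
    by (rule lborel.nn_integral_fst[symmetric]) measurable
  also have "\<dots> = (\<integral>\<^sup>+ y. \<integral>\<^sup>+ s. f (y, s) * indicator {0..T} s * indicator space_dom y \<partial>lborel \<partial>lborel)"
    by (intro nn_integral_cong) (auto simp: indicator_def)
  also have "\<dots> = (\<integral>\<^sup>+ y. (\<integral>\<^sup>+ s. f (y, s) * indicator {0..T} s \<partial>lborel) * indicator space_dom y \<partial>lborel)"
    by (intro nn_integral_cong nn_integral_multc) measurable
  finally show ?thesis .
qed

context hurst
begin

text \<open>The operator at a frozen space point, for nonnegative functions of time. With extended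
  values Tonelli's theorem applies to it without integrability.\<close>

definition Kop :: "(real \<Rightarrow> ennreal) \<Rightarrow> real \<Rightarrow> ennreal" where
  "Kop f u = (\<integral>\<^sup>+ r. f r * ennreal (dKH H r u) * indicator {u..T} r \<partial>lborel)"

text \<open>The mixed second derivative of the fractional Brownian covariance. On the diagonal it is
  0 by the convention for \<open>powr\<close>.\<close>

definition kernel :: "real \<Rightarrow> real \<Rightarrow> ennreal" where
  "kernel r r' = ennreal (H * (2 * H - 1) * \<bar>r' - r\<bar> powr (2 * H - 2))"

lemma kernel_measurable[measurable]:
  assumes "f \<in> borel_measurable M" "g \<in> borel_measurable M"
  shows "(\<lambda>x. kernel (f x) (g x)) \<in> borel_measurable M"
  unfolding kernel_def using assms by measurable

lemma kernel_sym: "kernel r r' = kernel r' r"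
  unfolding kernel_def by (simp add: abs_minus_commute)

lemma indicator_Icc_measurable[measurable]:
  fixes f g h :: "'b \<Rightarrow> real"
  assumes [measurable]: "f \<in> borel_measurable M" "g \<in> borel_measurable M" "h \<in> borel_measurable M"
  shows "(\<lambda>x. indicator {f x..g x} (h x) :: ennreal) \<in> borel_measurable M"
  unfolding indicator_def of_bool_def atLeastAtMost_iff by measurable

lemma indicator_Icc_measurable_real[measurable]:
  fixes f g h :: "'b \<Rightarrow> real"
  assumes [measurable]: "f \<in> borel_measurable M" "g \<in> borel_measurable M" "h \<in> borel_measurable M"
  shows "(\<lambda>x. indicator {f x..g x} (h x) :: real) \<in> borel_measurable M"
  unfolding indicator_def of_bool_def atLeastAtMost_iff by measurable

lemma Kop_measurable[measurable]:
  assumes [measurable]: "(\<lambda>(x, r). f x r) \<in> borel_measurable (M \<Otimes>\<^sub>M lborel)" "g \<in> borel_measurable M"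
  shows "(\<lambda>x. Kop (f x) (g x)) \<in> borel_measurable M"
  unfolding Kop_def by measurable

text \<open>Only times u below both r and r' contribute, so up to symmetry this is the beta
  integral. The diagonal has to be excluded: there the left side is infinite, whereas
  \<open>kernel\<close> is 0.\<close>

lemma nn_integral_Kop_kernel:
  assumes "0 < r" "0 < r'" "r \<noteq> r'" "r \<le> T" "r' \<le> T"
  shows "(\<integral>\<^sup>+ u. ennreal (dKH H r u) * indicator {u..T} r * (ennreal (dKH H r' u) * indicator {u..T} r') * indicator {0..T} u \<partial>lborel)
     = kernel r r'"
proof -
  have *: "(\<integral>\<^sup>+ u. ennreal (dKH H r u) * indicator {u..T} r * (ennreal (dKH H r' u) * indicator {u..T} r') * indicator {0..T} u \<partial>lborel)
     = kernel r r'" if "0 < r" "r < r'" "r' \<le> T" for r r'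
  proof -
    have "(\<integral>\<^sup>+ u. ennreal (dKH H r u) * indicator {u..T} r * (ennreal (dKH H r' u) * indicator {u..T} r') * indicator {0..T} u \<partial>lborel)
      = (\<integral>\<^sup>+ u. ennreal (dKH H r' u * dKH H r u) * indicator {0..r} u \<partial>lborel)"
      using that by (intro nn_integral_cong) (auto simp: indicator_def ennreal_mult dKH_nonneg mult.commute)
    also have "\<dots> = kernel r r'"
      using that unfolding kernel_def by (subst nn_integral_dKH_dKH) auto
    finally show ?thesis .
  qed
  show ?thesis
  proof (cases "r < r'")
    case True
    with assms show ?thesis by (intro *) auto
  next
    case False
    with assms have "kernel r' r = (\<integral>\<^sup>+ u. ennreal (dKH H r' u) * indicator {u..T} r' * (ennreal (dKH H r u) * indicator {u..T} r) * indicator {0..T} u \<partial>lborel)"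
      by (intro *[symmetric]) auto
    then show ?thesis by (simp add: kernel_sym[of r r'] mult_ac)
  qed
qed

lemma nn_integral_Kop_Kop:
  assumes [measurable]: "f \<in> borel_measurable borel" "g \<in> borel_measurable borel"
  shows "(\<integral>\<^sup>+ u. Kop f u * Kop g u * indicator {0..T} u \<partial>lborel) =
    (\<integral>\<^sup>+ r. \<integral>\<^sup>+ r'. f r * g r' * kernel r r' * indicator {0..T} r * indicator {0..T} r' \<partial>lborel \<partial>lborel)"
proof -
  let ?F = "\<lambda>f r u. f r * ennreal (dKH H r u) * indicator {u..T} r"
  have "(\<integral>\<^sup>+ u. Kop f u * Kop g u * indicator {0..T} u \<partial>lborel) =
     (\<integral>\<^sup>+ u. \<integral>\<^sup>+ r. \<integral>\<^sup>+ r'. ?F f r u * ?F g r' u * indicator {0..T} u \<partial>lborel \<partial>lborel \<partial>lborel)"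
    unfolding Kop_def
    by (intro nn_integral_cong) (simp add: nn_integral_cmult nn_integral_multc)
  also have "\<dots> = (\<integral>\<^sup>+ r. \<integral>\<^sup>+ u. \<integral>\<^sup>+ r'. ?F f r u * ?F g r' u * indicator {0..T} u \<partial>lborel \<partial>lborel \<partial>lborel)"
    by (rule lborel_pair.Fubini') measurable
  also have "\<dots> = (\<integral>\<^sup>+ r. \<integral>\<^sup>+ r'. \<integral>\<^sup>+ u. ?F f r u * ?F g r' u * indicator {0..T} u \<partial>lborel \<partial>lborel \<partial>lborel)"
    by (intro nn_integral_cong lborel_pair.Fubini') measurable
  also have "\<dots> = (\<integral>\<^sup>+ r. \<integral>\<^sup>+ r'. f r * g r' * kernel r r' * indicator {0..T} r * indicator {0..T} r' \<partial>lborel \<partial>lborel)"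
  proof (rule nn_integral_cong_AE)
    have "AE r in lborel. r \<noteq> 0" by (rule AE_lborel_singleton)
    then show "AE r in lborel. (\<integral>\<^sup>+ r'. \<integral>\<^sup>+ u. ?F f r u * ?F g r' u * indicator {0..T} u \<partial>lborel \<partial>lborel)
      = (\<integral>\<^sup>+ r'. f r * g r' * kernel r r' * indicator {0..T} r * indicator {0..T} r' \<partial>lborel)"
    proof eventually_elim
      case (elim r)
      show ?case
      proof (rule nn_integral_cong_AE)
        have "AE r' in lborel. r' \<noteq> 0 \<and> r' \<noteq> r"
          by (auto intro: AE_lborel_singleton)
        then show "AE r' in lborel. (\<integral>\<^sup>+ u. ?F f r u * ?F g r' u * indicator {0..T} u \<partial>lborel) =
          f r * g r' * kernel r r' * indicator {0..T} r * indicator {0..T} r'"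
        proof eventually_elim
          case (elim r')
          show ?case
          proof (cases "r \<in> {0..T} \<and> r' \<in> {0..T}")
            case True
            have "(\<integral>\<^sup>+ u. ?F f r u * ?F g r' u * indicator {0..T} u \<partial>lborel) =
              (\<integral>\<^sup>+ u. (f r * g r') * (ennreal (dKH H r u) * indicator {u..T} r * (ennreal (dKH H r' u) * indicator {u..T} r') * indicator {0..T} u) \<partial>lborel)"
              by (intro nn_integral_cong) (simp add: mult_ac)
            also have "\<dots> = f r * g r' * kernel r r'"
              using True elim \<open>r \<noteq> 0\<close> by (subst nn_integral_cmult) (auto simp: nn_integral_Kop_kernel)
            finally show ?thesis using True by simp
          next
            case False
            then have "(\<integral>\<^sup>+ u. ?F f r u * ?F g r' u * indicator {0..T} u \<partial>lborel) = (\<integral>\<^sup>+ u. 0 \<partial>(lborel :: real measure))"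
              by (intro nn_integral_cong) (auto simp: indicator_def)
            with False show ?thesis by (auto simp: indicator_def)
          qed
        qed
      qed
    qed
  qed
  finally show ?thesis .
qed

lemma nn_integral_kernel_le:
  assumes "a \<le> r" "r \<le> b"
  shows "(\<integral>\<^sup>+ r'. kernel r r' * indicator {a..b} r' \<partial>lborel) \<le> ennreal (2 * H * (b - a) powr (2 * H - 1))"
proof -
  have "(\<integral>\<^sup>+ r'. kernel r r' * indicator {a..b} r' \<partial>lborel) =
    (\<integral>\<^sup>+ r'. ennreal (H * (2 * H - 1)) * (ennreal (\<bar>r' - r\<bar> powr ((2 * H - 1) - 1)) * indicator {a..b} r') \<partial>lborel)"
    using H_gt by (intro nn_integral_cong) (auto simp: kernel_def ennreal_mult mult.assoc)
  also have "\<dots> = ennreal (H * (2 * H - 1)) * (\<integral>\<^sup>+ r'. (ennreal (\<bar>r' - r\<bar> powr ((2 * H - 1) - 1)) * indicator {a..b} r') \<partial>lborel)"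
    by (rule nn_integral_cmult) measurable
  also have "\<dots> \<le> ennreal (H * (2 * H - 1)) * ennreal (2 * (b - a) powr (2 * H - 1) / (2 * H - 1))"
    using assms H_gt by (intro mult_left_mono nn_integral_Riesz_le) auto
  also have "\<dots> = ennreal (2 * H * (b - a) powr (2 * H - 1))"
    using H_gt by (subst ennreal_mult[symmetric]) auto
  finally show ?thesis .
qed

text \<open>Schur's test in a crude form: a product is at most the sum of the squares, which by
  symmetry of \<open>kernel\<close> gives twice the same double integral. Each copy is controlled by
  the row bound 2H(b - a)^(2H - 1), hence the 4H. The support condition confines both variables to
  the short interval, which produces a power of b - a rather than of T.\<close>

lemma nn_integral_Kop_square_le:
  assumes [measurable]: "f \<in> borel_measurable borel"
    and supp: "\<And>r. r \<in> {0..T} \<Longrightarrow> r \<notin> {a..b} \<Longrightarrow> f r = 0"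
  shows "(\<integral>\<^sup>+ u. (Kop f u)\<^sup>2 * indicator {0..T} u \<partial>lborel) \<le>
    ennreal (4 * H * (b - a) powr (2 * H - 1)) * (\<integral>\<^sup>+ r. (f r)\<^sup>2 * indicator {0..T} r \<partial>lborel)"
proof -
  let ?i = "indicator {a..b} :: real \<Rightarrow> ennreal" and ?j = "indicator {0..T} :: real \<Rightarrow> ennreal"
  let ?C = "ennreal (2 * H * (b - a) powr (2 * H - 1))"
  have half: "(\<integral>\<^sup>+ r. \<integral>\<^sup>+ r'. (f r)\<^sup>2 * ?j r * ?i r * (kernel r r' * ?i r') \<partial>lborel \<partial>lborel) \<le>
      ?C * (\<integral>\<^sup>+ r. (f r)\<^sup>2 * ?j r \<partial>lborel)"
  proof -
    have "(\<integral>\<^sup>+ r. \<integral>\<^sup>+ r'. (f r)\<^sup>2 * ?j r * ?i r * (kernel r r' * ?i r') \<partial>lborel \<partial>lborel) =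
       (\<integral>\<^sup>+ r. (f r)\<^sup>2 * ?j r * ?i r * (\<integral>\<^sup>+ r'. kernel r r' * ?i r' \<partial>lborel) \<partial>lborel)"
      by (intro nn_integral_cong nn_integral_cmult) measurable
    also have "\<dots> \<le> (\<integral>\<^sup>+ r. ?C * ((f r)\<^sup>2 * ?j r) \<partial>lborel)"
    proof (rule nn_integral_mono)
      fix r
      show "(f r)\<^sup>2 * ?j r * ?i r * (\<integral>\<^sup>+ r'. kernel r r' * ?i r' \<partial>lborel) \<le> ?C * ((f r)\<^sup>2 * ?j r)"
        using mult_left_mono[OF nn_integral_kernel_le[of a r b], of "(f r)\<^sup>2 * ?j r"]
        by (cases "r \<in> {a..b}") (auto simp: mult.commute)
    qed
    also have "\<dots> = ?C * (\<integral>\<^sup>+ r. (f r)\<^sup>2 * ?j r \<partial>lborel)"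
      by (rule nn_integral_cmult) measurable
    finally show ?thesis .
  qed
  have "(\<integral>\<^sup>+ u. (Kop f u)\<^sup>2 * ?j u \<partial>lborel) =
    (\<integral>\<^sup>+ r. \<integral>\<^sup>+ r'. f r * f r' * kernel r r' * ?j r * ?j r' \<partial>lborel \<partial>lborel)"
    unfolding power2_eq_square by (rule nn_integral_Kop_Kop) measurable
  also have "\<dots> \<le> (\<integral>\<^sup>+ r. \<integral>\<^sup>+ r'. (f r)\<^sup>2 * ?j r * ?i r * (kernel r r' * ?i r') +
      (f r')\<^sup>2 * ?j r' * ?i r' * (kernel r' r * ?i r) \<partial>lborel \<partial>lborel)"
  proof (intro nn_integral_mono)
    fix r r'
    show "f r * f r' * kernel r r' * ?j r * ?j r' \<le> (f r)\<^sup>2 * ?j r * ?i r * (kernel r r' * ?i r') +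
      (f r')\<^sup>2 * ?j r' * ?i r' * (kernel r' r * ?i r)"
    proof (cases "r \<in> {0..T} \<and> r' \<in> {0..T} \<and> r \<in> {a..b} \<and> r' \<in> {a..b}")
      case True
      then show ?thesis
        using mult_right_mono[OF ennreal_mult_le_add_squares[of "f r" "f r'"], of "kernel r r'"]
        by (simp add: kernel_sym[of r' r] distrib_right)
    next
      case False
      then show ?thesis using supp[of r] supp[of r'] by (auto simp: indicator_def)
    qed
  qed
  also have "\<dots> = (\<integral>\<^sup>+ r. \<integral>\<^sup>+ r'. (f r)\<^sup>2 * ?j r * ?i r * (kernel r r' * ?i r') \<partial>lborel \<partial>lborel) +
      (\<integral>\<^sup>+ r. \<integral>\<^sup>+ r'. (f r')\<^sup>2 * ?j r' * ?i r' * (kernel r' r * ?i r) \<partial>lborel \<partial>lborel)"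
    by (simp add: nn_integral_add)
  also have "(\<integral>\<^sup>+ r. \<integral>\<^sup>+ r'. (f r')\<^sup>2 * ?j r' * ?i r' * (kernel r' r * ?i r) \<partial>lborel \<partial>lborel) =
      (\<integral>\<^sup>+ r'. \<integral>\<^sup>+ r. (f r')\<^sup>2 * ?j r' * ?i r' * (kernel r' r * ?i r) \<partial>lborel \<partial>lborel)"
    by (rule lborel_pair.Fubini') measurable
  also have "(\<integral>\<^sup>+ r. \<integral>\<^sup>+ r'. (f r)\<^sup>2 * ?j r * ?i r * (kernel r r' * ?i r') \<partial>lborel \<partial>lborel) +
      (\<integral>\<^sup>+ r. \<integral>\<^sup>+ r'. (f r)\<^sup>2 * ?j r * ?i r * (kernel r r' * ?i r') \<partial>lborel \<partial>lborel) \<le>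
     ?C * (\<integral>\<^sup>+ r. (f r)\<^sup>2 * ?j r \<partial>lborel) + ?C * (\<integral>\<^sup>+ r. (f r)\<^sup>2 * ?j r \<partial>lborel)"
    by (intro add_mono half)
  also have "\<dots> = (?C + ?C) * (\<integral>\<^sup>+ r. (f r)\<^sup>2 * ?j r \<partial>lborel)"
    by (simp only: distrib_right)
  also have "?C + ?C = ennreal (4 * H * (b - a) powr (2 * H - 1))"
    using H_gt by (subst ennreal_plus[symmetric]) auto
  finally show ?thesis .
qed

text \<open>The temporal half of the isometry: the operator turns indicators of time intervals into
  functions whose inner products are fractional Brownian covariances.\<close>

lemma nn_integral_Kop_indicator:
  assumes "s \<in> {0..T}" "t \<in> {0..T}"
  shows "(\<integral>\<^sup>+ u. Kop (indicator {0..t}) u * Kop (indicator {0..s}) u * indicator {0..T} u \<partial>lborel) =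
    ennreal ((t powr (2 * H) + s powr (2 * H) - \<bar>t - s\<bar> powr (2 * H)) / 2)"
proof -
  have "(\<integral>\<^sup>+ u. Kop (indicator {0..t}) u * Kop (indicator {0..s}) u * indicator {0..T} u \<partial>lborel) =
    (\<integral>\<^sup>+ r. \<integral>\<^sup>+ r'. indicator {0..t} r * indicator {0..s} r' * kernel r r' * indicator {0..T} r * indicator {0..T} r' \<partial>lborel \<partial>lborel)"
    by (rule nn_integral_Kop_Kop) measurable
  also have "\<dots> = (\<integral>\<^sup>+ r. \<integral>\<^sup>+ r'. ennreal (H * (2 * H - 1)) * (ennreal (\<bar>r' - r\<bar> powr ((2 * H - 1) - 1)) * indicator {0..s} r' * indicator {0..t} r) \<partial>lborel \<partial>lborel)"
    using assms H_gt by (intro nn_integral_cong) (auto simp: kernel_def ennreal_mult indicator_def)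
  also have "\<dots> = ennreal (H * (2 * H - 1)) * (\<integral>\<^sup>+ r. \<integral>\<^sup>+ r'. (ennreal (\<bar>r' - r\<bar> powr ((2 * H - 1) - 1)) * indicator {0..s} r' * indicator {0..t} r) \<partial>lborel \<partial>lborel)"
    by (simp add: nn_integral_cmult)
  also have "\<dots> = ennreal (H * (2 * H - 1)) * ennreal ((t powr (2 * H) + s powr (2 * H) - \<bar>t - s\<bar> powr (2 * H)) / ((2 * H - 1) * (2 * H)))"
    using assms H_gt by (subst nn_integral_Riesz_rectangle) auto
  also have "\<dots> = ennreal (H * (2 * H - 1) * ((t powr (2 * H) + s powr (2 * H) - \<bar>t - s\<bar> powr (2 * H)) / ((2 * H - 1) * (2 * H))))"
    using H_gt by (intro ennreal_mult'[symmetric]) auto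
  also have "H * (2 * H - 1) * (x / ((2 * H - 1) * (2 * H))) = x / 2" for x
    using H_gt by (simp add: field_simps)
  finally show ?thesis .
qed

section \<open>Bounds for the operator on the cylinder\<close>

lemma KH_star_le_Kop:
  assumes [measurable]: "\<phi> \<in> borel_measurable borel"
  shows "ennreal \<bar>KH \<phi> (y, u)\<bar> \<le> Kop (\<lambda>r. ennreal \<bar>\<phi> (y, r)\<bar>) u"
proof (cases "set_integrable lborel {u..T} (\<lambda>r. \<phi> (y, r) * dKH H r u)")
  case True
  then have "ennreal (norm (KH \<phi> (y, u))) \<le>
      (\<integral>\<^sup>+ r. ennreal (norm (indicator {u..T} r *\<^sub>R (\<phi> (y, r) * dKH H r u))) \<partial>lborel)"
    unfolding KH_star_def set_lebesgue_integral_def set_integrable_def prod.case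
    by (rule integral_norm_bound_ennreal)
  also have "\<dots> = Kop (\<lambda>r. ennreal \<bar>\<phi> (y, r)\<bar>) u"
    unfolding Kop_def
    by (intro nn_integral_cong) (auto simp: indicator_def abs_mult ennreal_mult dKH_nonneg)
  finally show ?thesis by simp
next
  case False
  \<comment> \<open>A divergent Bochner integral has the default value 0, so the bound
    persists.\<close>
  then have "KH \<phi> (y, u) = 0"
    unfolding KH_star_def set_lebesgue_integral_def set_integrable_def prod.case
    by (rule not_integrable_integral_eq)
  then show ?thesis by simp
qed

text \<open>A parameter is carried along so that the same statement yields measurability on the
  cylinder and, later, measurability in x of the operator applied to the Green kernel.\<close>

lemma KH_star_measurable:
  assumes [measurable]: "(\<lambda>(x, z). \<phi> x z) \<in> borel_measurable (M \<Otimes>\<^sub>M borel)" "f \<in> borel_measurable M" "g \<in> borel_measurable M"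
  shows "(\<lambda>x. KH (\<phi> x) (f x, g x)) \<in> borel_measurable M"
proof -
  have [measurable]: "(\<lambda>x. \<phi> (h x) (k x)) \<in> borel_measurable N" 
    if "h \<in> measurable N M" "k \<in> borel_measurable N" for h k N
    using measurable_compose[OF measurable_Pair[OF that] assms(1)] by simp
  note [measurable] = real_Pair_measurable
  show ?thesis
    unfolding KH_star_def set_lebesgue_integral_def prod.case by measurable
qed

lemma KH_star_borel[measurable]:
  assumes [measurable]: "\<phi> \<in> borel_measurable borel"
  shows "KH \<phi> \<in> borel_measurable borel"
proof -
  have "(\<lambda>z. KH \<phi> (fst z, snd z)) \<in> borel_measurable (borel \<Otimes>\<^sub>M borel)"
    by (rule KH_star_measurable) measurable
  then show ?thesis by (simp add: borel_prod)
qed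

lemma Kop_abs_borel:
  fixes \<phi> :: "real \<times> real \<Rightarrow> real"
  assumes "\<phi> \<in> borel_measurable borel"
  shows "(\<lambda>z. Kop (\<lambda>r. ennreal \<bar>\<phi> (fst z, r)\<bar>) (snd z)) \<in> borel_measurable borel"
proof -
  have [measurable]: "\<phi> \<in> borel_measurable (borel \<Otimes>\<^sub>M borel)"
    using assms by (simp add: borel_prod)
  have "(\<lambda>z. Kop (\<lambda>r. ennreal \<bar>\<phi> (fst z, r)\<bar>) (snd z)) \<in> borel_measurable (borel \<Otimes>\<^sub>M borel)"
    by measurable
  then show ?thesis by (simp add: borel_prod)
qed

text \<open>Stated for the positive majorant instead of \<open>KH\<close> itself: applied to a bound
  that is uniform in x, the majorant also dominates the supremum over x.\<close>

lemma nn_integral_cyl_Kop_square_le: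
  assumes [measurable]: "\<phi> \<in> borel_measurable borel"
    and supp: "\<And>y r. y \<in> space_dom \<Longrightarrow> r \<in> {0..T} \<Longrightarrow> r \<notin> {a..b} \<Longrightarrow> \<phi> (y, r) = 0"
  shows "(\<integral>\<^sup>+ z. (Kop (\<lambda>r. ennreal \<bar>\<phi> (fst z, r)\<bar>) (snd z))\<^sup>2 \<partial>cyl) \<le>
    ennreal (4 * H * (b - a) powr (2 * H - 1)) * msq cyl \<phi>"
proof -
  let ?C = "ennreal (4 * H * (b - a) powr (2 * H - 1))"
  note [measurable] = real_Pair_measurable
  have "(\<integral>\<^sup>+ z. (Kop (\<lambda>r. ennreal \<bar>\<phi> (fst z, r)\<bar>) (snd z))\<^sup>2 \<partial>cyl) =
    (\<integral>\<^sup>+ y. (\<integral>\<^sup>+ s. (Kop (\<lambda>r. ennreal \<bar>\<phi> (y, r)\<bar>) s)\<^sup>2 * indicator {0..T} s \<partial>lborel) * indicator space_dom y \<partial>lborel)"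
    by (subst nn_integral_cyl_measure) (use Kop_abs_borel[of \<phi>] in simp_all)
  also have "\<dots> \<le> (\<integral>\<^sup>+ y. ?C * ((\<integral>\<^sup>+ s. ennreal ((\<phi> (y, s))\<^sup>2) * indicator {0..T} s \<partial>lborel) * indicator space_dom y) \<partial>lborel)"
  proof (rule nn_integral_mono)
    fix y
    show "(\<integral>\<^sup>+ s. (Kop (\<lambda>r. ennreal \<bar>\<phi> (y, r)\<bar>) s)\<^sup>2 * indicator {0..T} s \<partial>lborel) * indicator space_dom y \<le>
      ?C * ((\<integral>\<^sup>+ s. ennreal ((\<phi> (y, s))\<^sup>2) * indicator {0..T} s \<partial>lborel) * indicator space_dom y)"
    proof (cases "y \<in> space_dom")
      case True
      have "(\<integral>\<^sup>+ s. (Kop (\<lambda>r. ennreal \<bar>\<phi> (y, r)\<bar>) s)\<^sup>2 * indicator {0..T} s \<partial>lborel) \<le>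
        ?C * (\<integral>\<^sup>+ r. (ennreal \<bar>\<phi> (y, r)\<bar>)\<^sup>2 * indicator {0..T} r \<partial>lborel)"
        using True supp by (intro nn_integral_Kop_square_le) auto
      with True show ?thesis by (simp add: ennreal_power)
    qed auto
  qed
  also have "\<dots> = ?C * (\<integral>\<^sup>+ y. (\<integral>\<^sup>+ s. ennreal ((\<phi> (y, s))\<^sup>2) * indicator {0..T} s \<partial>lborel) * indicator space_dom y \<partial>lborel)"
    by (rule nn_integral_cmult) measurable
  also have "(\<integral>\<^sup>+ y. (\<integral>\<^sup>+ s. ennreal ((\<phi> (y, s))\<^sup>2) * indicator {0..T} s \<partial>lborel) * indicator space_dom y \<partial>lborel) = msq cyl \<phi>"
    unfolding msq_def by (rule nn_integral_cyl_measure[symmetric]) measurable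
  finally show ?thesis .
qed

lemma msq_KH_star_le:
  assumes [measurable]: "\<phi> \<in> borel_measurable borel"
    and supp: "\<And>y r. y \<in> space_dom \<Longrightarrow> r \<in> {0..T} \<Longrightarrow> r \<notin> {a..b} \<Longrightarrow> \<phi> (y, r) = 0"
  shows "msq cyl (KH \<phi>) \<le> ennreal (4 * H * (b - a) powr (2 * H - 1)) * msq cyl \<phi>"
proof -
  have "msq cyl (KH \<phi>) \<le> (\<integral>\<^sup>+ z. (Kop (\<lambda>r. ennreal \<bar>\<phi> (fst z, r)\<bar>) (snd z))\<^sup>2 \<partial>cyl)"
    unfolding msq_def
  proof (rule nn_integral_mono)
    fix z :: "real \<times> real"
    have "(ennreal \<bar>KH \<phi> z\<bar>)\<^sup>2 \<le> (Kop (\<lambda>r. ennreal \<bar>\<phi> (fst z, r)\<bar>) (snd z))\<^sup>2"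
      using KH_star_le_Kop[of \<phi> "fst z" "snd z"] by (intro power_mono) auto
    then show "ennreal ((KH \<phi> z)\<^sup>2) \<le> (Kop (\<lambda>r. ennreal \<bar>\<phi> (fst z, r)\<bar>) (snd z))\<^sup>2"
      by (simp add: ennreal_power)
  qed
  also have "\<dots> \<le> ennreal (4 * H * (b - a) powr (2 * H - 1)) * msq cyl \<phi>"
    using assms by (rule nn_integral_cyl_Kop_square_le)
  finally show ?thesis .
qed

text \<open>With the whole interval as support, the Schur bound makes the positive majorant square
  integrable. It is then finite almost everywhere, which is absolute convergence. This provides the
  existence clause of \<open>represents\<close>.\<close>

lemma AE_set_integrable:
  assumes [measurable]: "\<phi> \<in> borel_measurable borel" and fin: "msq cyl \<phi> < \<infinity>"
  shows "AE (y, s) in cyl. set_integrable lborel {s..T} (\<lambda>r. \<phi> (y, r) * dKH H r s)"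
proof -
  let ?k = "\<lambda>z. Kop (\<lambda>r. ennreal \<bar>\<phi> (fst z, r)\<bar>) (snd z)"
  note [measurable] = real_Pair_measurable
  have [measurable]: "?k \<in> borel_measurable borel" by (rule Kop_abs_borel) measurable
  have m: "(\<lambda>z. (?k z)\<^sup>2) \<in> borel_measurable borel" by measurable
  have "(\<integral>\<^sup>+ z. (?k z)\<^sup>2 \<partial>cyl) \<le> ennreal (4 * H * (T - 0) powr (2 * H - 1)) * msq cyl \<phi>"
    by (rule nn_integral_cyl_Kop_square_le) auto
  also have "\<dots> < \<infinity>" using fin by (simp add: ennreal_mult_less_top)
  finally have "AE z in cyl. (?k z)\<^sup>2 \<noteq> \<infinity>"
    by (intro nn_integral_PInf_AE)
       (auto simp: cyl_measure_def intro!: measurable_restrict_space1 m)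
  then show ?thesis
  proof eventually_elim
    case (elim z)
    obtain y s where z: "z = (y, s)" by (cases z)
    from elim have fin: "Kop (\<lambda>r. ennreal \<bar>\<phi> (y, r)\<bar>) s < \<infinity>"
      by (cases "Kop (\<lambda>r. ennreal \<bar>\<phi> (y, r)\<bar>) s = \<infinity>")
        (simp_all add: z power2_eq_square ennreal_top_mult top.not_eq_extremum)
    have "integrable lborel (\<lambda>r. indicator {s..T} r *\<^sub>R (\<phi> (y, r) * dKH H r s))"
    proof (rule integrableI_bounded)
      have "(\<integral>\<^sup>+ r. ennreal (norm (indicator {s..T} r *\<^sub>R (\<phi> (y, r) * dKH H r s))) \<partial>lborel) = Kop (\<lambda>r. ennreal \<bar>\<phi> (y, r)\<bar>) s"
        unfolding Kop_def
        by (intro nn_integral_cong) (auto simp: indicator_def abs_mult ennreal_mult dKH_nonneg)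
      then show "(\<integral>\<^sup>+ r. ennreal (norm (indicator {s..T} r *\<^sub>R (\<phi> (y, r) * dKH H r s))) \<partial>lborel) < \<infinity>"
        using fin by simp
    qed measurable
    then show ?case by (simp add: z set_integrable_def)
  qed
qed

end

section \<open>Step functions are dense\<close>

lemma tendsto_zero_mono:
  fixes f g :: "nat \<Rightarrow> ennreal"
  assumes "g \<longlonglongrightarrow> 0" "\<And>n. f n \<le> g n"
  shows "f \<longlonglongrightarrow> 0"
  by (rule tendsto_sandwich[OF _ _ tendsto_const assms(1)]) (auto simp: assms(2))

lemma tendsto_ennreal_geometric: "(\<lambda>n. ennreal (c * (1 / 4) ^ n)) \<longlonglongrightarrow> 0"
proof -
  have "(\<lambda>n. ennreal (c * (1 / 4) ^ n)) \<longlonglongrightarrow> ennreal (c * 0)"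
    by (intro tendsto_ennrealI tendsto_mult_left LIMSEQ_power_zero) auto
  then show ?thesis unfolding mult_zero_right ennreal_0 .
qed

section \<open>Calculus of squared L2 norms\<close>

lemma msq_cong_AE:
  assumes "AE x in M. f x = g x"
  shows "msq M f = msq M g"
  unfolding msq_def by (rule nn_integral_cong_AE) (use assms in eventually_elim, simp)

lemma msq_mono_AE:
  assumes "AE x in M. \<bar>f x\<bar> \<le> \<bar>g x\<bar>"
  shows "msq M f \<le> msq M g"
  unfolding msq_def
proof (rule nn_integral_mono_AE)
  show "AE x in M. ennreal ((f x)\<^sup>2) \<le> ennreal ((g x)\<^sup>2)"
    using assms by eventually_elim (auto intro!: ennreal_leI simp: abs_le_square_iff)
qed

lemma msq_minus_commute: "msq M (\<lambda>x. f x - g x) = msq M (\<lambda>x. g x - f x)"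
  unfolding msq_def by (simp add: power2_commute)

lemma msq_cmult:
  assumes [measurable]: "f \<in> borel_measurable M"
  shows "msq M (\<lambda>x. c * f x) = ennreal (c\<^sup>2) * msq M f"
  unfolding msq_def by (simp add: power_mult_distrib ennreal_mult nn_integral_cmult)

lemma msq_add_le:
  assumes [measurable]: "f \<in> borel_measurable M" "g \<in> borel_measurable M"
  shows "msq M (\<lambda>x. f x + g x) \<le> 2 * (msq M f + msq M g)"
proof -
  have "msq M (\<lambda>x. f x + g x) \<le> (\<integral>\<^sup>+ x. 2 * (ennreal ((f x)\<^sup>2) + ennreal ((g x)\<^sup>2)) \<partial>M)"
    unfolding msq_def
  proof (rule nn_integral_mono)
    fix x
    have "(f x + g x)\<^sup>2 \<le> 2 * ((f x)\<^sup>2 + (g x)\<^sup>2)"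
      using sum_squares_bound[of "f x" "g x"] by (simp add: power2_sum)
    then have "ennreal ((f x + g x)\<^sup>2) \<le> ennreal (2 * ((f x)\<^sup>2 + (g x)\<^sup>2))"
      by (rule ennreal_leI)
    then show "ennreal ((f x + g x)\<^sup>2) \<le> 2 * (ennreal ((f x)\<^sup>2) + ennreal ((g x)\<^sup>2))"
      by (simp add: ennreal_mult')
  qed
  then show ?thesis
    by (simp add: nn_integral_cmult nn_integral_add msq_def)
qed

lemma msq_triangle:
  assumes [measurable]: "f \<in> borel_measurable M" "g \<in> borel_measurable M" "h \<in> borel_measurable M"
  shows "msq M (\<lambda>x. f x - h x) \<le> 2 * (msq M (\<lambda>x. f x - g x) + msq M (\<lambda>x. g x - h x))"
  using msq_add_le[of "\<lambda>x. f x - g x" M "\<lambda>x. g x - h x"] by simp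

lemma msq_le_diff:
  assumes [measurable]: "f \<in> borel_measurable M" "g \<in> borel_measurable M"
  shows "msq M f \<le> 2 * (msq M (\<lambda>x. f x - g x) + msq M g)"
  using msq_add_le[of "\<lambda>x. f x - g x" M g] by simp

lemma msq_add_finite:
  assumes "f \<in> borel_measurable M" "g \<in> borel_measurable M" "msq M f < \<infinity>" "msq M g < \<infinity>"
  shows "msq M (\<lambda>x. f x + c * g x) < \<infinity>"
proof -
  have "msq M (\<lambda>x. f x + c * g x) \<le> 2 * (msq M f + ennreal (c\<^sup>2) * msq M g)"
    using assms msq_add_le[of f M "\<lambda>x. c * g x"] msq_cmult[of g M c] by simp
  also have "\<dots> < \<infinity>"
    using assms by (simp add: ennreal_mult_less_top)
  finally show ?thesis .
qed

lemma msq_eq_0_AE: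
  assumes [measurable]: "f \<in> borel_measurable M" "g \<in> borel_measurable M"
    and "msq M (\<lambda>x. f x - g x) = 0"
  shows "AE x in M. f x = g x"
  using assms(3) unfolding msq_def by (subst (asm) nn_integral_0_iff_AE) (auto simp: ennreal_eq_0_iff)

lemma integrable_mult_msq:
  assumes [measurable]: "f \<in> borel_measurable M" "g \<in> borel_measurable M"
    and "msq M f < \<infinity>" "msq M g < \<infinity>"
  shows "integrable M (\<lambda>x. f x * g x)"
proof (rule integrableI_bounded)
  have "(\<integral>\<^sup>+ x. ennreal (norm (f x * g x)) \<partial>M) \<le> (\<integral>\<^sup>+ x. ennreal ((f x)\<^sup>2) + ennreal ((g x)\<^sup>2) \<partial>M)"
  proof (rule nn_integral_mono)
    fix x
    have "ennreal (norm (f x * g x)) = ennreal \<bar>f x\<bar> * ennreal \<bar>g x\<bar>"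
      by (simp add: abs_mult ennreal_mult)
    also have "\<dots> \<le> (ennreal \<bar>f x\<bar>)\<^sup>2 + (ennreal \<bar>g x\<bar>)\<^sup>2"
      by (rule ennreal_mult_le_add_squares)
    finally show "ennreal (norm (f x * g x)) \<le> ennreal ((f x)\<^sup>2) + ennreal ((g x)\<^sup>2)"
      by (simp add: ennreal_power)
  qed
  also have "\<dots> = msq M f + msq M g"
    unfolding msq_def by (rule nn_integral_add) auto
  also have "\<dots> < \<infinity>" using assms by simp
  finally show "(\<integral>\<^sup>+ x. ennreal (norm (f x * g x)) \<partial>M) < \<infinity>" .
qed simp

lemma msq_eq_integral:
  assumes [measurable]: "f \<in> borel_measurable M" and "msq M f < \<infinity>"
  shows "msq M f = ennreal (\<integral>x. f x * f x \<partial>M)"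
  using nn_integral_eq_integral[OF integrable_mult_msq[of f M f]] assms
  by (simp add: msq_def power2_eq_square)

lemma msq_dominated:
  assumes [measurable]: "\<And>n. f n \<in> borel_measurable M" "F \<in> borel_measurable M" "g \<in> borel_measurable M"
    and lim: "AE x in M. (\<lambda>n. f n x) \<longlonglongrightarrow> F x"
    and bnd: "\<And>n. AE x in M. \<bar>f n x\<bar> \<le> g x" and fin: "msq M g < \<infinity>"
  shows "(\<lambda>n. msq M (\<lambda>x. f n x - F x)) \<longlonglongrightarrow> 0"
proof -
  have "(\<lambda>n. \<integral>\<^sup>+ x. ennreal ((f n x - F x)\<^sup>2) \<partial>M) \<longlonglongrightarrow> (\<integral>\<^sup>+ x. 0 \<partial>M)"
  \<comment> \<open>The limit inherits the bound g, so the differences are at most 2g.\<close>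
  proof (rule nn_integral_dominated_convergence[where w="\<lambda>x. ennreal ((2 * g x)\<^sup>2)"])
    have B: "AE x in M. \<forall>n. \<bar>f n x\<bar> \<le> g x"
      using bnd by (simp add: AE_all_countable)
    show "AE x in M. ennreal ((f j x - F x)\<^sup>2) \<le> ennreal ((2 * g x)\<^sup>2)" for j
      using lim B
    proof eventually_elim
      case (elim x)
      have "(\<lambda>n. \<bar>f n x\<bar>) \<longlonglongrightarrow> \<bar>F x\<bar>"
        using elim by (intro tendsto_rabs) auto
      then have "\<bar>F x\<bar> \<le> g x"
        using elim by (intro LIMSEQ_le_const2) auto
      with elim(2)[rule_format, of j] have "\<bar>f j x - F x\<bar> \<le> \<bar>2 * g x\<bar>"
        by linarith
      then show ?case by (intro ennreal_leI) (simp add: abs_le_square_iff)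
    qed
    have "(\<integral>\<^sup>+ x. ennreal ((2 * g x)\<^sup>2) \<partial>M) = ennreal (2\<^sup>2) * msq M g"
      using msq_cmult[of g M 2] by (simp add: msq_def)
    then show "(\<integral>\<^sup>+ x. ennreal ((2 * g x)\<^sup>2) \<partial>M) < \<infinity>"
      using fin by (simp add: ennreal_mult_less_top)
    show "AE x in M. (\<lambda>i. ennreal ((f i x - F x)\<^sup>2)) \<longlonglongrightarrow> 0"
      using lim
    proof eventually_elim
      case (elim x)
      have "(\<lambda>i. ennreal ((f i x - F x)\<^sup>2)) \<longlonglongrightarrow> ennreal ((F x - F x)\<^sup>2)"
        by (intro tendsto_ennrealI tendsto_intros elim)
      then show ?case by simp
    qed
  qed measurable
  then show ?thesis by (simp add: msq_def)
qed

lemma borel_measurable_cyl: "f \<in> borel_measurable borel \<Longrightarrow> f \<in> borel_measurable (cyl_measure T)"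
  unfolding cyl_measure_def by (intro measurable_restrict_space1) simp

lemma emeasure_cyl_finite: "emeasure (cyl_measure T) (space (cyl_measure T)) < \<infinity>"
proof -
  have "bounded (space_dom \<times> {0..T})"
    unfolding space_dom_def by (intro bounded_Times) auto
  moreover have "space_dom \<times> {0..T} \<in> sets borel"
    unfolding space_dom_def by (intro borel_closed closed_Times) auto
  ultimately show ?thesis
    unfolding cyl_measure_def using emeasure_bounded_finite
    by (simp add: emeasure_restrict_space space_restrict_space)
qed

lemma msq_cyl_bounded:
  assumes "\<And>z. \<bar>f z\<bar> \<le> c"
  shows "msq (cyl_measure T) f < \<infinity>"
proof -
  have "msq (cyl_measure T) f \<le> (\<integral>\<^sup>+ z. ennreal (c\<^sup>2) \<partial>cyl_measure T)"
    unfolding msq_def using assms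
    by (intro nn_integral_mono ennreal_leI) (metis abs_ge_zero order_trans power2_abs power_mono)
  also have "\<dots> < \<infinity>"
    using emeasure_cyl_finite by (simp add: ennreal_mult_less_top)
  finally show ?thesis .
qed

lemma indicator_Times_borel:
  fixes U :: "real set"
  assumes "U \<in> sets borel"
  shows "(indicator (U \<times> {a..b::real}) :: _ \<Rightarrow> real) \<in> borel_measurable borel"
proof -
  have "U \<times> {a..b} \<in> sets (borel \<Otimes>\<^sub>M borel)" using assms by auto
  then show ?thesis unfolding borel_prod by simp
qed

section \<open>Linear combinations of step functions\<close>

lemma step_fun_simps[simp]:
  "step_fun [] z = 0"
  "step_fun ((c, U, t) # \<phi>) z = c * indicator (U \<times> {0..t}) z + step_fun \<phi> z"
  "step_fun (\<phi> @ \<psi>) z = step_fun \<phi> z + step_fun \<psi> z"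
  unfolding step_fun_def by auto

lemma is_step_simps[simp]:
  "is_step T []"
  "is_step T ((c, U, t) # \<phi>) \<longleftrightarrow> U \<in> sets borel \<and> U \<subseteq> space_dom \<and> 0 \<le> t \<and> t \<le> T \<and> is_step T \<phi>"
  "is_step T (\<phi> @ \<psi>) \<longleftrightarrow> is_step T \<phi> \<and> is_step T \<psi>"
  unfolding is_step_def by (simp_all add: ball_Un)

definition step_scale :: "real \<Rightarrow> step \<Rightarrow> step" where
  "step_scale d \<phi> = map (\<lambda>(c, U, t). (d * c, U, t)) \<phi>"

lemma step_fun_scale: "step_fun (step_scale d \<phi>) z = d * step_fun \<phi> z"
  unfolding step_scale_def by (induction \<phi>) (auto simp: algebra_simps)

lemma is_step_scale: "is_step T \<phi> \<Longrightarrow> is_step T (step_scale d \<phi>)"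
  unfolding step_scale_def by (induction \<phi>) auto

lemma step_diff_eq: "step_diff \<phi> \<psi> = \<phi> @ step_scale (- 1) \<psi>"
  unfolding step_diff_def step_scale_def by simp

lemma step_fun_diff: "step_fun (step_diff \<phi> \<psi>) z = step_fun \<phi> z - step_fun \<psi> z"
  unfolding step_diff_eq by (simp add: step_fun_scale)

lemma is_step_diff: "is_step T \<phi> \<Longrightarrow> is_step T \<psi> \<Longrightarrow> is_step T (step_diff \<phi> \<psi>)"
  unfolding step_diff_eq by (simp add: is_step_scale)

lemma step_fun_borel: "is_step T \<phi> \<Longrightarrow> step_fun \<phi> \<in> borel_measurable borel"
proof (induction \<phi>)
  case Nil
  then show ?case by (simp add: step_fun_def)
next
  case (Cons a \<phi>)
  obtain c U t where a: "a = (c, U, t)" by (cases a)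
  have "step_fun (a # \<phi>) = (\<lambda>z. c * indicator (U \<times> {0..t}) z + step_fun \<phi> z)"
    by (auto simp: a)
  with Cons indicator_Times_borel[of U 0 t] show ?case
    by (simp add: a)
qed

lemma step_fun_bounded: "\<exists>c. \<forall>z. \<bar>step_fun \<phi> z\<bar> \<le> c"
proof (induction \<phi>)
  case Nil
  then show ?case by auto
next
  case (Cons a \<phi>)
  obtain c U t where a: "a = (c, U, t)" by (cases a)
  from Cons obtain C where C: "\<And>z. \<bar>step_fun \<phi> z\<bar> \<le> C" by auto
  have "\<bar>step_fun (a # \<phi>) z\<bar> \<le> \<bar>c\<bar> + C" for z
    using C[of z] by (auto simp: a indicator_def split: if_splits)
  then show ?case by blast
qed

lemma msq_step_fun: "msq (cyl_measure T) (step_fun \<phi>) < \<infinity>"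
proof -
  obtain c where "\<And>z. \<bar>step_fun \<phi> z\<bar> \<le> c" using step_fun_bounded[of \<phi>] by auto
  then show ?thesis by (rule msq_cyl_bounded)
qed

section \<open>Density of step functions in L2 of the cylinder\<close>

definition step_approximable :: "real \<Rightarrow> (real \<times> real \<Rightarrow> real) \<Rightarrow> bool" where
  "step_approximable T f \<longleftrightarrow>
     (\<forall>e>0. \<exists>\<Phi>. is_step T \<Phi> \<and> msq (cyl_measure T) (\<lambda>z. step_fun \<Phi> z - f z) < ennreal e)"

lemma step_approximable_limit:
  assumes [measurable]: "f \<in> borel_measurable borel" "\<And>n. g n \<in> borel_measurable borel"
    and g: "\<And>n. step_approximable T (g n)"
    and lim: "(\<lambda>n. msq (cyl_measure T) (\<lambda>z. g n z - f z)) \<longlonglongrightarrow> 0"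
  shows "step_approximable T f"
  unfolding step_approximable_def
proof (intro allI impI)
  fix e :: real assume e: "e > 0"
  \<comment> \<open>A quarter of e for each error, because the relaxed triangle inequality doubles
    the sum of the two.\<close>
  then have "eventually (\<lambda>n. msq (cyl_measure T) (\<lambda>z. g n z - f z) < ennreal (e / 4)) sequentially"
    by (intro order_tendstoD(2)[OF lim]) auto
  then obtain n where n: "msq (cyl_measure T) (\<lambda>z. g n z - f z) < ennreal (e / 4)"
    by (auto simp: eventually_sequentially)
  obtain \<Phi> where \<Phi>: "is_step T \<Phi>" "msq (cyl_measure T) (\<lambda>z. step_fun \<Phi> z - g n z) < ennreal (e / 4)"
    using g[of n] e unfolding step_approximable_def by (meson divide_pos_pos zero_less_numeral)
  have "msq (cyl_measure T) (\<lambda>z. step_fun \<Phi> z - f z) \<le>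
    2 * (msq (cyl_measure T) (\<lambda>z. step_fun \<Phi> z - g n z) + msq (cyl_measure T) (\<lambda>z. g n z - f z))"
    by (intro msq_triangle borel_measurable_cyl step_fun_borel[OF \<Phi>(1)]) measurable
  also have "\<dots> < 2 * (ennreal (e / 4) + ennreal (e / 4))"
    by (intro ennreal_mult_strict_left_mono add_strict_mono n \<Phi>) auto
  also have "\<dots> = 4 * ennreal (e / 4)"
    by (simp add: mult_2[symmetric])
  also have "\<dots> = ennreal e"
    using e ennreal_mult'[of 4 "e / 4"] by simp
  finally show "\<exists>\<Phi>. is_step T \<Phi> \<and> msq (cyl_measure T) (\<lambda>z. step_fun \<Phi> z - f z) < ennreal e"
    using \<Phi>(1) by blast
qed

text \<open>The rate is chosen with almost sure convergence in mind: squared distances of order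
  4^(-n) are distances of order 2^(-n), hence summable, so that no subsequence has to be extracted
  later.\<close>

lemma step_approximable_seq:
  assumes "step_approximable T f"
  obtains \<Phi> where "\<And>n. is_step T (\<Phi> n)" "\<And>n. msq (cyl_measure T) (\<lambda>z. step_fun (\<Phi> n) z - f z) < ennreal ((1 / 4) ^ n)"
proof -
  have "\<forall>n. \<exists>\<Phi>. is_step T \<Phi> \<and> msq (cyl_measure T) (\<lambda>z. step_fun \<Phi> z - f z) < ennreal ((1 / 4) ^ n)"
    using assms unfolding step_approximable_def by simp
  then show ?thesis using that by metis
qed

lemma step_approximable_cong:
  assumes "\<And>z. z \<in> space_dom \<times> {0..T} \<Longrightarrow> f z = g z" "step_approximable T f"
  shows "step_approximable T g"
proof -
  have "msq (cyl_measure T) (\<lambda>z. step_fun \<Phi> z - f z) = msq (cyl_measure T) (\<lambda>z. step_fun \<Phi> z - g z)" for \<Phi>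
    unfolding msq_def by (rule nn_integral_cong) (use assms in \<open>auto simp: cyl_measure_def space_restrict_space\<close>)
  with assms(2) show ?thesis by (simp add: step_approximable_def)
qed

lemma step_approximable_step:
  assumes "is_step T \<Phi>"
  shows "step_approximable T (step_fun \<Phi>)"
  unfolding step_approximable_def using assms by (auto simp: msq_def intro!: exI[of _ \<Phi>])

lemma step_approximable_add:
  assumes [measurable]: "f \<in> borel_measurable borel" "g \<in> borel_measurable borel"
    and f: "step_approximable T f" and g: "step_approximable T g"
  shows "step_approximable T (\<lambda>z. f z + c * g z)"
proof -
  obtain \<Phi> where \<Phi>: "\<And>n. is_step T (\<Phi> n)" "\<And>n. msq (cyl_measure T) (\<lambda>z. step_fun (\<Phi> n) z - f z) < ennreal ((1 / 4) ^ n)"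
    using step_approximable_seq[OF f] by blast
  obtain \<Psi> where \<Psi>: "\<And>n. is_step T (\<Psi> n)" "\<And>n. msq (cyl_measure T) (\<lambda>z. step_fun (\<Psi> n) z - g z) < ennreal ((1 / 4) ^ n)"
    using step_approximable_seq[OF g] by blast
  let ?X = "\<lambda>n. \<Phi> n @ step_scale c (\<Psi> n)"
  have [measurable]: "step_fun (\<Phi> n) \<in> borel_measurable borel" "step_fun (\<Psi> n) \<in> borel_measurable borel" for n
    using \<Phi>(1) \<Psi>(1) by (auto intro: step_fun_borel)
  have X: "is_step T (?X n)" for n using \<Phi>(1) \<Psi>(1) by (simp add: is_step_scale)
  have le: "msq (cyl_measure T) (\<lambda>z. step_fun (?X n) z - (f z + c * g z)) \<le> ennreal ((2 + 2 * c\<^sup>2) * (1 / 4) ^ n)" for n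
  proof -
    have "msq (cyl_measure T) (\<lambda>z. step_fun (?X n) z - (f z + c * g z)) =
      msq (cyl_measure T) (\<lambda>z. (step_fun (\<Phi> n) z - f z) + c * (step_fun (\<Psi> n) z - g z))"
      by (simp add: step_fun_scale algebra_simps)
    also have "\<dots> \<le> 2 * (msq (cyl_measure T) (\<lambda>z. step_fun (\<Phi> n) z - f z) + msq (cyl_measure T) (\<lambda>z. c * (step_fun (\<Psi> n) z - g z)))"
      by (intro msq_add_le borel_measurable_cyl) measurable
    also have "msq (cyl_measure T) (\<lambda>z. c * (step_fun (\<Psi> n) z - g z)) = ennreal (c\<^sup>2) * msq (cyl_measure T) (\<lambda>z. step_fun (\<Psi> n) z - g z)"
      by (intro msq_cmult borel_measurable_cyl) measurable
    also have "2 * (msq (cyl_measure T) (\<lambda>z. step_fun (\<Phi> n) z - f z) + ennreal (c\<^sup>2) * msq (cyl_measure T) (\<lambda>z. step_fun (\<Psi> n) z - g z))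
      \<le> ennreal 2 * (ennreal ((1 / 4) ^ n) + ennreal (c\<^sup>2) * ennreal ((1 / 4) ^ n))"
      using less_imp_le[OF \<Phi>(2)] less_imp_le[OF \<Psi>(2)] by (intro mult_mono add_mono) auto
    also have "\<dots> = ennreal (2 * ((1 / 4) ^ n + c\<^sup>2 * (1 / 4) ^ n))"
      by (simp add: ennreal_mult)
    also have "2 * ((1 / 4) ^ n + c\<^sup>2 * (1 / 4) ^ n) = (2 + 2 * c\<^sup>2) * (1 / 4) ^ n"
      by (simp add: algebra_simps)
    finally show ?thesis .
  qed
  have "(\<lambda>n. msq (cyl_measure T) (\<lambda>z. step_fun (?X n) z - (f z + c * g z))) \<longlonglongrightarrow> 0"
    by (rule tendsto_zero_mono[OF tendsto_ennreal_geometric le])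
  then show ?thesis
    by (rule step_approximable_limit[rotated 3]) (measurable, rule step_fun_borel[OF X], rule step_approximable_step[OF X])
qed

lemma step_approximable_zero: "step_approximable T (\<lambda>z. 0)"
proof -
  have "step_fun [] = (\<lambda>z. 0)" by (rule ext) simp
  then show ?thesis using step_approximable_step[of T "[]"] by simp
qed

text \<open>A Dynkin argument over the lower left quadrants. They are stable under intersection, and
  each meets the cylinder in one rectangle starting at time 0 or not at all, so its indicator is
  already a step function there.\<close>

lemma step_approximable_indicator:
  assumes "0 \<le> T" and "A \<in> sets borel"
  shows "step_approximable T (indicator A)"
proof -
  have borel: "(borel :: (real \<times> real) measure) = sigma UNIV (range (\<lambda>a. {..a}))"
    by (rule borel_eq_atMost)
  have one: "step_approximable T (\<lambda>z. 1)"
  proof (rule step_approximable_cong)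
    show "step_approximable T (step_fun [(1, space_dom, T)])"
      using assms by (intro step_approximable_step) (auto simp: space_dom_def)
  qed auto
  have "Int_stable (range (\<lambda>a::real \<times> real. {..a}))"
  proof (rule Int_stableI)
    fix x y assume "x \<in> range (\<lambda>a::real \<times> real. {..a})" "y \<in> range (\<lambda>a::real \<times> real. {..a})"
    then obtain a b where "x = {..a}" "y = {..b}" by auto
    then have "x \<inter> y = {..inf a b}" by auto
    then show "x \<inter> y \<in> range (\<lambda>a::real \<times> real. {..a})" by auto
  qed
  moreover have "range (\<lambda>a::real \<times> real. {..a}) \<subseteq> Pow UNIV" by auto
  moreover have "A \<in> sigma_sets UNIV (range (\<lambda>a::real \<times> real. {..a}))"
    using assms(2) unfolding borel by simp
  ultimately show ?thesis
  proof (induction rule: sigma_sets_induct_disjoint)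
    case (basic B)
    then obtain a b :: real where B: "B = {..(a, b)}" by auto
    show ?case
    proof (cases "b < 0")
      case True
      have "step_approximable T (\<lambda>z. 0 :: real)" by (rule step_approximable_zero)
      then show ?thesis
        by (rule step_approximable_cong[rotated]) (use True in \<open>auto simp: B indicator_def\<close>)
    next
      case False
      \<comment> \<open>Cutting the quadrant down to \<open>space_dom\<close> and to times at most T
        makes the list admissible without changing the function on the cylinder.\<close>
      have "step_approximable T (step_fun [(1, {..a} \<inter> space_dom, min b T)])"
        using assms False by (intro step_approximable_step) (auto simp: space_dom_def)
      then show ?thesis
        by (rule step_approximable_cong[rotated]) (auto simp: B indicator_def)
    qed
  next
    case empty
    then show ?case using step_approximable_zero[of T] by (simp add: indicator_def)
  next
    case (compl B)
    then have "B \<in> sets borel" unfolding borel by simp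
    then have "step_approximable T (\<lambda>z. 1 + (- 1) * indicator B z)"
      using compl one by (intro step_approximable_add) auto
    then show ?case
      by (rule step_approximable_cong[rotated]) (auto simp: indicator_def)
  next
    case (union B)
    have B[measurable]: "B i \<in> sets borel" for i
      using union(2) unfolding borel by auto
    have part: "step_approximable T (\<lambda>z. \<Sum>i<n. indicator (B i) z)" for n
    proof (induction n)
      case 0
      then show ?case using step_approximable_zero by simp
    next
      case (Suc n)
      have "step_approximable T (\<lambda>z. (\<Sum>i<n. indicator (B i) z) + 1 * indicator (B n) z)"
        using Suc union(3) by (intro step_approximable_add) auto
      then show ?case by simp
    qed
    \<comment> \<open>Disjointness keeps the partial sums equal to indicators, hence below the
      square integrable constant 1.\<close>
    have eq: "(\<Sum>i<n. indicator (B i) z) = (indicator (\<Union>i<n. B i) z :: real)" for n z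
      by (intro indicator_UN_disjoint[symmetric] disjoint_family_on_mono[OF _ union(1)]) auto
    have sums: "(\<lambda>n. \<Sum>i<n. indicator (B i) z) \<longlonglongrightarrow> (indicator (\<Union>i. B i) z :: real)" for z
      unfolding eq by (rule LIMSEQ_indicator_UN)
    have le1: "(\<Sum>i<n. indicator (B i) z) \<le> (1 :: real)" for n z
      unfolding eq by (simp add: indicator_def)
    show ?case
    proof (rule step_approximable_limit[OF _ _ part])
      show "(\<lambda>n. msq (cyl_measure T) (\<lambda>z. (\<Sum>i<n. indicator (B i) z) - indicator (\<Union>i. B i) z)) \<longlonglongrightarrow> 0"
      proof (rule msq_dominated[where g = "\<lambda>z. 1"])
        show "AE z in cyl_measure T. \<bar>\<Sum>i<n. indicator (B i) z\<bar> \<le> (1 :: real)" for n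
          using le1 by (auto simp: abs_of_nonneg sum_nonneg)
        show "msq (cyl_measure T) (\<lambda>z. 1) < \<infinity>"
          by (rule msq_cyl_bounded[of _ 1]) simp
      qed (auto intro!: borel_measurable_cyl sums)
    qed auto
  qed
qed

lemma step_approximable_nonneg:
  assumes "0 \<le> T" and "f \<in> borel_measurable borel" "\<And>z. 0 \<le> f z" "msq (cyl_measure T) f < \<infinity>"
  shows "step_approximable T f"
  using assms(2-4)
proof (induction rule: borel_measurable_induct_real)
  case (set A)
  then show ?case using assms(1) by (intro step_approximable_indicator) auto
next
  case (mult u c)
  show ?case
  proof (cases "c = 0")
    case True
    then show ?thesis by (simp add: step_approximable_zero)
  next
    case False
    have "msq (cyl_measure T) (\<lambda>z. (1 / c) * (c * u z)) < \<infinity>"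
      using mult by (subst msq_cmult) (auto intro!: borel_measurable_cyl simp: ennreal_mult_less_top)
    with False have "msq (cyl_measure T) u < \<infinity>" by simp
    then have "step_approximable T (\<lambda>z. 0 + c * u z)"
      using mult by (intro step_approximable_add step_approximable_zero) auto
    then show ?thesis by simp
  qed
next
  case (add u v)
  have "msq (cyl_measure T) u \<le> msq (cyl_measure T) (\<lambda>x. v x + u x)"
    "msq (cyl_measure T) v \<le> msq (cyl_measure T) (\<lambda>x. v x + u x)"
    using add by (auto intro!: msq_mono_AE)
  then have "step_approximable T (\<lambda>z. v z + 1 * u z)"
    using add.prems add.hyps by (intro step_approximable_add add.IH) (auto elim: order.strict_trans1)
  then show ?case by simp
next
  case (seq U)
  have le: "U i z \<le> f z" for i z
  proof (rule incseq_le[of "\<lambda>i. U i z"])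
    show "incseq (\<lambda>i. U i z)"
      using \<open>incseq U\<close> by (intro monoI) (rule le_funD, rule monoD)
  qed (use seq in auto)
  have "msq (cyl_measure T) (U i) \<le> msq (cyl_measure T) f" for i
    using seq le assms by (intro msq_mono_AE) auto
  then have "msq (cyl_measure T) (U i) < \<infinity>" for i
    using seq.prems by (rule order.strict_trans1)
  then have ap: "step_approximable T (U i)" for i
    using seq.IH by auto
  have lim: "(\<lambda>n. msq (cyl_measure T) (\<lambda>z. U n z - f z)) \<longlonglongrightarrow> 0"
    using seq le assms by (intro msq_dominated[where g = f]) (auto intro!: borel_measurable_cyl)
  show ?case
    using assms(2) seq(1) ap lim by (rule step_approximable_limit[where g = U])
qed

text \<open>Density in plain L2 is what is needed because \<open>KH\<close> is bounded on that
  space: L2 approximations are also approximations in the norm of the noise.\<close>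

theorem step_approximable:
  assumes "0 \<le> T" and [measurable]: "f \<in> borel_measurable borel" and fin: "msq (cyl_measure T) f < \<infinity>"
  shows "step_approximable T f"
proof -
  have "msq (cyl_measure T) (\<lambda>z. max 0 (f z)) < \<infinity>" "msq (cyl_measure T) (\<lambda>z. max 0 (- f z)) < \<infinity>"
    by (rule order.strict_trans1[OF msq_mono_AE fin], simp)+
  then have "step_approximable T (\<lambda>z. max 0 (f z))" "step_approximable T (\<lambda>z. max 0 (- f z))"
    using assms(1) by (simp_all add: step_approximable_nonneg)
  then have "step_approximable T (\<lambda>z. max 0 (f z) + (- 1) * max 0 (- f z))"
    by (intro step_approximable_add) auto
  also have "(\<lambda>z. max 0 (f z) + (- 1) * max 0 (- f z)) = f" by (auto simp: fun_eq_iff max_def)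
  finally show ?thesis .
qed

section \<open>The isometry on step functions\<close>

lemma noise_cov_eq:
  assumes [measurable]: "U \<in> sets borel" "V \<in> sets borel" and U: "U \<subseteq> space_dom"
  shows "(\<integral>\<^sup>+ y. c * indicator U y * indicator V y * indicator space_dom y \<partial>lborel) = c * ennreal (measure lborel (U \<inter> V))"
proof -
  have "emeasure lborel (U \<inter> V) < \<infinity>"
    using U by (intro emeasure_bounded_finite bounded_subset[of "space_dom" "U \<inter> V"]) (auto simp: space_dom_def)
  then have e: "emeasure lborel (U \<inter> V) = ennreal (measure lborel (U \<inter> V))"
    by (intro emeasure_eq_ennreal_measure) simp
  have "(\<integral>\<^sup>+ y. c * indicator U y * indicator V y * indicator space_dom y \<partial>lborel) = (\<integral>\<^sup>+ y. c * indicator (U \<inter> V) y \<partial>lborel)"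
    using U by (intro nn_integral_cong) (auto simp: indicator_def)
  also have "\<dots> = c * emeasure lborel (U \<inter> V)"
    by (rule nn_integral_cmult_indicator) measurable
  finally show ?thesis unfolding e .
qed

context hurst
begin

text \<open>Additivity can fail where one of the integrals diverges and takes its default value,
  hence the almost everywhere form.\<close>

lemma KH_star_add:
  assumes [measurable]: "f \<in> borel_measurable borel" "g \<in> borel_measurable borel"
    and "msq cyl f < \<infinity>" "msq cyl g < \<infinity>"
  shows "AE z in cyl. KH (\<lambda>z. f z + c * g z) z = KH f z + c * KH g z"
  using AE_set_integrable[OF assms(1,3)] AE_set_integrable[OF assms(2,4)]
proof eventually_elim
  case (elim z)
  obtain y s where z: "z = (y, s)" by (cases z)
  from elim have f: "set_integrable lborel {s..T} (\<lambda>r. f (y, r) * dKH H r s)"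
    and g: "set_integrable lborel {s..T} (\<lambda>r. g (y, r) * dKH H r s)"
    by (auto simp: z)
  have "(LBINT r:{s..T}. f (y, r) * dKH H r s + c * (g (y, r) * dKH H r s)) =
    (LBINT r:{s..T}. f (y, r) * dKH H r s) + c * (LBINT r:{s..T}. g (y, r) * dKH H r s)"
    using f g by (subst set_integral_add) auto
  then show ?case by (simp add: z KH_star_def algebra_simps)
qed

lemma KH_star_diff:
  assumes "f \<in> borel_measurable borel" "g \<in> borel_measurable borel"
    and "msq cyl f < \<infinity>" "msq cyl g < \<infinity>"
  shows "AE z in cyl. KH (\<lambda>z. f z - g z) z = KH f z - KH g z"
  using KH_star_add[OF assms, of "- 1"] by simp

lemma msq_KH_star_le':
  assumes [measurable]: "\<phi> \<in> borel_measurable borel"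
  shows "msq cyl (KH \<phi>) \<le> ennreal (4 * H * T powr (2 * H - 1)) * msq cyl \<phi>"
  using msq_KH_star_le[of \<phi> 0 T] by simp

lemma msq_KH_star_finite:
  assumes "\<phi> \<in> borel_measurable borel" "msq cyl \<phi> < \<infinity>"
  shows "msq cyl (KH \<phi>) < \<infinity>"
  using msq_KH_star_le'[OF assms(1)] assms(2)
  by (auto simp: ennreal_mult_less_top intro: order.strict_trans1)

lemma msq_KH_star_diff_le:
  assumes [measurable]: "f \<in> borel_measurable borel" "g \<in> borel_measurable borel"
    and "msq cyl f < \<infinity>" "msq cyl g < \<infinity>"
  shows "msq cyl (\<lambda>z. KH f z - KH g z) \<le>
    ennreal (4 * H * T powr (2 * H - 1)) * msq cyl (\<lambda>z. f z - g z)"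
proof -
  have "msq cyl (\<lambda>z. KH f z - KH g z) = msq cyl (KH (\<lambda>z. f z - g z))"
    by (rule msq_cong_AE) (use KH_star_diff[OF assms] in eventually_elim, simp)
  also have "\<dots> \<le> ennreal (4 * H * T powr (2 * H - 1)) * msq cyl (\<lambda>z. f z - g z)"
    by (rule msq_KH_star_le') measurable
  finally show ?thesis .
qed

text \<open>Space and time separate. The identity persists where \<open>Kop\<close> is infinite,
  since the Bochner integral and \<open>enn2real\<close> both return 0 there.\<close>

lemma KH_star_rectangle:
  "KH (indicator (U \<times> {0..t})) (y, u) = indicator U y * enn2real (Kop (indicator {0..t}) u)"
proof -
  have "KH (indicator (U \<times> {0..t})) (y, u) =
    (\<integral>r. indicator U y * (indicator {u..T} r * (indicator {0..t} r * dKH H r u)) \<partial>lborel)"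
    unfolding KH_star_def set_lebesgue_integral_def prod.case
    by (intro Bochner_Integration.integral_cong) (auto simp: indicator_def)
  also have "\<dots> = indicator U y * (\<integral>r. indicator {u..T} r * (indicator {0..t} r * dKH H r u) \<partial>lborel)"
    by simp
  also have "(\<integral>r. indicator {u..T} r * (indicator {0..t} r * dKH H r u) \<partial>lborel) =
    enn2real (\<integral>\<^sup>+ r. ennreal (indicator {u..T} r * (indicator {0..t} r * dKH H r u)) \<partial>lborel)"
    by (intro integral_eq_nn_integral) (auto simp: dKH_nonneg)
  also have "(\<integral>\<^sup>+ r. ennreal (indicator {u..T} r * (indicator {0..t} r * dKH H r u)) \<partial>lborel) = Kop (indicator {0..t}) u"
    unfolding Kop_def by (intro nn_integral_cong) (auto simp: indicator_def)
  finally show ?thesis .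
qed

text \<open>The covariance formula with equal times bounds the integral of the square. Finiteness is
  what allows \<open>enn2real\<close> to be undone.\<close>

lemma AE_Kop_finite:
  assumes "t \<in> {0..T}"
  shows "AE u in lborel. u \<in> {0..T} \<longrightarrow> Kop (indicator {0..t}) u < \<infinity>"
proof -
  have "(\<integral>\<^sup>+ u. Kop (indicator {0..t}) u * Kop (indicator {0..t}) u * indicator {0..T} u \<partial>lborel) < \<infinity>"
    by (subst nn_integral_Kop_indicator) (use assms in auto)
  then have "AE u in lborel. Kop (indicator {0..t}) u * Kop (indicator {0..t}) u * indicator {0..T} u \<noteq> \<infinity>"
    by (intro nn_integral_PInf_AE) auto
  then show ?thesis
  proof eventually_elim
    case (elim u)
    show ?case
    proof
      assume "u \<in> {0..T}"
      with elim show "Kop (indicator {0..t}) u < \<infinity>"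
        by (cases "Kop (indicator {0..t}) u = \<infinity>") (simp_all add: ennreal_top_mult top.not_eq_extremum)
    qed
  qed
qed

lemma integral_KH_star_rectangles:
  assumes [measurable]: "U \<in> sets borel" "V \<in> sets borel" and UV: "U \<subseteq> space_dom" "V \<subseteq> space_dom"
    and st: "t \<in> {0..T}" "s \<in> {0..T}"
  shows "(\<integral>z. KH (indicator (U \<times> {0..t})) z * KH (indicator (V \<times> {0..s})) z \<partial>cyl) = noise_cov H U t V s"
proof -
  let ?K = "\<lambda>t u. Kop (indicator {0..t}) u"
  let ?R = "(t powr (2 * H) + s powr (2 * H) - \<bar>t - s\<bar> powr (2 * H)) / 2"
  let ?f = "\<lambda>z. KH (indicator (U \<times> {0..t})) z * KH (indicator (V \<times> {0..s})) z"
  have f[measurable]: "?f \<in> borel_measurable borel"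
    by (intro borel_measurable_times KH_star_borel indicator_Times_borel) measurable
  \<comment> \<open>Without nonnegativity of the covariance the real value could not be read back
    from \<open>ennreal\<close>.\<close>
  have R: "?R \<ge> 0"
  proof -
    have "\<bar>t - s\<bar> powr (2 * H) \<le> max t s powr (2 * H)"
      using st H_gt by (intro powr_mono2) auto
    also have "\<dots> \<le> t powr (2 * H) + s powr (2 * H)"
      by (auto simp: max_def)
    finally show ?thesis by simp
  qed
  have inner: "(\<integral>\<^sup>+ u. ennreal (?f (y, u)) * indicator {0..T} u \<partial>lborel) = ennreal ?R * indicator U y * indicator V y" for y
  proof -
    have "(\<integral>\<^sup>+ u. ennreal (?f (y, u)) * indicator {0..T} u \<partial>lborel) =
       (\<integral>\<^sup>+ u. (indicator U y * indicator V y) * (?K t u * ?K s u * indicator {0..T} u) \<partial>lborel)"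
    proof (rule nn_integral_cong_AE)
      show "AE u in lborel. ennreal (?f (y, u)) * indicator {0..T} u =
          (indicator U y * indicator V y) * (?K t u * ?K s u * indicator {0..T} u)"
        using AE_Kop_finite[OF st(1)] AE_Kop_finite[OF st(2)]
        by eventually_elim (auto simp: KH_star_rectangle indicator_def ennreal_mult ennreal_enn2real)
    qed
    also have "\<dots> = (indicator U y * indicator V y) * (\<integral>\<^sup>+ u. ?K t u * ?K s u * indicator {0..T} u \<partial>lborel)"
      by (rule nn_integral_cmult) measurable
    also have "(\<integral>\<^sup>+ u. ?K t u * ?K s u * indicator {0..T} u \<partial>lborel) = ennreal ?R"
      using st(2,1) by (rule nn_integral_Kop_indicator)
    finally show ?thesis by (simp only: mult_ac)
  qed
  have "(\<integral>z. ?f z \<partial>cyl) = enn2real (\<integral>\<^sup>+ z. ennreal (?f z) \<partial>cyl)"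
  proof (rule integral_eq_nn_integral)
    show "?f \<in> borel_measurable cyl" by (intro borel_measurable_cyl f)
    show "AE z in cyl. 0 \<le> ?f z"
      by (rule AE_I2) (auto simp: KH_star_rectangle)
  qed
  also have "(\<integral>\<^sup>+ z. ennreal (?f z) \<partial>cyl) =
     (\<integral>\<^sup>+ y. (\<integral>\<^sup>+ u. ennreal (?f (y, u)) * indicator {0..T} u \<partial>lborel) * indicator space_dom y \<partial>lborel)"
    by (rule nn_integral_cyl_measure) measurable
  also have "\<dots> = ennreal ?R * ennreal (measure lborel (U \<inter> V))"
    unfolding inner using UV by (intro noise_cov_eq) auto
  also have "enn2real \<dots> = noise_cov H U t V s"
    using R by (simp add: noise_cov_def enn2real_mult)
  finally show ?thesis .
qed

text \<open>Bilinear extension from rectangles. Linearity is established once, in the left factor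
  (\<open>cons\<close>); commuting the product reduces the right factor to it.\<close>

lemma integral_KH_star_step:
  assumes "is_step T \<Phi>" "is_step T \<Psi>"
  shows "(\<integral>z. KH (step_fun \<Phi>) z * KH (step_fun \<Psi>) z \<partial>cyl) = step_inner H \<Phi> \<Psi>"
proof -
  let ?M = "cyl" and ?K = "KH"
  have ind: "(indicator (U \<times> {0..t}) :: _ \<Rightarrow> real) \<in> borel_measurable borel" "msq ?M (indicator (U \<times> {0..t})) < \<infinity>"
    if "U \<in> sets borel" for U :: "real set" and t :: real
    by (rule indicator_Times_borel[OF that], rule msq_cyl_bounded[of _ 1], simp)
  have meas: "?K f \<in> borel_measurable ?M" if "f \<in> borel_measurable borel" for f
    using that by (intro borel_measurable_cyl KH_star_borel)
  have integr: "integrable ?M (\<lambda>z. ?K f z * ?K g z)"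
    if "f \<in> borel_measurable borel" "g \<in> borel_measurable borel" "msq ?M f < \<infinity>" "msq ?M g < \<infinity>" for f g
    using that by (intro integrable_mult_msq meas msq_KH_star_finite)
  have cons: "(\<integral>z. ?K (step_fun ((c, U, t) # \<Phi>)) z * ?K g z \<partial>?M) =
      c * (\<integral>z. ?K (indicator (U \<times> {0..t})) z * ?K g z \<partial>?M) + (\<integral>z. ?K (step_fun \<Phi>) z * ?K g z \<partial>?M)"
    if g: "g \<in> borel_measurable borel" "msq ?M g < \<infinity>" and \<Phi>: "is_step T \<Phi>" and U: "U \<in> sets borel"
    for c U t \<Phi> g
  proof -
    have eq: "step_fun ((c, U, t) # \<Phi>) = (\<lambda>z. step_fun \<Phi> z + c * indicator (U \<times> {0..t}) z)"
      by (rule ext) simp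
    have "(\<integral>z. ?K (step_fun ((c, U, t) # \<Phi>)) z * ?K g z \<partial>?M) =
      (\<integral>z. c * (?K (indicator (U \<times> {0..t})) z * ?K g z) + ?K (step_fun \<Phi>) z * ?K g z \<partial>?M)"
    proof (rule integral_cong_AE)
      show "AE z in ?M. ?K (step_fun ((c, U, t) # \<Phi>)) z * ?K g z =
          c * (?K (indicator (U \<times> {0..t})) z * ?K g z) + ?K (step_fun \<Phi>) z * ?K g z"
        using KH_star_add[OF step_fun_borel[OF \<Phi>] ind(1)[OF U, of t] msq_step_fun ind(2)[OF U, of t], of c] unfolding eq
        by eventually_elim (simp add: algebra_simps)
      have "step_fun ((c, U, t) # \<Phi>) \<in> borel_measurable borel"
        unfolding eq using step_fun_borel[OF \<Phi>] ind(1)[OF U, of t] by measurable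
      then show "(\<lambda>z. ?K (step_fun ((c, U, t) # \<Phi>)) z * ?K g z) \<in> borel_measurable ?M"
        by (intro borel_measurable_times meas g)
    qed (intro borel_measurable_times borel_measurable_add borel_measurable_const meas g step_fun_borel[OF \<Phi>] ind(1)[OF U])
    also have "\<dots> = c * (\<integral>z. ?K (indicator (U \<times> {0..t})) z * ?K g z \<partial>?M) + (\<integral>z. ?K (step_fun \<Phi>) z * ?K g z \<partial>?M)"
      using g \<Phi> U by (subst Bochner_Integration.integral_add) (auto intro!: integr ind step_fun_borel msq_step_fun)
    finally show ?thesis .
  qed
  have zero: "?K (\<lambda>_. 0) z = 0" for z
    by (cases z) (simp add: KH_star_def set_lebesgue_integral_def)
  have single: "(\<integral>z. ?K (indicator (U \<times> {0..t})) z * ?K (step_fun \<Psi>) z \<partial>?M) = (\<Sum>(d, V, s)\<leftarrow>\<Psi>. d * noise_cov H U t V s)"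
    if "is_step T \<Psi>" and U: "U \<in> sets borel" "U \<subseteq> space_dom" "t \<in> {0..T}" for U t \<Psi>
    using that(1)
  proof (induction \<Psi>)
    case Nil
    then show ?case by (simp add: zero)
  next
    case (Cons a \<Psi>)
    obtain d V s where a: "a = (d, V, s)" by (cases a)
    have "(\<integral>z. ?K (indicator (U \<times> {0..t})) z * ?K (step_fun (a # \<Psi>)) z \<partial>?M) =
      (\<integral>z. ?K (step_fun ((d, V, s) # \<Psi>)) z * ?K (indicator (U \<times> {0..t})) z \<partial>?M)"
      by (simp add: a mult.commute)
    also have "\<dots> = d * (\<integral>z. ?K (indicator (V \<times> {0..s})) z * ?K (indicator (U \<times> {0..t})) z \<partial>?M) +
      (\<integral>z. ?K (step_fun \<Psi>) z * ?K (indicator (U \<times> {0..t})) z \<partial>?M)"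
      using Cons.prems U by (intro cons ind) (auto simp: a)
    also have "(\<integral>z. ?K (indicator (V \<times> {0..s})) z * ?K (indicator (U \<times> {0..t})) z \<partial>?M) = noise_cov H U t V s"
      using Cons.prems U by (subst mult.commute) (intro integral_KH_star_rectangles, auto simp: a)
    also have "(\<integral>z. ?K (step_fun \<Psi>) z * ?K (indicator (U \<times> {0..t})) z \<partial>?M) = (\<Sum>(d, V, s)\<leftarrow>\<Psi>. d * noise_cov H U t V s)"
      using Cons by (subst mult.commute) (simp add: a)
    finally show ?case by (simp add: a)
  qed
  show ?thesis
    using assms(1)
  proof (induction \<Phi>)
    case Nil
    then show ?case by (simp add: zero step_inner_def)
  next
    case (Cons a \<Phi>)
    obtain c U t where a: "a = (c, U, t)" by (cases a)
    have "(\<integral>z. ?K (step_fun (a # \<Phi>)) z * ?K (step_fun \<Psi>) z \<partial>?M) =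
      c * (\<integral>z. ?K (indicator (U \<times> {0..t})) z * ?K (step_fun \<Psi>) z \<partial>?M) + (\<integral>z. ?K (step_fun \<Phi>) z * ?K (step_fun \<Psi>) z \<partial>?M)"
      unfolding a using Cons.prems assms(2) by (intro cons step_fun_borel msq_step_fun) (auto simp: a)
    also have "(\<integral>z. ?K (indicator (U \<times> {0..t})) z * ?K (step_fun \<Psi>) z \<partial>?M) = (\<Sum>(d, V, s)\<leftarrow>\<Psi>. d * noise_cov H U t V s)"
      using Cons.prems assms(2) by (intro single) (auto simp: a)
    also have "(\<integral>z. ?K (step_fun \<Phi>) z * ?K (step_fun \<Psi>) z \<partial>?M) = step_inner H \<Phi> \<Psi>"
      using Cons by (simp add: a)
    finally show ?case
      by (simp add: a step_inner_def sum_list_const_mult[symmetric] case_prod_unfold mult.assoc)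
  qed
qed

text \<open>Identifies \<open>step_norm\<close> with the L2 norm of the image under
  \<open>KH\<close>. In particular the covariance form is positive semidefinite, which its formula
  does not reveal.\<close>

theorem step_isometry:
  assumes "is_step T \<Phi>"
  shows "ennreal (step_inner H \<Phi> \<Phi>) = msq cyl (KH (step_fun \<Phi>))" "0 \<le> step_inner H \<Phi> \<Phi>"
proof -
  have 1: "KH (step_fun \<Phi>) \<in> borel_measurable cyl"
    using assms by (intro borel_measurable_cyl KH_star_borel step_fun_borel)
  have 2: "msq cyl (KH (step_fun \<Phi>)) < \<infinity>"
    using assms by (intro msq_KH_star_finite step_fun_borel msq_step_fun)
  show "ennreal (step_inner H \<Phi> \<Phi>) = msq cyl (KH (step_fun \<Phi>))"
    using msq_eq_integral[OF 1 2] integral_KH_star_step[OF assms assms] by simp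
  show "0 \<le> step_inner H \<Phi> \<Phi>"
    unfolding integral_KH_star_step[OF assms assms, symmetric]
    by (intro Bochner_Integration.integral_nonneg) simp
qed

lemma step_isometry_diff:
  assumes "is_step T \<Phi>" "is_step T \<Psi>"
  shows "ennreal (step_inner H (step_diff \<Phi> \<Psi>) (step_diff \<Phi> \<Psi>)) =
    msq cyl (\<lambda>z. KH (step_fun \<Phi>) z - KH (step_fun \<Psi>) z)"
proof -
  have "step_fun (step_diff \<Phi> \<Psi>) = (\<lambda>z. step_fun \<Phi> z - step_fun \<Psi> z)"
    by (rule ext) (simp add: step_fun_diff)
  moreover have "msq cyl (KH (\<lambda>z. step_fun \<Phi> z - step_fun \<Psi> z)) =
    msq cyl (\<lambda>z. KH (step_fun \<Phi>) z - KH (step_fun \<Psi>) z)"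
    by (rule msq_cong_AE, rule KH_star_diff)
       (rule step_fun_borel[OF assms(1)] step_fun_borel[OF assms(2)] msq_step_fun)+
  ultimately show ?thesis
    using step_isometry(1)[OF is_step_diff[OF assms]] by simp
qed

end

section \<open>The stochastic integral\<close>

lemma tendsto_zero_twice_add:
  fixes f g :: "'a \<Rightarrow> ennreal"
  assumes "(f \<longlongrightarrow> 0) F" "(g \<longlongrightarrow> 0) F"
  shows "((\<lambda>x. 2 * (f x + g x)) \<longlongrightarrow> 0) F"
  using ennreal_tendsto_cmult[OF _ tendsto_add[OF assms], of 2] by simp

text \<open>Riesz-Fischer with a rate. Geometric decay makes the increments summable in mean, hence
  almost surely; Fatou's lemma then passes the rate to the limit.\<close>

lemma (in prob_space) msq_Cauchy:
  fixes X :: "nat \<Rightarrow> 'a \<Rightarrow> real"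
  assumes [measurable]: "\<And>n. X n \<in> borel_measurable M" and c: "0 \<le> c"
    and le: "\<And>m n. n \<le> m \<Longrightarrow> msq M (\<lambda>\<omega>. X n \<omega> - X m \<omega>) \<le> ennreal (c * (1 / 4) ^ n)"
  obtains Y where "Y \<in> borel_measurable M" "AE \<omega> in M. (\<lambda>n. X n \<omega>) \<longlonglongrightarrow> Y \<omega>"
    "\<And>n. msq M (\<lambda>\<omega>. X n \<omega> - Y \<omega>) \<le> ennreal (c * (1 / 4) ^ n)"
proof -
  let ?d = "\<lambda>n \<omega>. \<bar>X n \<omega> - X (Suc n) \<omega>\<bar>"
  define Y where "Y \<omega> = lim (\<lambda>n. X n \<omega>)" for \<omega>
  have Y[measurable]: "Y \<in> borel_measurable M" unfolding Y_def by measurable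
  have d: "(\<integral>\<^sup>+ \<omega>. ennreal (?d n \<omega>) \<partial>M) \<le> ennreal ((c + 1) * (1 / 2) ^ n)" for n
  proof -
    have "(\<integral>\<^sup>+ \<omega>. ennreal (?d n \<omega>) \<partial>M) \<le> (\<integral>\<^sup>+ \<omega>. ennreal (2 ^ n) * ennreal ((X n \<omega> - X (Suc n) \<omega>)\<^sup>2) + ennreal ((1 / 2) ^ n) \<partial>M)"
    proof (rule nn_integral_mono)
      fix \<omega>
      let ?a = "?d n \<omega>"
      \<comment> \<open>A substitute for the Cauchy-Schwarz inequality: either the increment is at
        most 2^(-n), or multiplying it by 2^n times itself only enlarges it. As its mean square is
        of order 4^(-n), both terms have integrals of order 2^(-n).\<close>
      have "?a \<le> 2 ^ n * ?a\<^sup>2 + (1 / 2) ^ n"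
      proof (cases "?a \<le> (1 / 2) ^ n")
        case True
        have "0 \<le> 2 ^ n * ?a\<^sup>2" by simp
        with True show ?thesis by linarith
      next
        case False
        then have "1 \<le> 2 ^ n * ?a" by (simp add: field_simps power_divide)
        from mult_right_mono[OF this, of ?a] have "?a \<le> 2 ^ n * ?a\<^sup>2"
          by (simp add: power2_eq_square mult.assoc)
        moreover have "0 \<le> (1 / 2 :: real) ^ n" by simp
        ultimately show ?thesis by linarith
      qed
      then have "ennreal ?a \<le> ennreal (2 ^ n * ?a\<^sup>2 + (1 / 2) ^ n)" by (rule ennreal_leI)
      also have "\<dots> = ennreal (2 ^ n) * ennreal ((X n \<omega> - X (Suc n) \<omega>)\<^sup>2) + ennreal ((1 / 2) ^ n)"
        by (subst ennreal_plus) (auto simp: ennreal_mult)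
      finally show "ennreal ?a \<le> ennreal (2 ^ n) * ennreal ((X n \<omega> - X (Suc n) \<omega>)\<^sup>2) + ennreal ((1 / 2) ^ n)" .
    qed
    also have "\<dots> = ennreal (2 ^ n) * msq M (\<lambda>\<omega>. X n \<omega> - X (Suc n) \<omega>) + ennreal ((1 / 2) ^ n)"
      unfolding msq_def by (simp add: nn_integral_add nn_integral_cmult emeasure_space_1)
    also have "\<dots> \<le> ennreal (2 ^ n) * ennreal (c * (1 / 4) ^ n) + ennreal ((1 / 2) ^ n)"
      by (intro add_mono mult_left_mono le) auto
    also have "\<dots> = ennreal (2 ^ n * (c * (1 / 4) ^ n) + (1 / 2) ^ n)"
      using c by (simp add: ennreal_mult)
    also have "2 ^ n * (c * (1 / 4) ^ n) + (1 / 2) ^ n = (c + 1) * (1 / 2) ^ n"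
    proof -
      have "(2 :: real) ^ n * (1 / 4) ^ n = (1 / 2) ^ n"
        unfolding power_mult_distrib[symmetric] by simp
      then show ?thesis by (simp add: algebra_simps)
    qed
    finally show ?thesis .
  qed
  have "(\<integral>\<^sup>+ \<omega>. (\<Sum>n. ennreal (?d n \<omega>)) \<partial>M) = (\<Sum>n. \<integral>\<^sup>+ \<omega>. ennreal (?d n \<omega>) \<partial>M)"
    by (rule nn_integral_suminf) measurable
  also have "\<dots> \<le> (\<Sum>n. ennreal ((c + 1) * (1 / 2) ^ n))"
    by (intro suminf_le d) auto
  also have "\<dots> < \<infinity>"
    using c unfolding infinity_ennreal_def top.not_eq_extremum[symmetric]
    by (intro ennreal_suminf_neq_top summable_mult summable_geometric) auto
  finally have "AE \<omega> in M. (\<Sum>n. ennreal (?d n \<omega>)) \<noteq> \<infinity>"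
    by (intro nn_integral_PInf_AE) auto
  then have conv: "AE \<omega> in M. (\<lambda>n. X n \<omega>) \<longlonglongrightarrow> Y \<omega>"
  proof eventually_elim
    case (elim \<omega>)
    then have "summable (\<lambda>n. \<bar>X n \<omega> - X (Suc n) \<omega>\<bar>)"
      by (intro summable_suminf_not_top) auto
    then have "summable (\<lambda>n. X n \<omega> - X (Suc n) \<omega>)" by (rule summable_rabs_cancel)
    then have "(\<lambda>n. \<Sum>i<n. X i \<omega> - X (Suc i) \<omega>) \<longlonglongrightarrow> (\<Sum>i. X i \<omega> - X (Suc i) \<omega>)"
      by (rule summable_LIMSEQ)
    from tendsto_diff[OF tendsto_const[of "X 0 \<omega>"] this]
    have "(\<lambda>n. X n \<omega>) \<longlonglongrightarrow> X 0 \<omega> - (\<Sum>i. X i \<omega> - X (Suc i) \<omega>)"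
      unfolding sum_lessThan_telescope'[of "\<lambda>i. X i \<omega>"] by simp
    then have "convergent (\<lambda>n. X n \<omega>)" by (auto simp: convergent_def)
    then show ?case unfolding Y_def by (simp add: convergent_LIMSEQ_iff)
  qed
  have "msq M (\<lambda>\<omega>. X n \<omega> - Y \<omega>) \<le> ennreal (c * (1 / 4) ^ n)" for n
  proof -
    have "msq M (\<lambda>\<omega>. X n \<omega> - Y \<omega>) = (\<integral>\<^sup>+ \<omega>. liminf (\<lambda>m. ennreal ((X n \<omega> - X m \<omega>)\<^sup>2)) \<partial>M)"
      unfolding msq_def
    proof (rule nn_integral_cong_AE)
      show "AE \<omega> in M. ennreal ((X n \<omega> - Y \<omega>)\<^sup>2) = liminf (\<lambda>m. ennreal ((X n \<omega> - X m \<omega>)\<^sup>2))"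
        using conv
      proof eventually_elim
        case (elim \<omega>)
        show ?case
          by (intro lim_imp_Liminf[symmetric] tendsto_ennrealI tendsto_intros elim) simp
      qed
    qed
    also have "\<dots> \<le> liminf (\<lambda>m. msq M (\<lambda>\<omega>. X n \<omega> - X m \<omega>))"
      unfolding msq_def by (rule nn_integral_liminf) measurable
    also have "\<dots> \<le> liminf (\<lambda>m. ennreal (c * (1 / 4) ^ n))"
      by (intro Liminf_mono eventually_mono[OF eventually_ge_at_top[of n]] le)
    finally show ?thesis by (simp add: Liminf_const)
  qed
  then show ?thesis using that[of Y] Y conv by blast
qed

section \<open>Absolute moments of Gaussian variables\<close>

definition normal_moment :: "real \<Rightarrow> ennreal" where
  "normal_moment p = (\<integral>\<^sup>+ x. ennreal (std_normal_density x * \<bar>x\<bar> powr p) \<partial>lborel)"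

lemma normal_moment_2: "normal_moment 2 = 1"
proof -
  have "normal_moment 2 = (\<integral>\<^sup>+ x. ennreal (std_normal_density x * x ^ (2 * 1)) \<partial>lborel)"
    unfolding normal_moment_def by (intro nn_integral_cong) (simp add: powr_numeral)
  also have "\<dots> = ennreal (\<integral> x. std_normal_density x * x ^ (2 * 1) \<partial>lborel)"
    by (intro nn_integral_eq_integral integrable_std_normal_moment) auto
  also have "\<dots> = 1"
    unfolding integral_std_normal_moment_even by simp
  finally show ?thesis .
qed

lemma normal_moment_finite:
  assumes "0 \<le> p"
  shows "normal_moment p < \<infinity>"
proof -
  \<comment> \<open>Rounding p up reduces real exponents to integer moments of the normal law; the
    exponent 0 takes care of |x| \<le> 1.\<close>
  let ?k = "nat \<lceil>p\<rceil>"
  have "normal_moment p \<le> (\<integral>\<^sup>+ x. ennreal (std_normal_density x * \<bar>x\<bar> ^ 0 + std_normal_density x * \<bar>x\<bar> ^ ?k) \<partial>lborel)"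
    unfolding normal_moment_def
  proof (intro nn_integral_mono ennreal_leI)
    fix x :: real
    have "\<bar>x\<bar> powr p \<le> 1 + \<bar>x\<bar> ^ ?k"
    proof (cases "\<bar>x\<bar> \<le> 1")
      case True
      then have "\<bar>x\<bar> powr p \<le> 1 powr p" using assms by (intro powr_mono2) auto
      then show ?thesis by (simp add: add_increasing2)
    next
      case False
      then have "\<bar>x\<bar> powr p \<le> \<bar>x\<bar> powr real ?k"
        by (intro powr_mono) linarith+
      with False show ?thesis by (simp add: powr_realpow)
    qed
    then have "std_normal_density x * \<bar>x\<bar> powr p \<le> std_normal_density x * (1 + \<bar>x\<bar> ^ ?k)"
      by (intro mult_left_mono) auto
    then show "std_normal_density x * \<bar>x\<bar> powr p \<le> std_normal_density x * \<bar>x\<bar> ^ 0 + std_normal_density x * \<bar>x\<bar> ^ ?k"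
      by (simp add: algebra_simps)
  qed
  also have "\<dots> < \<infinity>"
    using integrable_std_normal_moment_abs[of 0] integrable_std_normal_moment_abs[of ?k]
    by (subst nn_integral_eq_integral) auto
  finally show ?thesis .
qed

text \<open>By scaling, a single \<sigma> fixes all moments, so a bound on the variance is a bound
  on every p-th moment. The degenerate case is absorbed as \<sigma> = 0.\<close>

lemma (in prob_space) centered_gaussian_moments:
  assumes "centered_gaussian M X"
  obtains \<sigma> where "0 \<le> \<sigma>" "msq M X = ennreal (\<sigma>\<^sup>2)"
    "\<And>p. 0 < p \<Longrightarrow> (\<integral>\<^sup>+ \<omega>. ennreal (\<bar>X \<omega>\<bar> powr p) \<partial>M) = ennreal (\<sigma> powr p) * normal_moment p"
proof -
  have [measurable]: "X \<in> borel_measurable M"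
    using assms unfolding centered_gaussian_def by auto
  have ex: "\<exists>\<sigma>\<ge>0. \<forall>p>0. (\<integral>\<^sup>+ \<omega>. ennreal (\<bar>X \<omega>\<bar> powr p) \<partial>M) = ennreal (\<sigma> powr p) * normal_moment p"
  proof (cases "AE \<omega> in M. X \<omega> = 0")
    case True
    have "(\<integral>\<^sup>+ \<omega>. ennreal (\<bar>X \<omega>\<bar> powr p) \<partial>M) = (\<integral>\<^sup>+ \<omega>. 0 \<partial>M)" if "p > 0" for p
      by (rule nn_integral_cong_AE) (use True in eventually_elim, auto)
    then show ?thesis by (intro exI[of _ 0]) auto
  next
    case False
    then obtain \<sigma> where \<sigma>: "\<sigma> > 0" "distributed M lborel X (normal_density 0 \<sigma>)"
      using assms unfolding centered_gaussian_def by auto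
    have D: "distributed M lborel (\<lambda>\<omega>. X \<omega> / \<sigma>) std_normal_density"
      using \<sigma> normal_standard_normal_convert[OF \<sigma>(1), of X 0] by simp
    have "(\<integral>\<^sup>+ \<omega>. ennreal (\<bar>X \<omega>\<bar> powr p) \<partial>M) = ennreal (\<sigma> powr p) * normal_moment p" if "p > 0" for p
    proof -
      have "(\<integral>\<^sup>+ \<omega>. ennreal (\<bar>X \<omega>\<bar> powr p) \<partial>M) = (\<integral>\<^sup>+ \<omega>. ennreal (\<sigma> powr p) * ennreal (\<bar>X \<omega> / \<sigma>\<bar> powr p) \<partial>M)"
        using \<sigma>(1) by (intro nn_integral_cong) (simp add: ennreal_mult[symmetric] powr_mult[symmetric] abs_divide)
      also have "\<dots> = ennreal (\<sigma> powr p) * (\<integral>\<^sup>+ \<omega>. ennreal (\<bar>X \<omega> / \<sigma>\<bar> powr p) \<partial>M)"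
        by (rule nn_integral_cmult) measurable
      also have "(\<integral>\<^sup>+ \<omega>. ennreal (\<bar>X \<omega> / \<sigma>\<bar> powr p) \<partial>M) = (\<integral>\<^sup>+ x. ennreal (std_normal_density x) * ennreal (\<bar>x\<bar> powr p) \<partial>lborel)"
        by (rule distributed_nn_integral[OF D, symmetric]) measurable
      also have "\<dots> = normal_moment p"
        unfolding normal_moment_def by (intro nn_integral_cong) (simp add: ennreal_mult)
      finally show ?thesis .
    qed
    with \<sigma>(1) show ?thesis by (intro exI[of _ \<sigma>]) auto
  qed
  then obtain \<sigma> where \<sigma>: "0 \<le> \<sigma>"
    "\<And>p. 0 < p \<Longrightarrow> (\<integral>\<^sup>+ \<omega>. ennreal (\<bar>X \<omega>\<bar> powr p) \<partial>M) = ennreal (\<sigma> powr p) * normal_moment p" by auto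
  have "msq M X = ennreal (\<sigma> powr 2) * normal_moment 2"
    unfolding msq_def by (subst \<sigma>(2)[symmetric]) (auto simp: powr_numeral)
  then have "msq M X = ennreal (\<sigma>\<^sup>2)"
    using \<sigma>(1) by (simp add: normal_moment_2 powr_numeral)
  with \<sigma> show ?thesis using that by blast
qed

section \<open>The noise on step functions\<close>

lemma step_noise_simps[simp]:
  "step_noise W [] \<omega> = 0"
  "step_noise W ((c, U, t) # \<phi>) \<omega> = c * W (U \<times> {0..t}) \<omega> + step_noise W \<phi> \<omega>"
  "step_noise W (\<phi> @ \<psi>) \<omega> = step_noise W \<phi> \<omega> + step_noise W \<psi> \<omega>"
  unfolding step_noise_def by auto

lemma step_noise_scale: "step_noise W (step_scale d \<phi>) \<omega> = d * step_noise W \<phi> \<omega>"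
  unfolding step_scale_def by (induction \<phi>) (auto simp: algebra_simps)

lemma step_noise_diff: "step_noise W (step_diff \<phi> \<psi>) \<omega> = step_noise W \<phi> \<omega> - step_noise W \<psi> \<omega>"
  unfolding step_diff_eq by (simp add: step_noise_scale)

locale hurst_noise = fractional_noise M W H T + hurst H T
  for M :: "'w measure" and W :: "(real \<times> real) set \<Rightarrow> 'w \<Rightarrow> real" and H T :: real
begin

lemma step_noise_measurable:
  assumes "is_step T \<Phi>"
  shows "step_noise W \<Phi> \<in> borel_measurable M"
  using gaussian[OF assms] unfolding centered_gaussian_def by auto

lemma msq_step_noise_finite:
  assumes "is_step T \<Phi>"
  shows "msq M (step_noise W \<Phi>) < \<infinity>"
  using centered_gaussian_moments[OF gaussian[OF assms]] by (metis ennreal_less_top infinity_ennreal_def)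

lemma integral_step_noise:
  assumes "is_step T \<Phi>" "is_step T \<Psi>"
  shows "(\<integral>\<omega>. step_noise W \<Phi> \<omega> * step_noise W \<Psi> \<omega> \<partial>M) = step_inner H \<Phi> \<Psi>"
proof -
  have W: "W (U \<times> {0..t}) \<in> borel_measurable M" "msq M (W (U \<times> {0..t})) < \<infinity>"
    if "U \<in> sets borel" "U \<subseteq> space_dom" "0 \<le> t" "t \<le> T" for U t
  proof -
    \<comment> \<open>A list with one entry recovers W itself, so the Gaussian assumption on lists
      yields its measurability and finite second moment.\<close>
    have s: "is_step T [(1, U, t)]" using that by simp
    have "step_noise W [(1, U, t)] = W (U \<times> {0..t})" by (rule ext) simp
    then show "W (U \<times> {0..t}) \<in> borel_measurable M" "msq M (W (U \<times> {0..t})) < \<infinity>"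
      using step_noise_measurable[OF s] msq_step_noise_finite[OF s] by auto
  qed
  have single: "(\<integral>\<omega>. W (U \<times> {0..t}) \<omega> * step_noise W \<Psi> \<omega> \<partial>M) = (\<Sum>(d, V, s)\<leftarrow>\<Psi>. d * noise_cov H U t V s)"
    if "is_step T \<Psi>" and U: "U \<in> sets borel" "U \<subseteq> space_dom" "0 \<le> t" "t \<le> T" for U t \<Psi>
    using that(1)
  proof (induction \<Psi>)
    case Nil
    then show ?case by simp
  next
    case (Cons a \<Psi>)
    obtain d V s where a: "a = (d, V, s)" by (cases a)
    have V: "V \<in> sets borel" "V \<subseteq> space_dom" "0 \<le> s" "s \<le> T" "is_step T \<Psi>"
      using Cons.prems by (auto simp: a)
    have "(\<integral>\<omega>. W (U \<times> {0..t}) \<omega> * step_noise W (a # \<Psi>) \<omega> \<partial>M) =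
      (\<integral>\<omega>. d * (W (U \<times> {0..t}) \<omega> * W (V \<times> {0..s}) \<omega>) + W (U \<times> {0..t}) \<omega> * step_noise W \<Psi> \<omega> \<partial>M)"
      by (simp add: a algebra_simps)
    also have "\<dots> = d * (\<integral>\<omega>. W (U \<times> {0..t}) \<omega> * W (V \<times> {0..s}) \<omega> \<partial>M) + (\<integral>\<omega>. W (U \<times> {0..t}) \<omega> * step_noise W \<Psi> \<omega> \<partial>M)"
      by (subst Bochner_Integration.integral_add)
         (auto intro!: integrable_mult_right integrable_mult_msq W U V step_noise_measurable msq_step_noise_finite)
    also have "(\<integral>\<omega>. W (U \<times> {0..t}) \<omega> * W (V \<times> {0..s}) \<omega> \<partial>M) = noise_cov H U t V s"
      using U V by (intro covariance) auto
    finally show ?case using Cons.IH[OF V(5)] by (simp add: a)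
  qed
  show ?thesis
    using assms(1)
  proof (induction \<Phi>)
    case Nil
    then show ?case by (simp add: step_inner_def)
  next
    case (Cons a \<Phi>)
    obtain c U t where a: "a = (c, U, t)" by (cases a)
    have U: "U \<in> sets borel" "U \<subseteq> space_dom" "0 \<le> t" "t \<le> T" "is_step T \<Phi>"
      using Cons.prems by (auto simp: a)
    have "(\<integral>\<omega>. step_noise W (a # \<Phi>) \<omega> * step_noise W \<Psi> \<omega> \<partial>M) =
      (\<integral>\<omega>. c * (W (U \<times> {0..t}) \<omega> * step_noise W \<Psi> \<omega>) + step_noise W \<Phi> \<omega> * step_noise W \<Psi> \<omega> \<partial>M)"
      by (simp add: a algebra_simps)
    also have "\<dots> = c * (\<integral>\<omega>. W (U \<times> {0..t}) \<omega> * step_noise W \<Psi> \<omega> \<partial>M) + (\<integral>\<omega>. step_noise W \<Phi> \<omega> * step_noise W \<Psi> \<omega> \<partial>M)"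
      by (subst Bochner_Integration.integral_add)
         (auto intro!: integrable_mult_right integrable_mult_msq W U assms(2) step_noise_measurable msq_step_noise_finite)
    also have "(\<integral>\<omega>. W (U \<times> {0..t}) \<omega> * step_noise W \<Psi> \<omega> \<partial>M) = (\<Sum>(d, V, s)\<leftarrow>\<Psi>. d * noise_cov H U t V s)"
      using assms(2) U by (intro single)
    finally show ?case
      using Cons.IH[OF U(5)]
      by (simp add: a step_inner_def sum_list_const_mult[symmetric] case_prod_unfold mult.assoc)
  qed
qed

text \<open>Both sides equal the covariance form at the difference of the lists. This is the bridge
  between the probability space and the cylinder.\<close>

lemma noise_isometry:
  assumes "is_step T \<Phi>" "is_step T \<Psi>"
  shows "msq M (\<lambda>\<omega>. step_noise W \<Phi> \<omega> - step_noise W \<Psi> \<omega>) =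
    msq cyl (\<lambda>z. KH (step_fun \<Phi>) z - KH (step_fun \<Psi>) z)"
proof -
  have s: "is_step T (step_diff \<Phi> \<Psi>)" using assms by (rule is_step_diff)
  have "msq M (step_noise W (step_diff \<Phi> \<Psi>)) = ennreal (step_inner H (step_diff \<Phi> \<Psi>) (step_diff \<Phi> \<Psi>))"
    using msq_eq_integral[OF step_noise_measurable[OF s] msq_step_noise_finite[OF s]] integral_step_noise[OF s s] by simp
  also have "step_noise W (step_diff \<Phi> \<Psi>) = (\<lambda>\<omega>. step_noise W \<Phi> \<omega> - step_noise W \<Psi> \<omega>)"
    by (rule ext) (rule step_noise_diff)
  finally show ?thesis
    using step_isometry_diff[OF assms] by simp
qed

text \<open>X and Y may come from different approximating sequences. The images of these under
  \<open>KH\<close> share a limit, so by the isometry the noises of the two sequences approach each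
  other, and with them X and Y coincide.\<close>

lemma noise_integral_unique:
  assumes X: "noise_integral M W H T \<phi> X" and Y: "noise_integral M W H T \<phi> Y"
  shows "AE \<omega> in M. X \<omega> = Y \<omega>"
proof -
  let ?K = "KH" and ?C = "cyl"
  from X obtain \<Phi> where [measurable]: "X \<in> borel_measurable M" and \<Phi>: "represents H T \<Phi> \<phi>"
    "(\<lambda>n. msq M (\<lambda>\<omega>. step_noise W (\<Phi> n) \<omega> - X \<omega>)) \<longlonglongrightarrow> 0"
    unfolding noise_integral_def msq_def by auto
  from Y obtain \<Psi> where [measurable]: "Y \<in> borel_measurable M" and \<Psi>: "represents H T \<Psi> \<phi>"
    "(\<lambda>n. msq M (\<lambda>\<omega>. step_noise W (\<Psi> n) \<omega> - Y \<omega>)) \<longlonglongrightarrow> 0"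
    unfolding noise_integral_def msq_def by auto
  have s: "is_step T (\<Phi> n)" "is_step T (\<Psi> n)" for n
    using \<Phi>(1) \<Psi>(1) unfolding represents_def step_Cauchy_def by auto
  note [measurable] = step_noise_measurable[OF s(1)] step_noise_measurable[OF s(2)]
  have K: "?K (step_fun (\<Phi> n)) \<in> borel_measurable ?C" "?K (step_fun (\<Psi> n)) \<in> borel_measurable ?C" for n
    using s by (auto intro!: borel_measurable_cyl KH_star_borel step_fun_borel)
  have K\<phi>: "?K \<phi> \<in> borel_measurable ?C"
    using \<Phi>(1) unfolding represents_def by auto
  have lim1: "(\<lambda>n. msq ?C (\<lambda>z. ?K (step_fun (\<Phi> n)) z - ?K \<phi> z)) \<longlonglongrightarrow> 0"
    using \<Phi>(1) unfolding represents_def msq_def by auto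
  have lim2: "(\<lambda>n. msq ?C (\<lambda>z. ?K \<phi> z - ?K (step_fun (\<Psi> n)) z)) \<longlonglongrightarrow> 0"
    using \<Psi>(1) unfolding represents_def msq_def by (auto simp: power2_commute)
  have lim3: "(\<lambda>n. msq M (\<lambda>\<omega>. step_noise W (\<Phi> n) \<omega> - step_noise W (\<Psi> n) \<omega>)) \<longlonglongrightarrow> 0"
  proof (rule tendsto_zero_mono[OF tendsto_zero_twice_add[OF lim1 lim2]])
    show "msq M (\<lambda>\<omega>. step_noise W (\<Phi> n) \<omega> - step_noise W (\<Psi> n) \<omega>) \<le>
      2 * (msq ?C (\<lambda>z. ?K (step_fun (\<Phi> n)) z - ?K \<phi> z) + msq ?C (\<lambda>z. ?K \<phi> z - ?K (step_fun (\<Psi> n)) z))" for n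
      unfolding noise_isometry[OF s] by (intro msq_triangle K K\<phi>)
  qed
  have lim4: "(\<lambda>n. msq M (\<lambda>\<omega>. step_noise W (\<Phi> n) \<omega> - Y \<omega>)) \<longlonglongrightarrow> 0"
  proof (rule tendsto_zero_mono[OF tendsto_zero_twice_add[OF lim3 \<Psi>(2)]])
    show "msq M (\<lambda>\<omega>. step_noise W (\<Phi> n) \<omega> - Y \<omega>) \<le>
      2 * (msq M (\<lambda>\<omega>. step_noise W (\<Phi> n) \<omega> - step_noise W (\<Psi> n) \<omega>) + msq M (\<lambda>\<omega>. step_noise W (\<Psi> n) \<omega> - Y \<omega>))" for n
      by (intro msq_triangle) measurable
  qed
  have lim0: "(\<lambda>n. msq M (\<lambda>\<omega>. X \<omega> - step_noise W (\<Phi> n) \<omega>)) \<longlonglongrightarrow> 0"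
    using \<Phi>(2) by (subst msq_minus_commute)
  have "(\<lambda>n. msq M (\<lambda>\<omega>. X \<omega> - Y \<omega>)) \<longlonglongrightarrow> 0"
  proof (rule tendsto_zero_mono[OF tendsto_zero_twice_add[OF lim0 lim4]])
    show "msq M (\<lambda>\<omega>. X \<omega> - Y \<omega>) \<le>
      2 * (msq M (\<lambda>\<omega>. X \<omega> - step_noise W (\<Phi> n) \<omega>) + msq M (\<lambda>\<omega>. step_noise W (\<Phi> n) \<omega> - Y \<omega>))" for n
      by (intro msq_triangle) measurable
  qed
  then have "msq M (\<lambda>\<omega>. X \<omega> - Y \<omega>) = 0"
    by (simp add: LIMSEQ_const_iff)
  then show ?thesis by (intro msq_eq_0_AE) measurable
qed

text \<open>A strengthening of \<^const>\<open>noise_integral\<close> that is closed under linear combinations: the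
  approximation takes place in \<open>L\<^sup>2\<close> of the cylinder, hence also after applying
  \<^const>\<open>KH_star\<close>, and the approximating integrals converge almost surely as well.\<close>

definition wiener_integral :: "(real \<times> real \<Rightarrow> real) \<Rightarrow> ('w \<Rightarrow> real) \<Rightarrow> bool" where
  "wiener_integral \<phi> X \<longleftrightarrow> X \<in> borel_measurable M \<and>
     (\<exists>\<Phi>. (\<forall>n. is_step T (\<Phi> n)) \<and>
       (\<lambda>n. msq cyl (\<lambda>z. step_fun (\<Phi> n) z - \<phi> z)) \<longlonglongrightarrow> 0 \<and>
       (\<lambda>n. msq M (\<lambda>\<omega>. step_noise W (\<Phi> n) \<omega> - X \<omega>)) \<longlonglongrightarrow> 0 \<and>
       (AE \<omega> in M. (\<lambda>n. step_noise W (\<Phi> n) \<omega>) \<longlonglongrightarrow> X \<omega>))"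

section \<open>Wiener integrals: existence, linearity and moments\<close>

lemma KH_star_tendsto:
  assumes "\<phi> \<in> borel_measurable borel" "msq cyl \<phi> < \<infinity>" and s: "\<And>n. is_step T (\<Phi> n)"
    and lim: "(\<lambda>n. msq cyl (\<lambda>z. step_fun (\<Phi> n) z - \<phi> z)) \<longlonglongrightarrow> 0"
  shows "(\<lambda>n. msq cyl (\<lambda>z. KH (step_fun (\<Phi> n)) z - KH \<phi> z)) \<longlonglongrightarrow> 0"
proof (rule tendsto_zero_mono)
  show "(\<lambda>n. ennreal (4 * H * T powr (2 * H - 1)) * msq cyl (\<lambda>z. step_fun (\<Phi> n) z - \<phi> z)) \<longlonglongrightarrow> 0"
    using ennreal_tendsto_cmult[OF _ lim, of "ennreal (4 * H * T powr (2 * H - 1))"] by simp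
  show "msq cyl (\<lambda>z. KH (step_fun (\<Phi> n)) z - KH \<phi> z) \<le>
     ennreal (4 * H * T powr (2 * H - 1)) * msq cyl (\<lambda>z. step_fun (\<Phi> n) z - \<phi> z)" for n
    by (intro msq_KH_star_diff_le step_fun_borel[OF s] msq_step_fun assms)
qed

lemma wiener_integral_noise_integral:
  assumes \<phi>: "\<phi> \<in> borel_measurable borel" "msq cyl \<phi> < \<infinity>" and "wiener_integral \<phi> X"
  shows "noise_integral M W H T \<phi> X"
proof -
  from assms(3) obtain \<Phi> where X: "X \<in> borel_measurable M" and s: "\<And>n. is_step T (\<Phi> n)"
    and 1: "(\<lambda>n. msq cyl (\<lambda>z. step_fun (\<Phi> n) z - \<phi> z)) \<longlonglongrightarrow> 0"
    and 2: "(\<lambda>n. msq M (\<lambda>\<omega>. step_noise W (\<Phi> n) \<omega> - X \<omega>)) \<longlonglongrightarrow> 0"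
    unfolding wiener_integral_def by auto
  have 3: "(\<lambda>n. msq cyl (\<lambda>z. KH (step_fun (\<Phi> n)) z - KH \<phi> z)) \<longlonglongrightarrow> 0"
    using \<phi> s 1 by (rule KH_star_tendsto)
  have K: "KH (step_fun (\<Phi> n)) \<in> borel_measurable cyl" "KH \<phi> \<in> borel_measurable cyl" for n
    by (intro borel_measurable_cyl KH_star_borel step_fun_borel[OF s] \<phi>)+
  have "step_Cauchy H T \<Phi>"
    unfolding step_Cauchy_def
  proof (intro conjI allI impI s)
    fix e :: real assume e: "e > 0"
    \<comment> \<open>\<open>step_norm\<close> is a square root, and 2 (e^2/4 + e^2/4) = e^2 in the
      relaxed triangle inequality.\<close>
    then have "\<forall>\<^sub>F n in sequentially. msq cyl (\<lambda>z. KH (step_fun (\<Phi> n)) z - KH \<phi> z) < ennreal (e\<^sup>2 / 4)"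
      by (intro order_tendstoD(2)[OF 3]) auto
    then obtain N where N: "\<And>n. n \<ge> N \<Longrightarrow> msq cyl (\<lambda>z. KH (step_fun (\<Phi> n)) z - KH \<phi> z) < ennreal (e\<^sup>2 / 4)"
      unfolding eventually_sequentially by auto
    show "\<exists>N. \<forall>m\<ge>N. \<forall>n\<ge>N. step_norm H (step_diff (\<Phi> m) (\<Phi> n)) < e"
    proof (intro exI allI impI)
      fix m n assume mn: "N \<le> m" "N \<le> n"
      have "ennreal (step_inner H (step_diff (\<Phi> m) (\<Phi> n)) (step_diff (\<Phi> m) (\<Phi> n))) =
        msq cyl (\<lambda>z. KH (step_fun (\<Phi> m)) z - KH (step_fun (\<Phi> n)) z)"
        by (rule step_isometry_diff[OF s s])
      also have "\<dots> \<le> 2 * (msq cyl (\<lambda>z. KH (step_fun (\<Phi> m)) z - KH \<phi> z) +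
          msq cyl (\<lambda>z. KH \<phi> z - KH (step_fun (\<Phi> n)) z))"
        by (intro msq_triangle K)
      also have "\<dots> < 2 * (ennreal (e\<^sup>2 / 4) + ennreal (e\<^sup>2 / 4))"
        using N[OF mn(1)] N[OF mn(2)] by (intro ennreal_mult_strict_left_mono add_strict_mono) (auto simp: msq_minus_commute[of _ "KH \<phi>"])
      also have "\<dots> = 4 * ennreal (e\<^sup>2 / 4)" by (simp add: mult_2[symmetric])
      also have "\<dots> = ennreal (e\<^sup>2)" using ennreal_mult'[of 4 "e\<^sup>2 / 4"] by simp
      finally have "step_inner H (step_diff (\<Phi> m) (\<Phi> n)) (step_diff (\<Phi> m) (\<Phi> n)) < e\<^sup>2"
        using e by (simp add: ennreal_less_iff[OF step_isometry(2)[OF is_step_diff[OF s s]]])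
      then show "step_norm H (step_diff (\<Phi> m) (\<Phi> n)) < e"
        unfolding step_norm_def using e by (intro real_less_lsqrt) auto
    qed
  qed
  moreover have "AE (y, s) in cyl. set_integrable lborel {s..T} (\<lambda>r. \<phi> (y, r) * dKH H r s)"
    using \<phi> by (rule AE_set_integrable)
  ultimately have "represents H T \<Phi> \<phi>"
    using K(2) 3 unfolding represents_def msq_def by auto
  then show ?thesis
    using X 2 unfolding noise_integral_def msq_def by auto
qed

text \<open>Density gives step functions with rate 4^(-n). Boundedness of \<open>KH\<close> and the
  isometry carry the rate over to the noises, and completeness with a rate supplies mean square and
  almost sure convergence at once.\<close>

lemma wiener_integral_exists:
  assumes \<phi>: "\<phi> \<in> borel_measurable borel" "msq cyl \<phi> < \<infinity>"
  shows "\<exists>X. wiener_integral \<phi> X"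
proof -
  have "step_approximable T \<phi>" using \<phi> T_pos by (intro step_approximable) auto
  then obtain \<Phi> where s: "\<And>n. is_step T (\<Phi> n)"
    and \<Phi>: "\<And>n. msq cyl (\<lambda>z. step_fun (\<Phi> n) z - \<phi> z) < ennreal ((1 / 4) ^ n)"
    by (rule step_approximable_seq) blast
  let ?C = "4 * H * T powr (2 * H - 1)"
  have C: "?C \<ge> 0" using H_gt by simp
  have sb: "step_fun (\<Phi> n) \<in> borel_measurable cyl" for n
    by (intro borel_measurable_cyl step_fun_borel[OF s])
  have le: "msq M (\<lambda>\<omega>. step_noise W (\<Phi> n) \<omega> - step_noise W (\<Phi> m) \<omega>) \<le> ennreal (4 * ?C * (1 / 4) ^ n)" if "n \<le> m" for m n
  proof -
    have "msq cyl (\<lambda>z. step_fun (\<Phi> n) z - step_fun (\<Phi> m) z) \<le>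
      2 * (msq cyl (\<lambda>z. step_fun (\<Phi> n) z - \<phi> z) + msq cyl (\<lambda>z. \<phi> z - step_fun (\<Phi> m) z))"
      by (intro msq_triangle sb borel_measurable_cyl \<phi>)
    also have "\<dots> \<le> 2 * (ennreal ((1 / 4) ^ n) + ennreal ((1 / 4) ^ n))"
    proof (intro mult_left_mono add_mono)
      show "msq cyl (\<lambda>z. step_fun (\<Phi> n) z - \<phi> z) \<le> ennreal ((1 / 4) ^ n)"
        using \<Phi>[of n] by (rule less_imp_le)
      have "msq cyl (\<lambda>z. \<phi> z - step_fun (\<Phi> m) z) \<le> ennreal ((1 / 4) ^ m)"
        using \<Phi>[of m] unfolding msq_minus_commute[of _ \<phi>] by (rule less_imp_le)
      also have "\<dots> \<le> ennreal ((1 / 4) ^ n)"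
        using that by (intro ennreal_leI power_decreasing) auto
      finally show "msq cyl (\<lambda>z. \<phi> z - step_fun (\<Phi> m) z) \<le> ennreal ((1 / 4) ^ n)" .
    qed simp
    also have "\<dots> = 4 * ennreal ((1 / 4) ^ n)"
      by (simp add: mult_2[symmetric])
    also have "\<dots> = ennreal (4 * (1 / 4) ^ n)"
      using ennreal_mult'[of 4 "(1 / 4) ^ n"] by simp
    finally have *: "msq cyl (\<lambda>z. step_fun (\<Phi> n) z - step_fun (\<Phi> m) z) \<le> ennreal (4 * (1 / 4) ^ n)" .
    have "msq M (\<lambda>\<omega>. step_noise W (\<Phi> n) \<omega> - step_noise W (\<Phi> m) \<omega>) \<le> ennreal ?C * msq cyl (\<lambda>z. step_fun (\<Phi> n) z - step_fun (\<Phi> m) z)"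
      unfolding noise_isometry[OF s s] by (intro msq_KH_star_diff_le step_fun_borel[OF s] msq_step_fun)
    also have "\<dots> \<le> ennreal ?C * ennreal (4 * (1 / 4) ^ n)"
      using * by (rule mult_left_mono) simp
    also have "\<dots> = ennreal (?C * (4 * (1 / 4) ^ n))"
      using C by (rule ennreal_mult'[symmetric])
    also have "?C * (4 * (1 / 4) ^ n) = 4 * ?C * (1 / 4) ^ n"
      by (simp only: mult_ac)
    finally show ?thesis .
  qed
  have C4: "0 \<le> 4 * ?C" using C by simp
  obtain X where X: "X \<in> borel_measurable M" "AE \<omega> in M. (\<lambda>n. step_noise W (\<Phi> n) \<omega>) \<longlonglongrightarrow> X \<omega>"
    "\<And>n. msq M (\<lambda>\<omega>. step_noise W (\<Phi> n) \<omega> - X \<omega>) \<le> ennreal (4 * ?C * (1 / 4) ^ n)"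
    by (rule msq_Cauchy[where X = "\<lambda>n. step_noise W (\<Phi> n)", OF step_noise_measurable[OF s] C4 le]) (assumption, rule that, assumption+)
  have "(\<lambda>n. msq cyl (\<lambda>z. step_fun (\<Phi> n) z - \<phi> z)) \<longlonglongrightarrow> 0"
    by (rule tendsto_zero_mono[OF tendsto_ennreal_geometric[of 1]]) (simp add: \<Phi> less_imp_le)
  moreover have "(\<lambda>n. msq M (\<lambda>\<omega>. step_noise W (\<Phi> n) \<omega> - X \<omega>)) \<longlonglongrightarrow> 0"
    by (rule tendsto_zero_mono[OF tendsto_ennreal_geometric X(3)])
  ultimately show ?thesis
    unfolding wiener_integral_def using X s by blast
qed

lemma wiener_integral_add:
  assumes [measurable]: "\<phi> \<in> borel_measurable borel" "\<psi> \<in> borel_measurable borel"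
    and X: "wiener_integral \<phi> X" and Y: "wiener_integral \<psi> Y"
  shows "wiener_integral (\<lambda>z. \<phi> z + c * \<psi> z) (\<lambda>\<omega>. X \<omega> + c * Y \<omega>)"
proof -
  from X obtain \<Phi> where [measurable]: "X \<in> borel_measurable M" and \<Phi>: "\<And>n. is_step T (\<Phi> n)"
    "(\<lambda>n. msq cyl (\<lambda>z. step_fun (\<Phi> n) z - \<phi> z)) \<longlonglongrightarrow> 0"
    "(\<lambda>n. msq M (\<lambda>\<omega>. step_noise W (\<Phi> n) \<omega> - X \<omega>)) \<longlonglongrightarrow> 0"
    "AE \<omega> in M. (\<lambda>n. step_noise W (\<Phi> n) \<omega>) \<longlonglongrightarrow> X \<omega>"
    unfolding wiener_integral_def by auto
  from Y obtain \<Psi> where [measurable]: "Y \<in> borel_measurable M" and \<Psi>: "\<And>n. is_step T (\<Psi> n)"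
    "(\<lambda>n. msq cyl (\<lambda>z. step_fun (\<Psi> n) z - \<psi> z)) \<longlonglongrightarrow> 0"
    "(\<lambda>n. msq M (\<lambda>\<omega>. step_noise W (\<Psi> n) \<omega> - Y \<omega>)) \<longlonglongrightarrow> 0"
    "AE \<omega> in M. (\<lambda>n. step_noise W (\<Psi> n) \<omega>) \<longlonglongrightarrow> Y \<omega>"
    unfolding wiener_integral_def by auto
  note [measurable] = step_noise_measurable[OF \<Phi>(1)] step_noise_measurable[OF \<Psi>(1)]
    step_fun_borel[OF \<Phi>(1)] step_fun_borel[OF \<Psi>(1)]
  \<comment> \<open>Proved for an arbitrary measure, since it is applied once on the cylinder and
    once on the probability space.\<close>
  have lim: "(\<lambda>n. msq N (\<lambda>x. (f n x - F x) + c * (g n x - G x))) \<longlonglongrightarrow> 0"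
    if m: "\<And>n. f n \<in> borel_measurable N" "F \<in> borel_measurable N" "\<And>n. g n \<in> borel_measurable N" "G \<in> borel_measurable N"
      and l: "(\<lambda>n. msq N (\<lambda>x. f n x - F x)) \<longlonglongrightarrow> 0" "(\<lambda>n. msq N (\<lambda>x. g n x - G x)) \<longlonglongrightarrow> 0"
    for N :: "'c measure" and f F g G
  proof -
    note [measurable] = m
    have l2: "(\<lambda>n. msq N (\<lambda>x. c * (g n x - G x))) \<longlonglongrightarrow> 0"
    proof -
      have "(\<lambda>n. msq N (\<lambda>x. c * (g n x - G x))) = (\<lambda>n. ennreal (c\<^sup>2) * msq N (\<lambda>x. g n x - G x))"
        by (intro ext msq_cmult) measurable
      then show ?thesis
        using ennreal_tendsto_cmult[OF _ l(2), of "ennreal (c\<^sup>2)"] by simp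
    qed
    show ?thesis
    proof (rule tendsto_zero_mono[OF tendsto_zero_twice_add[OF l(1) l2]])
      show "msq N (\<lambda>x. (f n x - F x) + c * (g n x - G x)) \<le>
        2 * (msq N (\<lambda>x. f n x - F x) + msq N (\<lambda>x. c * (g n x - G x)))" for n
        by (intro msq_add_le) measurable
    qed
  qed
  let ?X = "\<lambda>n. \<Phi> n @ step_scale c (\<Psi> n)"
  have 1: "step_fun (?X n) z - (\<phi> z + c * \<psi> z) = (step_fun (\<Phi> n) z - \<phi> z) + c * (step_fun (\<Psi> n) z - \<psi> z)" for n z
    by (simp add: step_fun_scale algebra_simps)
  have 2: "step_noise W (?X n) \<omega> - (X \<omega> + c * Y \<omega>) = (step_noise W (\<Phi> n) \<omega> - X \<omega>) + c * (step_noise W (\<Psi> n) \<omega> - Y \<omega>)" for n \<omega>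
    by (simp add: step_noise_scale algebra_simps)
  have "(\<lambda>n. msq cyl (\<lambda>z. step_fun (?X n) z - (\<phi> z + c * \<psi> z))) \<longlonglongrightarrow> 0"
    unfolding 1 by (rule lim) (auto intro!: borel_measurable_cyl \<Phi> \<Psi>)
  moreover have "(\<lambda>n. msq M (\<lambda>\<omega>. step_noise W (?X n) \<omega> - (X \<omega> + c * Y \<omega>))) \<longlonglongrightarrow> 0"
    unfolding 2 by (rule lim) (auto intro!: \<Phi> \<Psi>)
  moreover have "AE \<omega> in M. (\<lambda>n. step_noise W (?X n) \<omega>) \<longlonglongrightarrow> X \<omega> + c * Y \<omega>"
    using \<Phi>(4) \<Psi>(4)
  proof eventually_elim
    case (elim \<omega>)
    then have "(\<lambda>n. step_noise W (\<Phi> n) \<omega> + c * step_noise W (\<Psi> n) \<omega>) \<longlonglongrightarrow> X \<omega> + c * Y \<omega>"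
      by (intro tendsto_intros)
    then show ?case by (simp add: step_noise_scale)
  qed
  moreover have "is_step T (?X n)" for n
    using \<Phi>(1) \<Psi>(1) by (simp add: is_step_scale)
  ultimately show ?thesis
    unfolding wiener_integral_def by (intro conjI exI[of _ ?X]) auto
qed

text \<open>Passing to the limit costs two relaxed triangle inequalities, hence the 4. The exact
  isometry would give 1, but only the order of magnitude enters the estimates.\<close>

lemma msq_wiener_integral_le:
  assumes \<phi>: "\<phi> \<in> borel_measurable borel" "msq cyl \<phi> < \<infinity>" and X: "wiener_integral \<phi> X"
  shows "msq M X \<le> 4 * msq cyl (KH \<phi>)"
proof -
  let ?C = "cyl" and ?K = "KH"
  from X obtain \<Phi> where [measurable]: "X \<in> borel_measurable M" and s: "\<And>n. is_step T (\<Phi> n)"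
    and 1: "(\<lambda>n. msq ?C (\<lambda>z. step_fun (\<Phi> n) z - \<phi> z)) \<longlonglongrightarrow> 0"
    and 2: "(\<lambda>n. msq M (\<lambda>\<omega>. step_noise W (\<Phi> n) \<omega> - X \<omega>)) \<longlonglongrightarrow> 0"
    unfolding wiener_integral_def by auto
  note [measurable] = step_noise_measurable[OF s]
  have 3: "(\<lambda>n. msq ?C (\<lambda>z. ?K (step_fun (\<Phi> n)) z - ?K \<phi> z)) \<longlonglongrightarrow> 0"
    using \<phi> s 1 by (rule KH_star_tendsto)
  have le: "msq M X \<le> 2 * (msq M (\<lambda>\<omega>. X \<omega> - step_noise W (\<Phi> n) \<omega>) + 2 * (msq ?C (\<lambda>z. ?K (step_fun (\<Phi> n)) z - ?K \<phi> z) + msq ?C (?K \<phi>)))" for n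
  proof -
    have "msq M X \<le> 2 * (msq M (\<lambda>\<omega>. X \<omega> - step_noise W (\<Phi> n) \<omega>) + msq M (step_noise W (\<Phi> n)))"
      by (rule msq_le_diff) measurable
    also have "msq M (step_noise W (\<Phi> n)) = msq ?C (?K (step_fun (\<Phi> n)))"
      using msq_eq_integral[OF step_noise_measurable[OF s] msq_step_noise_finite[OF s]]
        integral_step_noise[OF s s] step_isometry(1)[OF s] by metis
    also have "2 * (msq M (\<lambda>\<omega>. X \<omega> - step_noise W (\<Phi> n) \<omega>) + msq ?C (?K (step_fun (\<Phi> n)))) \<le>
      2 * (msq M (\<lambda>\<omega>. X \<omega> - step_noise W (\<Phi> n) \<omega>) + 2 * (msq ?C (\<lambda>z. ?K (step_fun (\<Phi> n)) z - ?K \<phi> z) + msq ?C (?K \<phi>)))"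
      by (intro mult_left_mono add_left_mono zero_le msq_le_diff borel_measurable_cyl KH_star_borel step_fun_borel[OF s] \<phi>)
    finally show ?thesis .
  qed
  have "(\<lambda>n. 2 * (msq M (\<lambda>\<omega>. X \<omega> - step_noise W (\<Phi> n) \<omega>) + 2 * (msq ?C (\<lambda>z. ?K (step_fun (\<Phi> n)) z - ?K \<phi> z) + msq ?C (?K \<phi>))))
     \<longlonglongrightarrow> 2 * (0 + 2 * (0 + msq ?C (?K \<phi>)))"
    using 2 3 by (intro ennreal_tendsto_cmult tendsto_add tendsto_const) (auto simp: msq_minus_commute[of _ X])
  then have "msq M X \<le> 2 * (0 + 2 * (0 + msq ?C (?K \<phi>)))"
    by (rule LIMSEQ_le_const) (use le in blast)
  then show ?thesis by simp
qed

text \<open>Gaussianity of the limit is bypassed. The approximants are Gaussian with variance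
  eventually at most 4B, so their p-th moments are uniformly bounded, and Fatou's lemma along the
  almost sure convergence transfers the bound.\<close>

lemma wiener_integral_moment:
  assumes X: "wiener_integral \<phi> X" and le: "msq M X \<le> ennreal B" and B: "0 \<le> B" and p: "0 < p"
  shows "(\<integral>\<^sup>+ \<omega>. ennreal (\<bar>X \<omega>\<bar> powr p) \<partial>M) \<le> ennreal ((4 * B) powr (p / 2)) * normal_moment p"
proof (cases "B = 0")
  case True
  have [measurable]: "X \<in> borel_measurable M" using X by (simp add: wiener_integral_def)
  have "AE \<omega> in M. X \<omega> = 0"
    using msq_eq_0_AE[of X M "\<lambda>_. 0"] le True by simp
  then have "(\<integral>\<^sup>+ \<omega>. ennreal (\<bar>X \<omega>\<bar> powr p) \<partial>M) = (\<integral>\<^sup>+ \<omega>. 0 \<partial>M)"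
    by (intro nn_integral_cong_AE, elim eventually_mono) simp
  then show ?thesis by simp
next
  case False
  with B have B: "B > 0" by simp
  from X obtain \<Phi> where [measurable]: "X \<in> borel_measurable M" and s: "\<And>n. is_step T (\<Phi> n)"
    and 2: "(\<lambda>n. msq M (\<lambda>\<omega>. step_noise W (\<Phi> n) \<omega> - X \<omega>)) \<longlonglongrightarrow> 0"
    and 3: "AE \<omega> in M. (\<lambda>n. step_noise W (\<Phi> n) \<omega>) \<longlonglongrightarrow> X \<omega>"
    unfolding wiener_integral_def by auto
  note [measurable] = step_noise_measurable[OF s]
  \<comment> \<open>Here B > 0 matters: the error has to drop strictly below B, after which the
    variance is at most 2 (B + B).\<close>
  have "\<forall>\<^sub>F n in sequentially. msq M (\<lambda>\<omega>. step_noise W (\<Phi> n) \<omega> - X \<omega>) < ennreal B"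
    using B by (intro order_tendstoD(2)[OF 2]) auto
  then have ev: "\<forall>\<^sub>F n in sequentially. (\<integral>\<^sup>+ \<omega>. ennreal (\<bar>step_noise W (\<Phi> n) \<omega>\<bar> powr p) \<partial>M) \<le> ennreal ((4 * B) powr (p / 2)) * normal_moment p"
  proof eventually_elim
    case (elim n)
    obtain \<sigma> where \<sigma>: "0 \<le> \<sigma>" "msq M (step_noise W (\<Phi> n)) = ennreal (\<sigma>\<^sup>2)"
      "\<And>p. 0 < p \<Longrightarrow> (\<integral>\<^sup>+ \<omega>. ennreal (\<bar>step_noise W (\<Phi> n) \<omega>\<bar> powr p) \<partial>M) = ennreal (\<sigma> powr p) * normal_moment p"
      using centered_gaussian_moments[OF gaussian[OF s[of n]]] by blast
    have "ennreal (\<sigma>\<^sup>2) \<le> 2 * (msq M (\<lambda>\<omega>. step_noise W (\<Phi> n) \<omega> - X \<omega>) + msq M X)"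
      unfolding \<sigma>(2)[symmetric] by (rule msq_le_diff) measurable
    also have "\<dots> \<le> 2 * (ennreal B + ennreal B)"
      using elim le by (intro mult_left_mono add_mono) auto
    also have "\<dots> = 4 * ennreal B"
      by (simp add: mult_2[symmetric])
    also have "\<dots> = ennreal (4 * B)"
      using ennreal_mult'[of 4 B] by simp
    finally have "\<sigma>\<^sup>2 \<le> 4 * B" using B by (simp add: ennreal_le_iff)
    then have "(\<sigma>\<^sup>2) powr (p / 2) \<le> (4 * B) powr (p / 2)"
      using p by (intro powr_mono2) auto
    also have "(\<sigma>\<^sup>2) powr (p / 2) = \<sigma> powr p"
      using \<sigma>(1) by (simp add: powr_numeral[symmetric] powr_powr del: powr_numeral)
    finally show ?case
      unfolding \<sigma>(3)[OF p] by (intro mult_right_mono ennreal_leI) auto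
  qed
  have "(\<integral>\<^sup>+ \<omega>. ennreal (\<bar>X \<omega>\<bar> powr p) \<partial>M) = (\<integral>\<^sup>+ \<omega>. liminf (\<lambda>n. ennreal (\<bar>step_noise W (\<Phi> n) \<omega>\<bar> powr p)) \<partial>M)"
  proof (rule nn_integral_cong_AE)
    show "AE \<omega> in M. ennreal (\<bar>X \<omega>\<bar> powr p) = liminf (\<lambda>n. ennreal (\<bar>step_noise W (\<Phi> n) \<omega>\<bar> powr p))"
      using 3
    proof eventually_elim
      case (elim \<omega>)
      show ?case
        by (intro lim_imp_Liminf[symmetric] tendsto_ennrealI tendsto_powr' tendsto_rabs elim tendsto_const)
           (use p in auto)
    qed
  qed
  also have "\<dots> \<le> liminf (\<lambda>n. \<integral>\<^sup>+ \<omega>. ennreal (\<bar>step_noise W (\<Phi> n) \<omega>\<bar> powr p) \<partial>M)"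
    by (rule nn_integral_liminf) measurable
  also have "\<dots> \<le> liminf (\<lambda>n. ennreal ((4 * B) powr (p / 2)) * normal_moment p)"
    by (rule Liminf_mono[OF ev])
  finally show ?thesis by (simp add: Liminf_const)
qed

end

section \<open>Green's function\<close>

lemma powr_sum_le_weighted:
  fixes a w :: "'i \<Rightarrow> real"
  assumes "finite I" "1 \<le> p" and a: "\<And>k. k \<in> I \<Longrightarrow> 0 \<le> a k" and w: "\<And>k. k \<in> I \<Longrightarrow> 0 < w k"
    and V: "(\<Sum>k\<in>I. w k) \<le> V"
  shows "(\<Sum>k\<in>I. a k) powr p \<le> V powr (p - 1) * (\<Sum>k\<in>I. w k * (a k / w k) powr p)"
proof -
  \<comment> \<open>Discarding the zero terms leaves the left side unchanged and keeps all ratios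
    \<open>a k / w k\<close> positive, where convexity of the power is applied. The remaining
    weights are normalised by their own sum \<open>V'\<close>, which is replaced by V only at the
    end, using p \<ge> 1.\<close>
  let ?J = "{k \<in> I. a k > 0}"
  have nn: "0 \<le> w k * (a k / w k) powr p" if "k \<in> I" for k
    using w[OF that] by simp
  have sum_eq: "(\<Sum>k\<in>I. a k) = (\<Sum>k\<in>?J. a k)"
    using a assms(1) by (intro sum.mono_neutral_right) force+
  show ?thesis
  proof (cases "?J = {}")
    case True
    have "0 \<le> (\<Sum>k\<in>I. w k * (a k / w k) powr p)"
      by (intro sum_nonneg nn)
    then show ?thesis unfolding sum_eq True by simp
  next
    case False
    define V' where "V' = (\<Sum>k\<in>?J. w k)"
    have V': "0 < V'" unfolding V'_def using False assms(1) w by (intro sum_pos) auto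
    have "V' \<le> (\<Sum>k\<in>I. w k)"
      unfolding V'_def using assms(1) w by (intro sum_mono2) (auto intro: less_imp_le)
    with V have "V' \<le> V" by simp
    have "(\<Sum>k\<in>?J. (w k / V') *\<^sub>R (a k / w k)) powr p \<le> (\<Sum>k\<in>?J. (w k / V') * (a k / w k) powr p)"
    proof (rule convex_on_sum[OF _ _ powr_convex[OF assms(2)]])
      show "(\<Sum>k\<in>?J. w k / V') = 1"
        using V' unfolding sum_divide_distrib[symmetric] V'_def by simp
    qed (use False assms(1) w V' in \<open>auto intro!: divide_pos_pos divide_nonneg_pos less_imp_le\<close>)
    moreover have "(\<Sum>k\<in>?J. (w k / V') *\<^sub>R (a k / w k)) = (\<Sum>k\<in>?J. a k) / V'"
      unfolding sum_divide_distrib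
    proof (rule sum.cong[OF refl])
      fix k assume "k \<in> ?J"
      with w[of k] show "(w k / V') *\<^sub>R (a k / w k) = a k / V'" by simp
    qed
    ultimately have "((\<Sum>k\<in>?J. a k) / V') powr p \<le> (\<Sum>k\<in>?J. w k * (a k / w k) powr p) / V'"
      by (simp add: sum_divide_distrib)
    then have "V' powr p * ((\<Sum>k\<in>?J. a k) / V') powr p \<le> V' powr p * ((\<Sum>k\<in>?J. w k * (a k / w k) powr p) / V')"
      by (rule mult_left_mono) simp
    moreover have "V' powr p * ((\<Sum>k\<in>?J. a k) / V') powr p = (\<Sum>k\<in>?J. a k) powr p"
      using V' by (simp add: powr_divide)
    moreover have "V' powr p * (x / V') = V' powr (p - 1) * x" for x
      using V' by (simp add: powr_diff)
    ultimately have "(\<Sum>k\<in>?J. a k) powr p \<le> V' powr (p - 1) * (\<Sum>k\<in>?J. w k * (a k / w k) powr p)"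
      by simp
    also have "\<dots> \<le> V powr (p - 1) * (\<Sum>k\<in>I. w k * (a k / w k) powr p)"
    proof (rule mult_mono)
      show "V' powr (p - 1) \<le> V powr (p - 1)"
        using V' \<open>V' \<le> V\<close> assms(2) by (intro powr_mono2) auto
      show "(\<Sum>k\<in>?J. w k * (a k / w k) powr p) \<le> (\<Sum>k\<in>I. w k * (a k / w k) powr p)"
        using assms(1) nn by (intro sum_mono2) auto
    qed (auto intro!: sum_nonneg nn)
    finally show ?thesis unfolding sum_eq .
  qed
qed

text \<open>The finite inequality is used with the total weight as V, a bound independent of n, so
  that the partial sums pass to the limit.\<close>

lemma suminf_powr_le_weighted:
  fixes a w :: "nat \<Rightarrow> real"
  assumes p: "1 \<le> p" and a: "\<And>k. 0 \<le> a k" "summable a" and w: "\<And>k. 0 < w k" "summable w"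
  shows "ennreal ((\<Sum>k. a k) powr p) \<le> ennreal ((\<Sum>k. w k) powr (p - 1)) * (\<Sum>k. ennreal (w k * (a k / w k) powr p))"
proof (rule LIMSEQ_le_const2)
  show "(\<lambda>n. ennreal ((\<Sum>k<n. a k) powr p)) \<longlonglongrightarrow> ennreal ((\<Sum>k. a k) powr p)"
    using p a by (intro tendsto_ennrealI tendsto_powr' summable_LIMSEQ tendsto_const)
       (auto intro!: always_eventually sum_nonneg)
  show "\<exists>N. \<forall>n\<ge>N. ennreal ((\<Sum>k<n. a k) powr p) \<le> ennreal ((\<Sum>k. w k) powr (p - 1)) * (\<Sum>k. ennreal (w k * (a k / w k) powr p))"
  proof (intro exI allI impI)
    fix n
    have nn: "0 \<le> w k * (a k / w k) powr p" for k
      using w(1)[of k] by simp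
    have "(\<Sum>k<n. a k) powr p \<le> (\<Sum>k. w k) powr (p - 1) * (\<Sum>k<n. w k * (a k / w k) powr p)"
      using p a w by (intro powr_sum_le_weighted sum_le_suminf) (auto intro: less_imp_le)
    then have "ennreal ((\<Sum>k<n. a k) powr p) \<le> ennreal ((\<Sum>k. w k) powr (p - 1)) * ennreal (\<Sum>k<n. w k * (a k / w k) powr p)"
      by (subst ennreal_mult[symmetric]) (auto intro!: ennreal_leI sum_nonneg nn)
    also have "ennreal (\<Sum>k<n. w k * (a k / w k) powr p) = (\<Sum>k<n. ennreal (w k * (a k / w k) powr p))"
      by (rule sum_ennreal[symmetric]) (rule nn)
    also have "ennreal ((\<Sum>k. w k) powr (p - 1)) * (\<Sum>k<n. ennreal (w k * (a k / w k) powr p)) \<le>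
        ennreal ((\<Sum>k. w k) powr (p - 1)) * (\<Sum>k. ennreal (w k * (a k / w k) powr p))"
      by (intro mult_left_mono sum_le_suminf) auto
    finally show "ennreal ((\<Sum>k<n. a k) powr p) \<le> ennreal ((\<Sum>k. w k) powr (p - 1)) * (\<Sum>k. ennreal (w k * (a k / w k) powr p))" .
  qed
qed

lemma le_powr_interpolate:
  fixes m a b \<theta> :: real
  assumes "0 \<le> m" "m \<le> a" "m \<le> b" "0 \<le> \<theta>" "\<theta> \<le> 1"
  shows "m \<le> a powr \<theta> * b powr (1 - \<theta>)"
proof (cases "m = 0")
  case False
  have "m = m powr (\<theta> + (1 - \<theta>))" using assms by simp
  also have "\<dots> = m powr \<theta> * m powr (1 - \<theta>)" by (rule powr_add)
  also have "\<dots> \<le> a powr \<theta> * b powr (1 - \<theta>)"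
    using assms by (intro mult_mono powr_mono2) auto
  finally show ?thesis .
qed auto

section \<open>Uniform bounds for the Green series\<close>

lemma abs_eigenfun_le: "\<bar>eigenfun k x\<bar> \<le> 1"
proof (cases "k = 0")
  case True
  have "1 \<le> sqrt pi" using pi_ge_two by simp
  then show ?thesis using True by (simp add: eigenfun_def)
next
  case False
  have "sqrt (2 / pi) \<le> 1" using pi_ge_two by simp
  then have "\<bar>sqrt (2 / pi)\<bar> * \<bar>cos (real k * x)\<bar> \<le> 1 * 1"
    by (intro mult_mono) (auto simp: abs_le_iff)
  then show ?thesis using False by (simp add: eigenfun_def abs_mult)
qed

lemma eigenfun_measurable[measurable]: "f \<in> borel_measurable M \<Longrightarrow> (\<lambda>x. eigenfun k (f x)) \<in> borel_measurable M"
  by (cases "k = 0") (simp_all add: eigenfun_def)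

text \<open>Comparison of a sum with an integral. After scaling to b = k u^(1/4) the quartic
  exponential is dominated by 2 / (1 + b^2), whose primitive is 2 \<open>arctan\<close>. Its
  boundedness will give a constant free of n, and the spacing u^(1/4) of the points gives the
  rate.\<close>

lemma sum_exp_quartic_le:
  assumes u: "u > 0"
  shows "(\<Sum>k\<le>n. exp (- (real k ^ 4) * u)) \<le> 1 + 2 * arctan (real n * u powr (1 / 4)) / u powr (1 / 4)"
proof (induction n)
  case 0
  then show ?case by simp
next
  case (Suc n)
  define a where "a = u powr (1 / 4)"
  have a: "a > 0" "a ^ 4 = u"
    using u by (auto simp: a_def powr_powr powr_realpow[symmetric] simp flip: powr_numeral)
  define b where "b = real (Suc n) * a"
  have "exp (- (real (Suc n) ^ 4) * u) = inverse (exp (b ^ 4))"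
    by (simp add: b_def power_mult_distrib a exp_minus)
  also have "\<dots> \<le> inverse ((1 + b\<^sup>2) / 2)"
  proof (rule le_imp_inverse_le)
    \<comment> \<open>The square trades the quartic for a quadratic whose reciprocal has an
      elementary primitive.\<close>
    have "0 \<le> (b\<^sup>2 - 1)\<^sup>2" by simp
    then have "2 * b\<^sup>2 \<le> b ^ 4 + 1" by (simp add: power2_eq_square power4_eq_xxxx algebra_simps)
    moreover have "0 \<le> b ^ 4" by simp
    moreover have "(1 + X) / 2 \<le> 1 + Y" if "2 * X \<le> Y + 1" "0 \<le> Y" for X Y :: real
      using that by simp
    ultimately have "(1 + b\<^sup>2) / 2 \<le> 1 + b ^ 4" by blast
    also have "\<dots> \<le> exp (b ^ 4)" by (rule exp_ge_add_one_self)
    finally show "(1 + b\<^sup>2) / 2 \<le> exp (b ^ 4)" .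
    show "0 < (1 + b\<^sup>2) / 2" by (simp add: add_pos_nonneg)
  qed
  also have "\<dots> = 2 * inverse (1 + b\<^sup>2)"
    by (simp only: inverse_divide) (rule divide_inverse)
  also have "\<dots> \<le> 2 * ((arctan b - arctan (real n * a)) / a)"
  proof -
    \<comment> \<open>On the last subinterval 1 / (1 + z^2) is smallest at the right endpoint b, so
      the new term is at most the increment of the primitive.\<close>
    have lt: "real n * a < b" using a by (simp add: b_def)
    obtain z where z: "real n * a < z" "z < b" "arctan b - arctan (real n * a) = (b - real n * a) * inverse (1 + z\<^sup>2)"
      using MVT2[OF lt, of arctan "\<lambda>x. inverse (1 + x\<^sup>2)"] DERIV_arctan by blast
    have "0 \<le> z" using z(1) a by (meson less_imp_le mult_nonneg_nonneg of_nat_0_le_iff order_trans)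
    then have "z\<^sup>2 \<le> b\<^sup>2" using z(2) by (intro power_mono) auto
    then have "inverse (1 + b\<^sup>2) \<le> inverse (1 + z\<^sup>2)"
      by (intro le_imp_inverse_le) (auto intro: add_pos_nonneg)
    also have "\<dots> = (arctan b - arctan (real n * a)) / a"
      unfolding z(3) using a by (simp add: b_def algebra_simps)
    finally show ?thesis by (rule mult_left_mono) simp
  qed
  finally have "exp (- (real (Suc n) ^ 4) * u) \<le> 2 * ((arctan b - arctan (real n * a)) / a)" .
  with Suc.IH show ?case
    unfolding sum.atMost_Suc a_def[symmetric] b_def[symmetric] by (simp add: diff_divide_distrib algebra_simps)
qed

lemma exp_quartic_sum:
  assumes u: "u > 0"
  shows "summable (\<lambda>k. exp (- (real k ^ 4) * u))" "(\<Sum>k. exp (- (real k ^ 4) * u)) \<le> 1 + pi * u powr (- 1 / 4)"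
proof -
  have le: "(\<Sum>k<n. exp (- (real k ^ 4) * u)) \<le> 1 + pi * u powr (- 1 / 4)" for n
  proof -
    have "(\<Sum>k<n. exp (- (real k ^ 4) * u)) \<le> (\<Sum>k\<le>n. exp (- (real k ^ 4) * u))"
      by (intro sum_mono2) auto
    also have "\<dots> \<le> 1 + 2 * arctan (real n * u powr (1 / 4)) / u powr (1 / 4)"
      by (rule sum_exp_quartic_le[OF u])
    also have "\<dots> \<le> 1 + pi / u powr (1 / 4)"
      using arctan_ubound[of "real n * u powr (1 / 4)"] by (intro add_left_mono divide_right_mono) auto
    also have "\<dots> = 1 + pi * u powr (- 1 / 4)"
      using powr_minus_divide[of u "1 / 4"] by simp
    finally show ?thesis .
  qed
  show s: "summable (\<lambda>k. exp (- (real k ^ 4) * u))"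
    by (rule bounded_imp_summable[of _ "1 + pi * u powr (- 1 / 4)"])
       (simp, unfold lessThan_Suc_atMost[symmetric], rule le)
  show "(\<Sum>k. exp (- (real k ^ 4) * u)) \<le> 1 + pi * u powr (- 1 / 4)"
    using s le by (rule suminf_le_const)
qed

lemma green_term_le: "\<bar>exp (- (real k ^ 4) * u) * eigenfun k x * eigenfun k y\<bar> \<le> exp (- (real k ^ 4) * u)"
proof -
  have "\<bar>eigenfun k x\<bar> * \<bar>eigenfun k y\<bar> \<le> 1 * 1"
    using abs_eigenfun_le by (intro mult_mono) auto
  then show ?thesis
    by (simp add: abs_mult mult.assoc mult_left_le)
qed

lemma green_term_summable:
  "u > 0 \<Longrightarrow> summable (\<lambda>k. exp (- (real k ^ 4) * u) * eigenfun k x * eigenfun k y)"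
  by (rule summable_comparison_test'[OF exp_quartic_sum(1)]) (use green_term_le in auto)

lemma sum_green_term_le:
  assumes "u > 0"
  shows "\<bar>\<Sum>k<n. exp (- (real k ^ 4) * u) * eigenfun k x * eigenfun k y\<bar> \<le> 1 + pi * u powr (- 1 / 4)"
proof -
  have "\<bar>\<Sum>k<n. exp (- (real k ^ 4) * u) * eigenfun k x * eigenfun k y\<bar> \<le> (\<Sum>k<n. exp (- (real k ^ 4) * u))"
    by (rule order_trans[OF sum_abs sum_mono]) (rule green_term_le)
  also have "\<dots> \<le> (\<Sum>k. exp (- (real k ^ 4) * u))"
    by (rule sum_le_suminf[OF exp_quartic_sum(1)[OF assms]]) auto
  finally show ?thesis using exp_quartic_sum(2)[OF assms] by linarith
qed

lemma green_le:
  assumes "u > 0"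
  shows "\<bar>green x y u\<bar> \<le> 1 + pi * u powr (- 1 / 4)"
proof (rule LIMSEQ_le_const2)
  show "(\<lambda>n. \<bar>\<Sum>k<n. exp (- (real k ^ 4) * u) * eigenfun k x * eigenfun k y\<bar>) \<longlonglongrightarrow> \<bar>green x y u\<bar>"
    using tendsto_rabs[OF summable_LIMSEQ[OF green_term_summable[OF assms]]] assms by (simp add: green_def)
qed (use sum_green_term_le[OF assms] in blast)

lemma green_measurable[measurable]:
  assumes [measurable]: "f \<in> borel_measurable M" "g \<in> borel_measurable M" "h \<in> borel_measurable M"
  shows "(\<lambda>x. green (f x) (g x) (h x)) \<in> borel_measurable M"
  unfolding green_def by measurable

section \<open>The Green kernel, its modes and a common majorant\<close>

lemma green_kernel_measurable:
  assumes [measurable]: "f \<in> borel_measurable M" "g \<in> borel_measurable M" "h \<in> borel_measurable M"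
  shows "(\<lambda>x. green_kernel \<zeta> t (f x) (g x, h x)) \<in> borel_measurable M"
  unfolding green_kernel_def prod.case by measurable

lemma green_kernel_borel: "green_kernel \<zeta> t x \<in> borel_measurable borel"
proof -
  have "(\<lambda>z. green_kernel \<zeta> t x (fst z, snd z)) \<in> borel_measurable (borel \<Otimes>\<^sub>M borel)"
    by (rule green_kernel_measurable) measurable
  then show ?thesis by (simp add: borel_prod)
qed

text \<open>The k-th mode without its factor in x. The interval is half open, unlike in
  \<open>green_kernel\<close>: at s = t every exponential is 1 and the partial sums need not tend to
  the value 0 that \<open>green\<close> has there by convention.\<close>

definition mode_kernel :: "real \<Rightarrow> real \<Rightarrow> nat \<Rightarrow> real \<times> real \<Rightarrow> real" where
  "mode_kernel \<zeta> t k = (\<lambda>(y, s). eigenfun k y * exp (- (real k ^ 4) * (t - s)) * indicator {\<zeta>..<t} s)"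

lemma mode_kernel_borel: "mode_kernel \<zeta> t k \<in> borel_measurable borel"
proof -
  have "(\<lambda>z. mode_kernel \<zeta> t k (fst z, snd z)) \<in> borel_measurable (borel \<Otimes>\<^sub>M borel)"
    unfolding mode_kernel_def prod.case by measurable
  then show ?thesis by (simp add: borel_prod)
qed

lemma sum_mode_kernel:
  "(\<Sum>k<n. eigenfun k x * mode_kernel \<zeta> t k (y, s)) =
    (\<Sum>k<n. exp (- (real k ^ 4) * (t - s)) * eigenfun k x * eigenfun k y) * indicator {\<zeta>..<t} s"
  unfolding mode_kernel_def by (cases "s \<in> {\<zeta>..<t}") (simp_all add: mult_ac)

lemma sum_mode_kernel_tendsto:
  "(\<lambda>n. \<Sum>k<n. eigenfun k x * mode_kernel \<zeta> t k z) \<longlonglongrightarrow> green_kernel \<zeta> t x z"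
proof -
  obtain y s where z: "z = (y, s)" by (cases z)
  show ?thesis
  proof (cases "s \<in> {\<zeta>..<t}")
    case True
    then have "t - s > 0" by simp
    from summable_LIMSEQ[OF green_term_summable[OF this]] True show ?thesis
      unfolding z sum_mode_kernel by (simp add: green_kernel_def green_def)
  next
    case False
    then have "green_kernel \<zeta> t x z = 0"
      by (auto simp: z green_kernel_def green_def indicator_def)
    then show ?thesis using False unfolding z sum_mode_kernel by simp
  qed
qed

text \<open>One majorant for the kernel and for all partial sums of its modes, free of x and y. The
  summand T^(1/4) absorbs the 1 in 1 + pi u^(-1/4), as u \<le> T.\<close>

definition green_bound :: "real \<Rightarrow> real \<Rightarrow> real \<Rightarrow> real \<times> real \<Rightarrow> real" where
  "green_bound T \<zeta> t = (\<lambda>(y, s). (T powr (1 / 4) + pi) * \<bar>s - t\<bar> powr (- 1 / 4) * indicator {\<zeta>..t} s)"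

lemma green_bound_borel: "green_bound T \<zeta> t \<in> borel_measurable borel"
proof -
  have "(\<lambda>z. green_bound T \<zeta> t (fst z, snd z)) \<in> borel_measurable (borel \<Otimes>\<^sub>M borel)"
    unfolding green_bound_def prod.case by measurable
  then show ?thesis by (simp add: borel_prod)
qed

lemma one_add_pi_powr_le:
  assumes "0 < u" "u \<le> T"
  shows "1 + pi * u powr (- 1 / 4) \<le> (T powr (1 / 4) + pi) * u powr (- 1 / 4)"
proof -
  have "1 = u powr (1 / 4) * u powr (- 1 / 4)"
    using assms by (simp add: powr_add[symmetric])
  also have "\<dots> \<le> T powr (1 / 4) * u powr (- 1 / 4)"
    using assms by (intro mult_right_mono powr_mono2) auto
  finally show ?thesis by (simp add: algebra_simps)
qed

lemma green_kernel_le_bound: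
  assumes "0 \<le> \<zeta>" "t \<le> T"
  shows "\<bar>green_kernel \<zeta> t x z\<bar> \<le> green_bound T \<zeta> t z"
proof -
  obtain y s where z: "z = (y, s)" by (cases z)
  show ?thesis
  proof (cases "s \<in> {\<zeta>..<t}")
    case True
    then have "\<bar>green x y (t - s)\<bar> \<le> (T powr (1 / 4) + pi) * (t - s) powr (- 1 / 4)"
      using assms by (intro order_trans[OF green_le one_add_pi_powr_le]) auto
    with True show ?thesis by (simp add: z green_kernel_def green_bound_def abs_minus_commute)
  next
    case False
    then have "green_kernel \<zeta> t x z = 0"
      by (auto simp: z green_kernel_def green_def indicator_def)
    then show ?thesis by (simp add: z green_bound_def)
  qed
qed

lemma sum_mode_kernel_le_bound:
  assumes "0 \<le> \<zeta>" "t \<le> T"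
  shows "\<bar>\<Sum>k<n. eigenfun k x * mode_kernel \<zeta> t k z\<bar> \<le> green_bound T \<zeta> t z"
proof -
  obtain y s where z: "z = (y, s)" by (cases z)
  show ?thesis
  proof (cases "s \<in> {\<zeta>..<t}")
    case True
    then have "\<bar>\<Sum>k<n. exp (- (real k ^ 4) * (t - s)) * eigenfun k x * eigenfun k y\<bar> \<le> (T powr (1 / 4) + pi) * (t - s) powr (- 1 / 4)"
      using assms by (intro order_trans[OF sum_green_term_le one_add_pi_powr_le]) auto
    with True show ?thesis unfolding z sum_mode_kernel by (simp add: green_bound_def abs_minus_commute)
  next
    case False
    then show ?thesis unfolding z sum_mode_kernel by (simp add: green_bound_def)
  qed
qed

lemma msq_cyl_time_le:
  assumes g[measurable]: "g \<in> borel_measurable borel" and f: "f \<in> borel_measurable borel"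
    and le: "\<And>y s. y \<in> space_dom \<Longrightarrow> s \<in> {0..T} \<Longrightarrow> \<bar>f (y, s)\<bar> \<le> g s"
  shows "msq (cyl_measure T) f \<le> ennreal pi * (\<integral>\<^sup>+ s. ennreal ((g s)\<^sup>2) * indicator {0..T} s \<partial>lborel)"
proof -
  have "msq (cyl_measure T) f = (\<integral>\<^sup>+ y. (\<integral>\<^sup>+ s. ennreal ((f (y, s))\<^sup>2) * indicator {0..T} s \<partial>lborel) * indicator space_dom y \<partial>lborel)"
    unfolding msq_def by (rule nn_integral_cyl_measure) (use f in measurable)
  also have "\<dots> \<le> (\<integral>\<^sup>+ y. (\<integral>\<^sup>+ s. ennreal ((g s)\<^sup>2) * indicator {0..T} s \<partial>lborel) * indicator space_dom y \<partial>lborel)"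
  proof (rule nn_integral_mono)
    fix y
    show "(\<integral>\<^sup>+ s. ennreal ((f (y, s))\<^sup>2) * indicator {0..T} s \<partial>lborel) * indicator space_dom y \<le>
      (\<integral>\<^sup>+ s. ennreal ((g s)\<^sup>2) * indicator {0..T} s \<partial>lborel) * indicator space_dom y"
    proof (cases "y \<in> space_dom")
      case True
      have "(\<integral>\<^sup>+ s. ennreal ((f (y, s))\<^sup>2) * indicator {0..T} s \<partial>lborel) \<le> (\<integral>\<^sup>+ s. ennreal ((g s)\<^sup>2) * indicator {0..T} s \<partial>lborel)"
      proof (rule nn_integral_mono)
        fix s
        have "(f (y, s))\<^sup>2 \<le> (g s)\<^sup>2" if "s \<in> {0..T}"
          using le[OF True that] by (intro abs_le_square_iff[THEN iffD1]) auto
        then show "ennreal ((f (y, s))\<^sup>2) * indicator {0..T} s \<le> ennreal ((g s)\<^sup>2) * indicator {0..T} s"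
          by (auto simp: indicator_def intro!: ennreal_leI)
      qed
      then show ?thesis by (intro mult_right_mono) auto
    qed simp
  qed
  also have "\<dots> = (\<integral>\<^sup>+ s. ennreal ((g s)\<^sup>2) * indicator {0..T} s \<partial>lborel) * emeasure lborel space_dom"
    by (rule nn_integral_cmult_indicator) measurable
  also have "emeasure lborel space_dom = ennreal pi" unfolding space_dom_def by simp
  finally show ?thesis by (simp add: mult.commute)
qed

text \<open>Squaring turns the exponent -1/4 into 1/2 - 1, an integrable singularity at the right
  end t of the interval. The separate factor pi is the length of the space interval.\<close>

lemma msq_green_bound:
  assumes "0 \<le> \<zeta>" "\<zeta> \<le> t" "t \<le> T"
  shows "msq (cyl_measure T) (green_bound T \<zeta> t) \<le> ennreal (2 * pi * (T powr (1 / 4) + pi)\<^sup>2 * (t - \<zeta>) powr (1 / 2))"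
proof -
  let ?A = "T powr (1 / 4) + pi"
  let ?g = "\<lambda>s. ?A * \<bar>s - t\<bar> powr (- 1 / 4) * indicator {\<zeta>..t} s"
  have A: "?A \<ge> 0" by (intro add_nonneg_nonneg) auto
  have "msq (cyl_measure T) (green_bound T \<zeta> t) \<le> ennreal pi * (\<integral>\<^sup>+ s. ennreal ((?g s)\<^sup>2) * indicator {0..T} s \<partial>lborel)"
  proof (rule msq_cyl_time_le)
    show "green_bound T \<zeta> t \<in> borel_measurable borel" by (rule green_bound_borel)
  qed (use A in \<open>auto simp: green_bound_def\<close>)
  also have "(\<integral>\<^sup>+ s. ennreal ((?g s)\<^sup>2) * indicator {0..T} s \<partial>lborel) =
    (\<integral>\<^sup>+ s. ennreal (?A\<^sup>2) * (ennreal (\<bar>s - t\<bar> powr (1 / 2 - 1)) * indicator {\<zeta>..t} s) \<partial>lborel)"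
  proof (rule nn_integral_cong)
    fix s :: real
    have "(\<bar>s - t\<bar> powr (- 1 / 4))\<^sup>2 = \<bar>s - t\<bar> powr (1 / 2 - 1)"
      by (simp add: power2_eq_square powr_add[symmetric])
    then show "ennreal ((?g s)\<^sup>2) * indicator {0..T} s = ennreal (?A\<^sup>2) * (ennreal (\<bar>s - t\<bar> powr (1 / 2 - 1)) * indicator {\<zeta>..t} s)"
      using assms by (auto simp: indicator_def power_mult_distrib ennreal_mult)
  qed
  also have "\<dots> = ennreal (?A\<^sup>2) * (\<integral>\<^sup>+ s. ennreal (\<bar>s - t\<bar> powr (1 / 2 - 1)) * indicator {\<zeta>..t} s \<partial>lborel)"
    by (rule nn_integral_cmult) measurable
  also have "(\<integral>\<^sup>+ s. ennreal (\<bar>s - t\<bar> powr (1 / 2 - 1)) * indicator {\<zeta>..t} s \<partial>lborel) = ennreal (2 * (t - \<zeta>) powr (1 / 2))"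
  proof -
    have "(sgn (t - t) * \<bar>t - t\<bar> powr (1 / 2) - sgn (\<zeta> - t) * \<bar>\<zeta> - t\<bar> powr (1 / 2)) / (1 / 2) = 2 * (t - \<zeta>) powr (1 / 2)"
    proof (cases "\<zeta> = t")
      case False
      with assms have "sgn (\<zeta> - t) = - 1" "\<bar>\<zeta> - t\<bar> = t - \<zeta>" by auto
      then show ?thesis by simp
    qed simp
    moreover have "0 < (1 / 2 :: real)" by simp
    note nn_integral_Riesz[OF this assms(2), of t]
    ultimately show ?thesis by (simp only:)
  qed
  also have "ennreal pi * (ennreal (?A\<^sup>2) * ennreal (2 * (t - \<zeta>) powr (1 / 2))) = ennreal (pi * (?A\<^sup>2 * (2 * (t - \<zeta>) powr (1 / 2))))"
    by (simp add: ennreal_mult)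
  also have "pi * (?A\<^sup>2 * (2 * (t - \<zeta>) powr (1 / 2))) = 2 * pi * ?A\<^sup>2 * (t - \<zeta>) powr (1 / 2)"
    by (simp only: mult_ac)
  finally show ?thesis .
qed

text \<open>The squared exponential is at most the exponential itself. Bounding that by 1 gives the
  length of the time interval, integrating it gives k^(-4). Neither bound alone is both small in
  time and decaying in k.\<close>

lemma msq_mode_kernel:
  assumes "0 \<le> \<zeta>" "\<zeta> \<le> t" "t \<le> T"
  shows "msq (cyl_measure T) (mode_kernel \<zeta> t k) \<le> ennreal (pi * (t - \<zeta>))"
    and "k \<noteq> 0 \<Longrightarrow> msq (cyl_measure T) (mode_kernel \<zeta> t k) \<le> ennreal (pi * (1 / real k ^ 4))"
proof -
  let ?K = "real k ^ 4"
  let ?g = "\<lambda>s. exp (- ?K * (t - s)) * indicator {\<zeta>..<t} s"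
  have "msq (cyl_measure T) (mode_kernel \<zeta> t k) \<le> ennreal pi * (\<integral>\<^sup>+ s. ennreal ((?g s)\<^sup>2) * indicator {0..T} s \<partial>lborel)"
  proof (rule msq_cyl_time_le)
    show "mode_kernel \<zeta> t k \<in> borel_measurable borel" by (rule mode_kernel_borel)
    show "\<bar>mode_kernel \<zeta> t k (y, s)\<bar> \<le> ?g s" for y s
      using abs_eigenfun_le[of k y] by (auto simp: mode_kernel_def abs_mult indicator_def mult_left_le_one_le)
  qed measurable
  also have "\<dots> \<le> ennreal pi * (\<integral>\<^sup>+ s. ennreal (exp (- ?K * (t - s))) * indicator {\<zeta>..t} s \<partial>lborel)"
  proof (intro mult_left_mono nn_integral_mono)
    fix s
    have "exp (- ?K * (t - s)) * exp (- ?K * (t - s)) \<le> exp (- ?K * (t - s))" if "s < t"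
      using that by (intro mult_left_le_one_le) auto
    then show "ennreal ((?g s)\<^sup>2) * indicator {0..T} s \<le> ennreal (exp (- ?K * (t - s))) * indicator {\<zeta>..t} s"
      using assms by (auto simp: indicator_def power2_eq_square intro!: ennreal_leI)
  qed simp
  finally have main: "msq (cyl_measure T) (mode_kernel \<zeta> t k) \<le>
      ennreal pi * (\<integral>\<^sup>+ s. ennreal (exp (- ?K * (t - s))) * indicator {\<zeta>..t} s \<partial>lborel)" .
  have "(\<integral>\<^sup>+ s. ennreal (exp (- ?K * (t - s))) * indicator {\<zeta>..t} s \<partial>lborel) \<le> (\<integral>\<^sup>+ s. indicator {\<zeta>..t} s \<partial>lborel)"
    by (intro nn_integral_mono) (auto simp: indicator_def ennreal_le_1)
  also have "\<dots> = ennreal (t - \<zeta>)" using assms by simp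
  finally have "ennreal pi * (\<integral>\<^sup>+ s. ennreal (exp (- ?K * (t - s))) * indicator {\<zeta>..t} s \<partial>lborel) \<le> ennreal pi * ennreal (t - \<zeta>)"
    by (intro mult_left_mono) auto
  with main show "msq (cyl_measure T) (mode_kernel \<zeta> t k) \<le> ennreal (pi * (t - \<zeta>))"
    using assms by (simp add: ennreal_mult)
  assume k: "k \<noteq> 0"
  have "(\<integral>\<^sup>+ s. ennreal (exp (- ?K * (t - s))) * indicator {\<zeta>..t} s \<partial>lborel) =
    ennreal (exp (- ?K * (t - t)) / ?K - exp (- ?K * (t - \<zeta>)) / ?K)"
  proof (rule nn_integral_FTC_Icc)
    show "((\<lambda>s. exp (- ?K * (t - s)) / ?K) has_real_derivative exp (- ?K * (t - s))) (at s)" for s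
    proof -
      have "((\<lambda>s. exp (- ?K * (t - s))) has_real_derivative exp (- ?K * (t - s)) * ?K) (at s)"
        by (auto intro!: derivative_eq_intros)
      from DERIV_cdivide[OF this, of ?K] k show ?thesis by simp
    qed
  qed (use assms in auto)
  also have "\<dots> \<le> ennreal (1 / ?K)" by (intro ennreal_leI) auto
  finally have "ennreal pi * (\<integral>\<^sup>+ s. ennreal (exp (- ?K * (t - s))) * indicator {\<zeta>..t} s \<partial>lborel) \<le> ennreal pi * ennreal (1 / ?K)"
    by (intro mult_left_mono) auto
  with main show "msq (cyl_measure T) (mode_kernel \<zeta> t k) \<le> ennreal (pi * (1 / ?K))"
    by (subst ennreal_mult) auto
qed

lemma measurable_dom: "f \<in> borel_measurable borel \<Longrightarrow> f \<in> borel_measurable dom_measure"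
  unfolding dom_measure_def by (intro measurable_restrict_space1) simp

text \<open>The majorant \<open>green_bound\<close> is free of x, so the essential supremum costs
  nothing beyond the estimate for a single function. The exponents 2H - 1 of Schur's test and 1/2 of
  the majorant add up to (4H - 1)/2.\<close>

lemma (in hurst) linf_KH_star_green:
  assumes z: "0 \<le> \<zeta>" "\<zeta> \<le> t" "t \<le> T"
  shows "(\<integral>\<^sup>+ z. (linf_norm (\<lambda>x. KH_star H T (green_kernel \<zeta> t x) z))\<^sup>2 \<partial>cyl_measure T) \<le>
    ennreal (8 * pi * H * (T powr (1 / 4) + pi)\<^sup>2 * (t - \<zeta>) powr ((4 * H - 1) / 2))"
proof -
  let ?g = "green_bound T \<zeta> t" and ?A = "(T powr (1 / 4) + pi)\<^sup>2"
  let ?k = "\<lambda>z. Kop (\<lambda>r. ennreal \<bar>?g (fst z, r)\<bar>) (snd z)"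
  have norm: "linf_norm (\<lambda>x. KH_star H T (green_kernel \<zeta> t x) z) \<le> ?k z" for z
    unfolding linf_norm_def
  proof (rule esssup_I)
    obtain y s where z': "z = (y, s)" by (cases z)
    \<comment> \<open>Measurability in x is part of the estimate: the essential supremum of a
      nonmeasurable function is \<open>top\<close>.\<close>
    have "(\<lambda>x. KH_star H T (green_kernel \<zeta> t x) (y, s)) \<in> borel_measurable borel"
    proof (rule KH_star_measurable)
      have "(\<lambda>p. green_kernel \<zeta> t (fst p) (fst (snd p), snd (snd p))) \<in> borel_measurable (borel \<Otimes>\<^sub>M (borel \<Otimes>\<^sub>M borel))"
        by (rule green_kernel_measurable) measurable
      then show "(\<lambda>(x, z). green_kernel \<zeta> t x z) \<in> borel_measurable (borel \<Otimes>\<^sub>M borel)"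
        by (simp add: borel_prod case_prod_unfold)
    qed measurable
    then show "(\<lambda>x. ennreal \<bar>KH_star H T (green_kernel \<zeta> t x) z\<bar>) \<in> borel_measurable dom_measure"
      unfolding z' by (intro measurable_dom) measurable
    show "AE x in dom_measure. ennreal \<bar>KH_star H T (green_kernel \<zeta> t x) z\<bar> \<le> ?k z"
    proof (rule AE_I2)
      fix x
      have "ennreal \<bar>KH_star H T (green_kernel \<zeta> t x) z\<bar> \<le> Kop (\<lambda>r. ennreal \<bar>green_kernel \<zeta> t x (y, r)\<bar>) s"
        unfolding z' by (rule KH_star_le_Kop) (rule green_kernel_borel)
      also have "\<dots> \<le> ?k z"
        unfolding Kop_def z' fst_conv snd_conv
        by (intro nn_integral_mono mult_right_mono ennreal_leI
            order_trans[OF green_kernel_le_bound[OF z(1,3)] abs_ge_self] zero_le)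
      finally show "ennreal \<bar>KH_star H T (green_kernel \<zeta> t x) z\<bar> \<le> ?k z" .
    qed
  qed
  have "(\<integral>\<^sup>+ z. (linf_norm (\<lambda>x. KH_star H T (green_kernel \<zeta> t x) z))\<^sup>2 \<partial>cyl_measure T) \<le> (\<integral>\<^sup>+ z. (?k z)\<^sup>2 \<partial>cyl_measure T)"
    by (intro nn_integral_mono power_mono norm) auto
  also have "\<dots> \<le> ennreal (4 * H * (t - \<zeta>) powr (2 * H - 1)) * msq (cyl_measure T) ?g"
    by (rule nn_integral_cyl_Kop_square_le[OF green_bound_borel]) (simp add: green_bound_def)
  also have "\<dots> \<le> ennreal (4 * H * (t - \<zeta>) powr (2 * H - 1)) * ennreal (2 * pi * ?A * (t - \<zeta>) powr (1 / 2))"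
    by (intro mult_left_mono msq_green_bound z) auto
  also have "\<dots> = ennreal (4 * H * (t - \<zeta>) powr (2 * H - 1) * (2 * pi * ?A * (t - \<zeta>) powr (1 / 2)))"
    using H_gt by (intro ennreal_mult'[symmetric]) auto
  also have "4 * H * (t - \<zeta>) powr (2 * H - 1) * (2 * pi * ?A * (t - \<zeta>) powr (1 / 2)) =
      8 * pi * H * ?A * ((t - \<zeta>) powr (2 * H - 1) * (t - \<zeta>) powr (1 / 2))"
    by simp
  also have "(t - \<zeta>) powr (2 * H - 1) * (t - \<zeta>) powr (1 / 2) = (t - \<zeta>) powr ((4 * H - 1) / 2)"
    unfolding powr_add[symmetric] by (simp add: field_simps)
  finally show ?thesis .
qed

section \<open>The stochastic convolution\<close>

lemma finite_measure_dom: "finite_measure dom_measure"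
proof
  show "emeasure dom_measure (space dom_measure) \<noteq> \<infinity>"
    by (simp add: dom_measure_def space_dom_def emeasure_restrict_space space_restrict_space)
qed

lemma ennreal_powr_le:
  assumes "a \<le> ennreal b" "0 \<le> b" "0 \<le> p"
  shows "ennreal_powr a p \<le> ennreal (b powr p)"
proof -
  have "a < top" using assms(1) by (rule order.strict_trans1) simp
  moreover have "enn2real a \<le> b" using assms(1,2) by (rule enn2real_leI[rotated])
  ultimately show ?thesis
    using assms(3) by (auto simp: ennreal_powr_def intro!: ennreal_leI powr_mono2)
qed

context hurst
begin

text \<open>k^(H - 2) bounds the order of the standard deviation of the k-th mode integral and is at
  the same time its weight in Jensen's inequality. With this choice the normalised modes have
  moments bounded uniformly in k, and summability is exactly H < 1.\<close>

definition weight :: "nat \<Rightarrow> real" where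
  "weight k = (if k = 0 then 1 else real k powr (H - 2))"

lemma weight_pos: "0 < weight k"
  by (simp add: weight_def)

lemma weight_summable: "summable weight"
proof -
  have "summable (\<lambda>k. real k powr (H - 2))"
    using H_less by (subst summable_real_powr_iff) simp
  moreover have "eventually (\<lambda>k. weight k = real k powr (H - 2)) sequentially"
    using eventually_gt_at_top[of 0] by eventually_elim (simp add: weight_def)
  ultimately show ?thesis by (subst summable_cong)
qed

text \<open>The 64 collects three factors 4: from Schur's test, from the variance of a Wiener
  integral and from its moments. The maximum serves the modes k > 0 and k = 0 together; pi is the
  length of the space interval.\<close>

definition mode_const :: real where
  "mode_const = 64 * pi * H * max 1 (T powr (1 - H / 2))"

text \<open>Jensen's inequality contributes the power p - 1 of the total weight; summing the uniform
  moment bound against the weights contributes one more.\<close>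

definition moment_const :: "real \<Rightarrow> real" where
  "moment_const p = (\<Sum>k. weight k) powr (p - 1) * (mode_const powr (p / 2) * (\<Sum>k. weight k))"

lemma mode_const_nonneg: "0 \<le> mode_const"
  using H_gt by (simp add: mode_const_def)

text \<open>Interpolation with exponent H/2 on the time bound. For k > 0 the complementary exponent
  turns k^(-4) into k^(2H - 4), the square of the weight. For k = 0 there is no decay, and T takes
  the place of k^(-4).\<close>

lemma msq_mode_kernel_weight:
  assumes z: "0 \<le> \<zeta>" "\<zeta> \<le> t" "t \<le> T"
  shows "msq cyl (mode_kernel \<zeta> t k) \<le>
    ennreal (pi * ((t - \<zeta>) powr (H / 2) * (max 1 (T powr (1 - H / 2)) * (weight k)\<^sup>2)))"
proof -
  let ?\<tau> = "t - \<zeta>" and ?m = "max 1 (T powr (1 - H / 2))"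
  have \<tau>: "0 \<le> ?\<tau>" "?\<tau> \<le> T" using z by auto
  show ?thesis
  proof (cases "k = 0")
    case True
    have "?\<tau> \<le> ?\<tau> powr (H / 2) * T powr (1 - H / 2)"
      using \<tau> H_gt H_less by (intro le_powr_interpolate) auto
    also have "\<dots> \<le> ?\<tau> powr (H / 2) * (?m * (weight k)\<^sup>2)"
      using True by (intro mult_left_mono) (auto simp: weight_def)
    finally have "pi * ?\<tau> \<le> pi * (?\<tau> powr (H / 2) * (?m * (weight k)\<^sup>2))"
      by (intro mult_left_mono) auto
    with msq_mode_kernel(1)[OF z, of k] show ?thesis
      by (meson ennreal_leI order_trans)
  next
    case False
    let ?b = "1 / real k ^ 4"
    have le: "min ?\<tau> ?b \<le> ?\<tau> powr (H / 2) * ?b powr (1 - H / 2)"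
      using \<tau> H_gt H_less by (intro le_powr_interpolate) auto
    have "?b = real k powr (- 4)"
      using False by (simp add: powr_minus powr_numeral divide_inverse)
    then have "?b powr (1 - H / 2) = real k powr ((H - 2) + (H - 2))"
      by (simp add: powr_powr algebra_simps)
    also have "\<dots> = (weight k)\<^sup>2"
      unfolding powr_add using False by (simp add: weight_def power2_eq_square)
    also have "\<dots> \<le> ?m * (weight k)\<^sup>2"
      using mult_right_mono[of 1 ?m "(weight k)\<^sup>2"] by simp
    finally have "?\<tau> powr (H / 2) * ?b powr (1 - H / 2) \<le> ?\<tau> powr (H / 2) * (?m * (weight k)\<^sup>2)"
      by (intro mult_left_mono) auto
    with le have "pi * min ?\<tau> ?b \<le> pi * (?\<tau> powr (H / 2) * (?m * (weight k)\<^sup>2))"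
      by (intro mult_left_mono) auto
    moreover have "msq cyl (mode_kernel \<zeta> t k) \<le> ennreal (pi * min ?\<tau> ?b)"
      using msq_mode_kernel[OF z, of k] False by (cases "?\<tau> \<le> ?b") auto
    ultimately show ?thesis
      by (meson ennreal_leI order_trans)
  qed
qed

lemma msq_KH_star_mode_kernel:
  assumes z: "0 \<le> \<zeta>" "\<zeta> \<le> t" "t \<le> T"
  shows "4 * msq cyl (KH (mode_kernel \<zeta> t k)) \<le>
    ennreal (mode_const / 4 * (t - \<zeta>) powr ((5 * H - 2) / 2) * (weight k)\<^sup>2)"
proof -
  let ?\<tau> = "t - \<zeta>" and ?m = "max 1 (T powr (1 - H / 2))"
  let ?c = "4 * H * ?\<tau> powr (2 * H - 1)" and ?d = "pi * (?\<tau> powr (H / 2) * (?m * (weight k)\<^sup>2))"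
  have "msq cyl (KH (mode_kernel \<zeta> t k)) \<le> ennreal ?c * msq cyl (mode_kernel \<zeta> t k)"
    by (rule msq_KH_star_le[OF mode_kernel_borel]) (auto simp: mode_kernel_def indicator_def)
  also have "\<dots> \<le> ennreal ?c * ennreal ?d"
    by (intro mult_left_mono msq_mode_kernel_weight z) auto
  also have "\<dots> = ennreal (?c * ?d)"
    using H_gt by (intro ennreal_mult'[symmetric]) auto
  finally have "4 * msq cyl (KH (mode_kernel \<zeta> t k)) \<le> 4 * ennreal (?c * ?d)"
    by (rule mult_left_mono) simp
  also have "\<dots> = ennreal (4 * (?c * ?d))"
    using ennreal_mult'[of 4 "?c * ?d"] by simp
  also have "4 * (?c * ?d) = mode_const / 4 * (?\<tau> powr (2 * H - 1) * ?\<tau> powr (H / 2)) * (weight k)\<^sup>2"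
    by (simp add: mode_const_def)
  also have "?\<tau> powr (2 * H - 1) * ?\<tau> powr (H / 2) = ?\<tau> powr ((5 * H - 2) / 2)"
    unfolding powr_add[symmetric] by (rule arg_cong[where f = "(powr) ?\<tau>"]) (simp add: field_simps)
  finally show ?thesis .
qed

end

section \<open>The random series over the modes\<close>

lemma abs_eigenfun_series_le:
  fixes a :: "nat \<Rightarrow> real"
  assumes "summable (\<lambda>k. \<bar>a k\<bar>)"
  shows "summable (\<lambda>k. eigenfun k x * a k)" "\<bar>\<Sum>k. eigenfun k x * a k\<bar> \<le> (\<Sum>k. \<bar>a k\<bar>)"
proof -
  have le: "\<bar>eigenfun k x * a k\<bar> \<le> \<bar>a k\<bar>" for k
    using abs_eigenfun_le[of k x] by (simp add: abs_mult mult_left_le_one_le)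
  have s: "summable (\<lambda>k. \<bar>eigenfun k x * a k\<bar>)"
    by (rule summable_comparison_test'[OF assms]) (use le in auto)
  then show "summable (\<lambda>k. eigenfun k x * a k)" by (rule summable_rabs_cancel)
  have "\<bar>\<Sum>k. eigenfun k x * a k\<bar> \<le> (\<Sum>k. \<bar>eigenfun k x * a k\<bar>)"
    by (rule summable_rabs[OF s])
  also have "\<dots> \<le> (\<Sum>k. \<bar>a k\<bar>)" by (rule suminf_le[OF le s assms])
  finally show "\<bar>\<Sum>k. eigenfun k x * a k\<bar> \<le> (\<Sum>k. \<bar>a k\<bar>)" .
qed

context hurst_noise
begin

text \<open>Versions are chosen for the countably many modes, none of them depending on x. This is
  what makes the series jointly measurable in \<omega> and x.\<close>

definition mode_integrals :: "real \<Rightarrow> real \<Rightarrow> (nat \<Rightarrow> 'w \<Rightarrow> real) \<Rightarrow> bool" where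
  "mode_integrals \<zeta> t \<xi> \<longleftrightarrow> (\<forall>k. wiener_integral (mode_kernel \<zeta> t k) (\<xi> k))"

lemma mode_kernel_finite:
  assumes z: "0 \<le> \<zeta>" "\<zeta> \<le> t" "t \<le> T"
  shows "msq cyl (mode_kernel \<zeta> t k) < \<infinity>"
  using msq_mode_kernel(1)[OF z, of k] by (rule order.strict_trans1) simp

lemma mode_integrals_exist:
  assumes z: "0 \<le> \<zeta>" "\<zeta> \<le> t" "t \<le> T"
  obtains \<xi> where "mode_integrals \<zeta> t \<xi>"
  using wiener_integral_exists[OF mode_kernel_borel mode_kernel_finite[OF z]]
  unfolding mode_integrals_def by metis

lemma mode_integrals_measurable:
  assumes "mode_integrals \<zeta> t \<xi>"
  shows "\<xi> k \<in> borel_measurable M"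
  using assms unfolding mode_integrals_def wiener_integral_def by auto

lemma mode_integrals_moment:
  assumes z: "0 \<le> \<zeta>" "\<zeta> \<le> t" "t \<le> T" and \<xi>: "mode_integrals \<zeta> t \<xi>" and p: "0 < p"
  shows "(\<integral>\<^sup>+ \<omega>. ennreal (\<bar>\<xi> k \<omega>\<bar> powr p) \<partial>M) \<le>
    ennreal (mode_const powr (p / 2) * (t - \<zeta>) powr (p * (5 * H - 2) / 4) * (weight k) powr p) * normal_moment p"
proof -
  let ?\<tau> = "t - \<zeta>"
  let ?B = "mode_const / 4 * ?\<tau> powr ((5 * H - 2) / 2) * (weight k)\<^sup>2"
  have X: "wiener_integral (mode_kernel \<zeta> t k) (\<xi> k)"
    using \<xi> by (simp add: mode_integrals_def)
  have "msq M (\<xi> k) \<le> ennreal ?B"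
    using msq_wiener_integral_le[OF mode_kernel_borel mode_kernel_finite[OF z] X] msq_KH_star_mode_kernel[OF z]
    by (rule order_trans)
  then have "(\<integral>\<^sup>+ \<omega>. ennreal (\<bar>\<xi> k \<omega>\<bar> powr p) \<partial>M) \<le> ennreal ((4 * ?B) powr (p / 2)) * normal_moment p"
    using mode_const_nonneg p by (intro wiener_integral_moment[OF X]) auto
  also have "4 * ?B = mode_const * ?\<tau> powr ((5 * H - 2) / 2) * (weight k) powr 2"
    using weight_pos[of k] by (simp add: powr_numeral)
  also have "\<dots> powr (p / 2) = mode_const powr (p / 2) * ?\<tau> powr ((5 * H - 2) / 2 * (p / 2)) * (weight k) powr (2 * (p / 2))"
    by (simp only: powr_mult powr_powr)
  also have "(5 * H - 2) / 2 * (p / 2) = p * (5 * H - 2) / 4" by simp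
  also have "2 * (p / 2) = p" by simp
  finally show ?thesis .
qed

text \<open>The first absolute moments are dominated by the summable weights, so the sum of the
  moduli has finite expectation.\<close>

lemma AE_mode_integrals_summable:
  assumes z: "0 \<le> \<zeta>" "\<zeta> \<le> t" "t \<le> T" and \<xi>: "mode_integrals \<zeta> t \<xi>"
  shows "AE \<omega> in M. summable (\<lambda>k. \<bar>\<xi> k \<omega>\<bar>)"
proof -
  note [measurable] = mode_integrals_measurable[OF \<xi>]
  let ?c = "mode_const powr (1 / 2) * (t - \<zeta>) powr (1 * (5 * H - 2) / 4)"
  have "(\<integral>\<^sup>+ \<omega>. (\<Sum>k. ennreal \<bar>\<xi> k \<omega>\<bar>) \<partial>M) = (\<Sum>k. \<integral>\<^sup>+ \<omega>. ennreal \<bar>\<xi> k \<omega>\<bar> \<partial>M)"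
    by (rule nn_integral_suminf) measurable
  also have "\<dots> \<le> (\<Sum>k. ennreal (?c * weight k) * normal_moment 1)"
  proof (rule suminf_le)
    fix k
    show "(\<integral>\<^sup>+ \<omega>. ennreal \<bar>\<xi> k \<omega>\<bar> \<partial>M) \<le> ennreal (?c * weight k) * normal_moment 1"
      using mode_integrals_moment[OF z \<xi>, of 1 k] weight_pos[of k] by simp
  qed auto
  also have "\<dots> = (\<Sum>k. ennreal (?c * weight k)) * normal_moment 1"
    by simp
  also have "\<dots> < \<infinity>"
  proof -
    have "(\<Sum>k. ennreal (?c * weight k)) \<noteq> top"
      using less_imp_le[OF weight_pos]
      by (intro ennreal_suminf_neq_top summable_mult weight_summable mult_nonneg_nonneg) auto
    then show ?thesis
      using normal_moment_finite[of 1] by (simp add: ennreal_mult_less_top top.not_eq_extremum)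
  qed
  finally have "AE \<omega> in M. (\<Sum>k. ennreal \<bar>\<xi> k \<omega>\<bar>) \<noteq> \<infinity>"
    by (intro nn_integral_PInf_AE) auto
  then show ?thesis
    by eventually_elim (auto intro: summable_suminf_not_top)
qed

text \<open>Jensen's inequality pulls the p-th power inside the sum, where the moments of the
  individual modes are known; their joint law does not enter.\<close>

lemma mode_integrals_sum_moment:
  assumes z: "0 \<le> \<zeta>" "\<zeta> \<le> t" "t \<le> T" and \<xi>: "mode_integrals \<zeta> t \<xi>" and p: "1 \<le> p"
  shows "(\<integral>\<^sup>+ \<omega>. ennreal ((\<Sum>k. \<bar>\<xi> k \<omega>\<bar>) powr p) \<partial>M) \<le>
    ennreal (moment_const p * (t - \<zeta>) powr (p * (5 * H - 2) / 4)) * normal_moment p"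
proof -
  note [measurable] = mode_integrals_measurable[OF \<xi>]
  let ?V = "\<Sum>k. weight k" and ?w = weight
  let ?Q = "mode_const powr (p / 2) * (t - \<zeta>) powr (p * (5 * H - 2) / 4)"
  have "(\<integral>\<^sup>+ \<omega>. ennreal ((\<Sum>k. \<bar>\<xi> k \<omega>\<bar>) powr p) \<partial>M) \<le>
    (\<integral>\<^sup>+ \<omega>. ennreal (?V powr (p - 1)) * (\<Sum>k. ennreal (?w k * (\<bar>\<xi> k \<omega>\<bar> / ?w k) powr p)) \<partial>M)"
  proof (rule nn_integral_mono_AE)
    show "AE \<omega> in M. ennreal ((\<Sum>k. \<bar>\<xi> k \<omega>\<bar>) powr p) \<le>
       ennreal (?V powr (p - 1)) * (\<Sum>k. ennreal (?w k * (\<bar>\<xi> k \<omega>\<bar> / ?w k) powr p))"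
      using AE_mode_integrals_summable[OF z \<xi>]
      by eventually_elim (rule suminf_powr_le_weighted[OF p _ _ weight_pos weight_summable], auto)
  qed
  also have "\<dots> = ennreal (?V powr (p - 1)) * (\<Sum>k. \<integral>\<^sup>+ \<omega>. ennreal (?w k * (\<bar>\<xi> k \<omega>\<bar> / ?w k) powr p) \<partial>M)"
    by (simp add: nn_integral_cmult nn_integral_suminf)
  also have "\<dots> \<le> ennreal (?V powr (p - 1)) * (\<Sum>k. ennreal (?Q * ?w k) * normal_moment p)"
  proof (intro mult_left_mono suminf_le)
    fix k
    have w: "0 < ?w k" by (rule weight_pos)
    have "(\<integral>\<^sup>+ \<omega>. ennreal (?w k * (\<bar>\<xi> k \<omega>\<bar> / ?w k) powr p) \<partial>M) =
      (\<integral>\<^sup>+ \<omega>. ennreal (?w k / ?w k powr p) * ennreal (\<bar>\<xi> k \<omega>\<bar> powr p) \<partial>M)"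
      using w by (intro nn_integral_cong) (simp add: ennreal_mult[symmetric] powr_divide)
    also have "\<dots> = ennreal (?w k / ?w k powr p) * (\<integral>\<^sup>+ \<omega>. ennreal (\<bar>\<xi> k \<omega>\<bar> powr p) \<partial>M)"
      by (rule nn_integral_cmult) measurable
    also have "\<dots> \<le> ennreal (?w k / ?w k powr p) * (ennreal (?Q * ?w k powr p) * normal_moment p)"
      using p by (intro mult_left_mono mode_integrals_moment[OF z \<xi>]) auto
    also have "\<dots> = ennreal (?w k / ?w k powr p * (?Q * ?w k powr p)) * normal_moment p"
      using w by (subst ennreal_mult) (auto simp: mult.assoc)
    \<comment> \<open>The weights cancel by design: the moment bound carries the p-th power of the
      weight, and one power is left over for summation.\<close>
    also have "?w k / ?w k powr p * (?Q * ?w k powr p) = ?Q * ?w k"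
      using w by simp
    finally show "(\<integral>\<^sup>+ \<omega>. ennreal (?w k * (\<bar>\<xi> k \<omega>\<bar> / ?w k) powr p) \<partial>M) \<le> ennreal (?Q * ?w k) * normal_moment p" .
  qed auto
  also have "(\<Sum>k. ennreal (?Q * ?w k) * normal_moment p) = (\<Sum>k. ennreal (?Q * ?w k)) * normal_moment p"
    by simp
  also have "(\<Sum>k. ennreal (?Q * ?w k)) = ennreal (?Q * ?V)"
  proof -
    have "0 \<le> ?Q * ?w k" for k
      using weight_pos[of k] by (intro mult_nonneg_nonneg) auto
    then have "(\<Sum>k. ennreal (?Q * ?w k)) = ennreal (\<Sum>k. ?Q * ?w k)"
      by (rule suminf_ennreal2) (intro summable_mult weight_summable)
    then show ?thesis by (simp only: suminf_mult[OF weight_summable])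
  qed
  also have "ennreal (?V powr (p - 1)) * (ennreal (?Q * ?V) * normal_moment p) =
      ennreal (?V powr (p - 1) * (?Q * ?V)) * normal_moment p"
    by (subst ennreal_mult') (auto simp: mult.assoc)
  also have "?V powr (p - 1) * (?Q * ?V) = moment_const p * (t - \<zeta>) powr (p * (5 * H - 2) / 4)"
    by (simp only: moment_const_def mult_ac)
  finally show ?thesis .
qed

lemma wiener_integral_zero: "wiener_integral (\<lambda>_. 0) (\<lambda>_. 0)"
  unfolding wiener_integral_def
proof (intro conjI exI[of _ "\<lambda>_. []"])
  have "step_fun [] = (\<lambda>_. 0)" "step_noise W [] = (\<lambda>_. 0)" by (rule ext, simp)+
  then show "(\<lambda>n. msq cyl (\<lambda>z. step_fun [] z - 0)) \<longlonglongrightarrow> 0"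
    "(\<lambda>n. msq M (\<lambda>\<omega>. step_noise W [] \<omega> - 0)) \<longlonglongrightarrow> 0"
    by (auto simp: msq_def)
qed auto

text \<open>For each x there is a Wiener integral Y of the Green kernel, but its null sets for
  different x are unrelated. The partial sums converge to Y in mean square and to the series almost
  surely, so the two agree and the series takes over the role of Y.\<close>

lemma noise_integral_mode_series:
  assumes z: "0 \<le> \<zeta>" "\<zeta> \<le> t" "t \<le> T" and \<xi>: "mode_integrals \<zeta> t \<xi>"
  shows "noise_integral M W H T (green_kernel \<zeta> t x) (\<lambda>\<omega>. \<Sum>k. eigenfun k x * \<xi> k \<omega>)"
proof -
  note [measurable] = mode_integrals_measurable[OF \<xi>]
  let ?Z = "\<lambda>\<omega>. \<Sum>k. eigenfun k x * \<xi> k \<omega>" and ?g = "green_kernel \<zeta> t x" and ?C = "cyl"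
  let ?S = "\<lambda>n z. \<Sum>k<n. eigenfun k x * mode_kernel \<zeta> t k z" and ?X = "\<lambda>n \<omega>. \<Sum>k<n. eigenfun k x * \<xi> k \<omega>"
  have gb: "msq ?C (green_bound T \<zeta> t) < \<infinity>"
    using msq_green_bound[OF z] by (rule order.strict_trans1) simp
  have fin: "msq ?C f < \<infinity>" if "\<And>z. \<bar>f z\<bar> \<le> green_bound T \<zeta> t z" for f
  proof -
    have "msq ?C f \<le> msq ?C (green_bound T \<zeta> t)"
      by (rule msq_mono_AE, rule AE_I2, rule order_trans[OF that abs_ge_self])
    then show ?thesis using gb by (rule order.strict_trans1)
  qed
  have g: "?g \<in> borel_measurable borel" "msq ?C ?g < \<infinity>"
    by (rule green_kernel_borel, rule fin, rule green_kernel_le_bound[OF z(1,3)])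
  have S: "?S n \<in> borel_measurable borel" "msq ?C (?S n) < \<infinity>" for n
    by (intro borel_measurable_sum borel_measurable_times borel_measurable_const mode_kernel_borel,
        rule fin, rule sum_mode_kernel_le_bound[OF z(1,3)])
  have wS: "wiener_integral (?S n) (?X n)" for n
  proof (induction n)
    case 0
    then show ?case using wiener_integral_zero by simp
  next
    case (Suc n)
    have "wiener_integral (mode_kernel \<zeta> t n) (\<xi> n)" using \<xi> by (simp add: mode_integrals_def)
    from wiener_integral_add[OF S(1) mode_kernel_borel Suc.IH this] show ?case by simp
  qed
  obtain Y where Y: "wiener_integral ?g Y"
    using wiener_integral_exists[OF g] by blast
  have [measurable]: "Y \<in> borel_measurable M" using Y by (simp add: wiener_integral_def)
  let ?c = "4 * H * T powr (2 * H - 1)"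
  \<comment> \<open>The partial sum minus Y is itself a Wiener integral, up to sign that of the tail
    of the kernel, so the variance bound applies to it.\<close>
  have le: "msq M (\<lambda>\<omega>. ?X n \<omega> - Y \<omega>) \<le> 4 * (ennreal ?c * msq ?C (\<lambda>z. ?S n z - ?g z))" for n
  proof -
    have w: "wiener_integral (\<lambda>z. ?S n z - ?g z) (\<lambda>\<omega>. ?X n \<omega> - Y \<omega>)"
      using wiener_integral_add[OF S(1)[of n] g(1) wS[of n] Y, of "- 1"] by simp
    have d: "(\<lambda>z. ?S n z - ?g z) \<in> borel_measurable borel"
      by (intro borel_measurable_diff S g)
    have "msq M (\<lambda>\<omega>. ?X n \<omega> - Y \<omega>) \<le> 4 * msq ?C (KH (\<lambda>z. ?S n z - ?g z))"
    proof (rule msq_wiener_integral_le[OF d _ w])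
      show "msq ?C (\<lambda>z. ?S n z - ?g z) < \<infinity>"
        using msq_add_finite[OF borel_measurable_cyl[OF S(1)[of n]] borel_measurable_cyl[OF g(1)] S(2)[of n] g(2), of "- 1"] by simp
    qed
    also have "\<dots> \<le> 4 * (ennreal ?c * msq ?C (\<lambda>z. ?S n z - ?g z))"
      by (intro mult_left_mono msq_KH_star_le' d) auto
    finally show ?thesis .
  qed
  have "(\<lambda>n. msq ?C (\<lambda>z. ?S n z - ?g z)) \<longlonglongrightarrow> 0"
  proof (rule msq_dominated[OF _ _ _ _ _ gb])
    show "AE z in ?C. (\<lambda>n. ?S n z) \<longlonglongrightarrow> ?g z"
      by (rule AE_I2, rule sum_mode_kernel_tendsto)
    show "AE z in ?C. \<bar>?S n z\<bar> \<le> green_bound T \<zeta> t z" for n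
      by (rule AE_I2, rule sum_mode_kernel_le_bound[OF z(1,3)])
  qed (rule borel_measurable_cyl, rule S g green_bound_borel)+
  then have "(\<lambda>n. ennreal ?c * msq ?C (\<lambda>z. ?S n z - ?g z)) \<longlonglongrightarrow> ennreal ?c * 0"
    by (rule ennreal_tendsto_cmult[rotated]) simp
  then have "(\<lambda>n. 4 * (ennreal ?c * msq ?C (\<lambda>z. ?S n z - ?g z))) \<longlonglongrightarrow> 4 * (ennreal ?c * 0)"
    by (rule ennreal_tendsto_cmult[rotated]) simp
  then have lim: "(\<lambda>n. 4 * (ennreal ?c * msq ?C (\<lambda>z. ?S n z - ?g z))) \<longlonglongrightarrow> 0"
    by simp
  \<comment> \<open>Almost sure convergence of the partial sums lets Fatou's lemma compare the two
    limits, giving distance 0.\<close>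
  have "msq M (\<lambda>\<omega>. ?Z \<omega> - Y \<omega>) = (\<integral>\<^sup>+ \<omega>. liminf (\<lambda>n. ennreal ((?X n \<omega> - Y \<omega>)\<^sup>2)) \<partial>M)"
    unfolding msq_def
  proof (rule nn_integral_cong_AE)
    show "AE \<omega> in M. ennreal ((?Z \<omega> - Y \<omega>)\<^sup>2) = liminf (\<lambda>n. ennreal ((?X n \<omega> - Y \<omega>)\<^sup>2))"
      using AE_mode_integrals_summable[OF z \<xi>]
    proof eventually_elim
      case (elim \<omega>)
      show ?case
        by (intro lim_imp_Liminf[symmetric] tendsto_ennrealI tendsto_power tendsto_diff tendsto_const
            summable_LIMSEQ abs_eigenfun_series_le(1)[of "\<lambda>k. \<xi> k \<omega>"] elim) simp
    qed
  qed
  also have "\<dots> \<le> liminf (\<lambda>n. msq M (\<lambda>\<omega>. ?X n \<omega> - Y \<omega>))"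
    unfolding msq_def by (rule nn_integral_liminf) measurable
  also have "\<dots> \<le> liminf (\<lambda>n. 4 * (ennreal ?c * msq ?C (\<lambda>z. ?S n z - ?g z)))"
    by (intro Liminf_mono always_eventually allI le)
  also have "\<dots> = 0"
    by (rule lim_imp_Liminf[OF _ lim]) simp
  finally have "msq M (\<lambda>\<omega>. ?Z \<omega> - Y \<omega>) = 0" by simp
  then have eq: "AE \<omega> in M. ?Z \<omega> = Y \<omega>"
    by (intro msq_eq_0_AE) measurable
  have "noise_integral M W H T ?g Y"
    using g Y by (rule wiener_integral_noise_integral)
  then obtain \<Phi> where \<Phi>: "represents H T \<Phi> ?g" "(\<lambda>n. msq M (\<lambda>\<omega>. step_noise W (\<Phi> n) \<omega> - Y \<omega>)) \<longlonglongrightarrow> 0"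
    unfolding noise_integral_def msq_def by auto
  \<comment> \<open>Almost sure equality leaves mean square distances unchanged, so the sequence for
    Y serves the series as well.\<close>
  have "msq M (\<lambda>\<omega>. step_noise W (\<Phi> n) \<omega> - Y \<omega>) = msq M (\<lambda>\<omega>. step_noise W (\<Phi> n) \<omega> - ?Z \<omega>)" for n
    by (rule msq_cong_AE) (use eq in eventually_elim, simp)
  with \<Phi> have "(\<lambda>n. msq M (\<lambda>\<omega>. step_noise W (\<Phi> n) \<omega> - ?Z \<omega>)) \<longlonglongrightarrow> 0" by simp
  moreover have "?Z \<in> borel_measurable M" by measurable
  ultimately show ?thesis
    unfolding noise_integral_def using \<Phi>(1) unfolding msq_def by blast
qed

lemma convolution_version_mode_series:
  assumes z: "0 \<le> \<zeta>" "\<zeta> \<le> t" "t \<le> T" and \<xi>: "mode_integrals \<zeta> t \<xi>"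
  shows "convolution_version M W H T \<zeta> t (\<lambda>\<omega> x. \<Sum>k. eigenfun k x * \<xi> k \<omega>)"
proof -
  note [measurable] = mode_integrals_measurable[OF \<xi>]
  have [measurable]: "eigenfun k \<in> borel_measurable dom_measure" for k
    by (rule measurable_dom) measurable
  have "(\<lambda>(\<omega>, x). \<Sum>k. eigenfun k x * \<xi> k \<omega>) \<in> borel_measurable (M \<Otimes>\<^sub>M dom_measure)"
    by measurable
  then show ?thesis
    unfolding convolution_version_def using noise_integral_mode_series[OF z \<xi>] by auto
qed

text \<open>An arbitrary version agrees with the series almost surely for each fixed x, off a null
  set depending on x. Fubini's theorem exchanges the quantifiers: almost surely the two agree for
  almost every x, and the essential supremum sees no more than that.\<close>

lemma convolution_version_linf_le:
  assumes z: "0 \<le> \<zeta>" "\<zeta> \<le> t" "t \<le> T" and \<xi>: "mode_integrals \<zeta> t \<xi>"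
    and Z: "convolution_version M W H T \<zeta> t Z"
  shows "AE \<omega> in M. linf_norm (Z \<omega>) \<le> ennreal (\<Sum>k. \<bar>\<xi> k \<omega>\<bar>)"
proof -
  interpret D: finite_measure dom_measure by (rule finite_measure_dom)
  interpret P: pair_sigma_finite M dom_measure ..
  let ?Y = "\<lambda>\<omega> x. \<Sum>k. eigenfun k x * \<xi> k \<omega>"
  have Y: "convolution_version M W H T \<zeta> t ?Y"
    using z \<xi> by (rule convolution_version_mode_series)
  have mZ[measurable]: "(\<lambda>(\<omega>, x). Z \<omega> x) \<in> borel_measurable (M \<Otimes>\<^sub>M dom_measure)"
    and mY[measurable]: "(\<lambda>(\<omega>, x). ?Y \<omega> x) \<in> borel_measurable (M \<Otimes>\<^sub>M dom_measure)"
    using Z Y unfolding convolution_version_def by auto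
  have "AE x in dom_measure. AE \<omega> in M. Z \<omega> x = ?Y \<omega> x"
  proof (rule AE_I2)
    fix x assume "x \<in> space dom_measure"
    then have "x \<in> space_dom" by (simp add: dom_measure_def space_restrict_space)
    then show "AE \<omega> in M. Z \<omega> x = ?Y \<omega> x"
      using Z Y unfolding convolution_version_def by (intro noise_integral_unique) auto
  qed
  \<comment> \<open>The exchange needs a measurable agreement set in the product; joint
    measurability of both versions enters here.\<close>
  moreover have "{p \<in> space (M \<Otimes>\<^sub>M dom_measure). Z (fst p) (snd p) = ?Y (fst p) (snd p)} \<in> sets (M \<Otimes>\<^sub>M dom_measure)"
    using mZ mY by (intro borel_measurable_eq) (simp_all add: case_prod_unfold)
  ultimately have "AE \<omega> in M. AE x in dom_measure. Z \<omega> x = ?Y \<omega> x"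
    by (subst P.AE_commute)
  then show ?thesis
    using AE_mode_integrals_summable[OF z \<xi>] AE_space
  proof eventually_elim
    case (elim \<omega>)
    have "Z \<omega> \<in> borel_measurable dom_measure"
      using measurable_compose[OF measurable_Pair1'[OF elim(3)] mZ] by simp
    then have "(\<lambda>x. ennreal \<bar>Z \<omega> x\<bar>) \<in> borel_measurable dom_measure" by measurable
    then show ?case
      unfolding linf_norm_def
    proof (rule esssup_I)
      show "AE x in dom_measure. ennreal \<bar>Z \<omega> x\<bar> \<le> ennreal (\<Sum>k. \<bar>\<xi> k \<omega>\<bar>)"
        using elim(1)
      proof eventually_elim
        case (elim x)
        then show ?case
          using abs_eigenfun_series_le(2)[of "\<lambda>k. \<xi> k \<omega>" x] \<open>summable (\<lambda>k. \<bar>\<xi> k \<omega>\<bar>)\<close> by (simp add: ennreal_leI)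
      qed
    qed
  qed
qed

lemma convolution_version_moment:
  assumes z: "0 \<le> \<zeta>" "\<zeta> \<le> t" "t \<le> T" and p: "1 \<le> p"
    and Z: "convolution_version M W H T \<zeta> t Z"
  shows "(\<integral>\<^sup>+ \<omega>. ennreal_powr (linf_norm (Z \<omega>)) p \<partial>M) \<le>
    ennreal (moment_const p * (t - \<zeta>) powr (p * (5 * H - 2) / 4)) * normal_moment p"
proof -
  obtain \<xi> where \<xi>: "mode_integrals \<zeta> t \<xi>" using z by (rule mode_integrals_exist)
  have "(\<integral>\<^sup>+ \<omega>. ennreal_powr (linf_norm (Z \<omega>)) p \<partial>M) \<le> (\<integral>\<^sup>+ \<omega>. ennreal ((\<Sum>k. \<bar>\<xi> k \<omega>\<bar>) powr p) \<partial>M)"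
  proof (rule nn_integral_mono_AE)
    show "AE \<omega> in M. ennreal_powr (linf_norm (Z \<omega>)) p \<le> ennreal ((\<Sum>k. \<bar>\<xi> k \<omega>\<bar>) powr p)"
      using convolution_version_linf_le[OF z \<xi> Z] AE_mode_integrals_summable[OF z \<xi>]
    proof eventually_elim
      case (elim \<omega>)
      then show ?case using p by (intro ennreal_powr_le suminf_nonneg) auto
    qed
  qed
  also have "\<dots> \<le> ennreal (moment_const p * (t - \<zeta>) powr (p * (5 * H - 2) / 4)) * normal_moment p"
    using z \<xi> p by (rule mode_integrals_sum_moment)
  finally show ?thesis .
qed

end

theorem lemma3p1:
  fixes T H :: real
  assumes "T > 0" and "1 / 2 < H" and "H < 1"
  shows "(\<forall>p::real. p \<ge> 2 \<longrightarrow>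
            (\<exists>c1::real. c1 > 0 \<and>
              (\<forall>(M :: 'w measure) W. fractional_noise M W H T \<longrightarrow>
                (\<forall>\<zeta> t. 0 \<le> \<zeta> \<and> \<zeta> \<le> t \<and> t \<le> T \<longrightarrow>
                  (\<exists>Z. convolution_version M W H T \<zeta> t Z) \<and>
                  (\<forall>Z. convolution_version M W H T \<zeta> t Z \<longrightarrow>
                    (\<integral>\<^sup>+ \<omega>. ennreal_powr (linf_norm (Z \<omega>)) p \<partial>M)
                      \<le> ennreal (c1 * (t - \<zeta>) powr (p * (5 * H - 2) / 4)))))))
       \<and> (\<exists>c2::real. c2 > 0 \<and>
            (\<forall>\<zeta> t. 0 \<le> \<zeta> \<and> \<zeta> \<le> t \<and> t \<le> T \<longrightarrow>
              (\<integral>\<^sup>+ z. (linf_norm (\<lambda>x. KH_star H T (green_kernel \<zeta> t x) z))\<^sup>2 \<partial>cyl_measure T)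
                \<le> ennreal (c2 * (t - \<zeta>) powr ((4 * H - 1) / 2))))"
proof (intro conjI allI impI)
  interpret hurst H T using assms by unfold_locales auto
  let ?c2 = "8 * pi * H * (T powr (1 / 4) + pi)\<^sup>2"
  have "T powr (1 / 4) + pi > 0" by (intro add_nonneg_pos) auto
  then have "?c2 > 0" using H_gt by simp
  then show "\<exists>c2::real. c2 > 0 \<and>
            (\<forall>\<zeta> t. 0 \<le> \<zeta> \<and> \<zeta> \<le> t \<and> t \<le> T \<longrightarrow>
              (\<integral>\<^sup>+ z. (linf_norm (\<lambda>x. KH_star H T (green_kernel \<zeta> t x) z))\<^sup>2 \<partial>cyl_measure T)
                \<le> ennreal (c2 * (t - \<zeta>) powr ((4 * H - 1) / 2)))"
    using linf_KH_star_green by (intro exI[of _ ?c2]) auto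
  fix p :: real assume p: "p \<ge> 2"
  let ?N = "enn2real (normal_moment p)"
  \<comment> \<open>Depends on p, H and T only, so one constant serves every probability space,
    noise and time interval. Only its nonnegativity is established, hence the added 1 in the witness
    below.\<close>
  let ?c = "moment_const p * ?N"
  have V: "0 \<le> (\<Sum>k. weight k)"
    using weight_pos by (intro suminf_nonneg weight_summable less_imp_le)
  have c: "0 \<le> ?c" unfolding moment_const_def by (intro mult_nonneg_nonneg V) auto
  have N: "normal_moment p = ennreal ?N"
    using normal_moment_finite[of p] p by (simp add: ennreal_enn2real)
  show "\<exists>c1::real. c1 > 0 \<and>
              (\<forall>(M :: 'w measure) W. fractional_noise M W H T \<longrightarrow>
                (\<forall>\<zeta> t. 0 \<le> \<zeta> \<and> \<zeta> \<le> t \<and> t \<le> T \<longrightarrow>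
                  (\<exists>Z. convolution_version M W H T \<zeta> t Z) \<and>
                  (\<forall>Z. convolution_version M W H T \<zeta> t Z \<longrightarrow>
                    (\<integral>\<^sup>+ \<omega>. ennreal_powr (linf_norm (Z \<omega>)) p \<partial>M)
                      \<le> ennreal (c1 * (t - \<zeta>) powr (p * (5 * H - 2) / 4)))))"
  proof (intro exI[of _ "?c + 1"] conjI allI impI)
    show "?c + 1 > 0" using c by simp
    fix M :: "'w measure" and W \<zeta> t
    assume "fractional_noise M W H T" and "0 \<le> \<zeta> \<and> \<zeta> \<le> t \<and> t \<le> T"
    then interpret fractional_noise M W H T by simp
    interpret hurst_noise M W H T ..
    have z: "0 \<le> \<zeta>" "\<zeta> \<le> t" "t \<le> T"
      using \<open>0 \<le> \<zeta> \<and> \<zeta> \<le> t \<and> t \<le> T\<close> by auto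
    obtain \<xi> where "mode_integrals \<zeta> t \<xi>" using z by (rule mode_integrals_exist)
    then show "\<exists>Z. convolution_version M W H T \<zeta> t Z"
      by (intro exI, rule convolution_version_mode_series[OF z])
    fix Z assume "convolution_version M W H T \<zeta> t Z"
    with z p have "(\<integral>\<^sup>+ \<omega>. ennreal_powr (linf_norm (Z \<omega>)) p \<partial>M) \<le>
      ennreal (moment_const p * (t - \<zeta>) powr (p * (5 * H - 2) / 4)) * normal_moment p"
      by (intro convolution_version_moment) auto
    also have "\<dots> = ennreal (?c * (t - \<zeta>) powr (p * (5 * H - 2) / 4))"
      by (subst N, subst ennreal_mult''[symmetric]) (simp_all only: enn2real_nonneg mult_ac)
    also have "\<dots> \<le> ennreal ((?c + 1) * (t - \<zeta>) powr (p * (5 * H - 2) / 4))"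
      by (intro ennreal_leI mult_right_mono) auto
    finally show "(\<integral>\<^sup>+ \<omega>. ennreal_powr (linf_norm (Z \<omega>)) p \<partial>M) \<le> ennreal ((?c + 1) * (t - \<zeta>) powr (p * (5 * H - 2) / 4))" .
  qed
qed

end
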